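(* Let $k\ge1$ and let $T_\ast=(T_0\to T_1\to\cdots\to T_{2k})$ be a $2k$-simplex in the category of faces of the Stasheff polyhedron $K^{2k}$ such that $T_0$ is a trivalent planar tree with $2k+3$ leaves and $T_i=T_{i-1}/e_i$, where $e_1,\dots,e_{2k}$ are the internal edges of $T_0$. Give $K^{2k}$ its intrinsic orientation, i.e. the geometric orientation corresponding to the natural orientation of the one-vertex tree $T_{2k}$. Then the sign (degree) of the embedding $\sigma^{2k}:\Delta^{2k}\to K^{2k}$ given by $T_\ast$ is $$\mathrm{sgn}(\sigma^{2k})=\mathrm{sgn}(a_1,a_2,a_3,b_1,b_2,\dots,b_{2k}),$$ the sign of the permutation which puts $a_1,a_2,a_3,b_1,\dots,b_{2k}$ into their correct cyclic order, where these are the $2k+3$ regions of the complement of $T_0$ in the disk in which it is embedded (leaves ending on the boundary), labelled as follows. The two regions bounding $e_1$ are $a_1,a_3$ (in either order). The two other regions touching $e_1$ are $a_2,b_1$, labelled so that $a_1,a_2,a_3,b_1$ are in cyclic order. For $i\ge2$, let $v_i$ be the endpoint of $e_i$ furthest from $e_1$; then $b_i$ is the region which touches $e_i$ only at the point $v_i$.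
   Context: **Stasheff polyhedron.** $K^n$ is the $n$-dimensional convex polyhedron (associahedron) whose points correspond to isomorphism classes of planar metric trees with $n+3$ leaves of fixed length, vertices of valence $\geq 3$ and up to $n$ internal edges of variable length in $(0,1]$; two such trees lie in the same open face iff after collapsing all internal edges of length $<1$ they become isomorphic fixing the leaves. Thus $j$-dimensional faces correspond to planar trees with $n+3$ fixed leaves and $n-j$ internal edges; vertices correspond to trivalent trees, the top cell to the one-vertex tree. The category of faces has inclusions as morphisms; $T\to T'$ means $T'$ is obtained from $T$ by collapsing internal edges. Its nerve triangulates $K^n$: each object is sent to a point in the interior of the corresponding face and one extends linearly over simplices; this gives the embedding $\Delta^n\to K^n$ associated with an $n$-simplex $T_0\to\cdots\to T_n$ ($\Delta^n$ oriented by its vertex order). **Orientations of trees.** An orientation of a tree is an orientation of the vector space spanned by its vertices and its half-edges (leaves count as half-edges). If the orientation is $v_1v_2\,e^-e^+\cdots$ with $e$ an internal edge from $v_1$ to $v_2$, the induced orientation of $T/e$ is $v_\ast\cdots$ with $v_\ast$ the merged vertex and the rest unchanged. A planar tree with all valences odd has a natural (intrinsic) orientation: each vertex followed by its incident half-edges in counterclockwise cyclic order. **Geometric orientation.** Let $T_0$ be trivalent with internal edges $e_1,\dots,e_n$ of lengths $x_1,\dots,x_n$, and let $T_n$ be the one-vertex tree with the orientation induced from the natural orientation of $T_0$ by collapsing $e_1,\dots,e_n$ in that order. The orientation of $K^n$ corresponding to this orientation of $T_n$ is the one given, near the vertex $T_0$, by the coordinates $(x_n,x_{n-1},\dots,x_1)$.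 Reversing the orientation of $T_n$ reverses that of $K^n$. Regions and leaves are cyclically ordered counterclockwise around the disk; since the number $2k+3$ of regions is odd, the sign of a permutation to cyclic order is well defined. *)

theory Defs
  imports
    "HOL-Analysis.Analysis"
    "HOL-Combinatorics.Combinatorics"
    "HOL-Homology.Simplices"
    "Jordan_Normal_Form.Determinant"
begin

section \<open>Planar trees\<close>

text \<open>
  A planar tree is encoded as a ribbon graph on its half-edges (darts): \<open>rot\<close> sends a half-edge
  to the next one counterclockwise around its vertex, \<open>flip\<close> exchanges the two halves of an
  internal edge and fixes the leaves. Vertices are the orbits of \<open>rot\<close>. The leaves are fixed,
  so they carry the same names \<open>Leaf 0, Leaf 1, \<dots>\<close> in all trees.
\<close>

datatype dart = is_leaf: Leaf nat | Inner nat

record ptree =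
  darts :: "dart set"
  rot :: "dart \<Rightarrow> dart"
  flip :: "dart \<Rightarrow> dart"

type_synonym vertex = "dart set"
type_synonym edge = "dart set"
type_synonym region = "dart set"

definition vertex_of :: "ptree \<Rightarrow> dart \<Rightarrow> vertex" where
  "vertex_of T h = orbit (rot T) h"

definition vertices :: "ptree \<Rightarrow> vertex set" where
  "vertices T = vertex_of T ` darts T"

text \<open>Internal edges only; leaves are not edges.\<close>

definition edges :: "ptree \<Rightarrow> edge set" where
  "edges T = {{h, flip T h} | h. h \<in> darts T \<and> \<not> is_leaf h}"

definition endpoints :: "ptree \<Rightarrow> edge \<Rightarrow> vertex set" where
  "endpoints T E = vertex_of T ` E"

definition adj :: "ptree \<Rightarrow> edge set \<Rightarrow> (vertex \<times> vertex) set" where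
  "adj T \<E> = {(vertex_of T h, vertex_of T (flip T h)) | h. {h, flip T h} \<in> \<E>}"

text \<open>
  A half-edge \<open>h\<close> also denotes the corner between \<open>h\<close> and \<open>rot T h\<close>. Walking outwards along the
  clockwise side of an internal \<open>rot T h\<close>, the next corner of the same region is
  \<open>flip T (rot T h)\<close>; along a leaf the walk ends on the boundary of the disk. A region of the
  complement of the tree in the disk is represented by the set of its corners. It starts at
  the corner \<open>Leaf i\<close> and ends at the next leaf counterclockwise.
\<close>

definition corner_step :: "ptree \<Rightarrow> (dart \<times> dart) set" where
  "corner_step T = {(h, flip T (rot T h)) | h. h \<in> darts T \<and> \<not> is_leaf (rot T h)}"

definition region_of :: "ptree \<Rightarrow> dart \<Rightarrow> region" where
  "region_of T h = {g. (h, g) \<in> (corner_step T \<union> (corner_step T)\<inverse>)\<^sup>*}"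

definition regions :: "ptree \<Rightarrow> region set" where
  "regions T = region_of T ` darts T"

text \<open>
  Planar trees with leaves \<open>Leaf 0, \<dots>, Leaf (n + 2)\<close> in counterclockwise order around the disk
  and all valences at least 3. Acyclicity says that no internal edge lies on a cycle.
\<close>

definition planar_tree :: "nat \<Rightarrow> ptree \<Rightarrow> bool" where
  "planar_tree n T \<longleftrightarrow>
     finite (darts T) \<and>
     rot T permutes darts T \<and>
     flip T permutes darts T \<and>
     (\<forall>h\<in>darts T. flip T (flip T h) = h \<and> (flip T h = h \<longleftrightarrow> is_leaf h)) \<and>
     {h \<in> darts T. is_leaf h} = Leaf ` {..<n + 3} \<and>
     (\<forall>v\<in>vertices T. card v \<ge> 3) \<and>
     (\<forall>u\<in>vertices T. \<forall>v\<in>vertices T. (u, v) \<in> (adj T (edges T))\<^sup>*) \<and>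
     (\<forall>h\<in>darts T. \<not> is_leaf h \<longrightarrow>
        (vertex_of T h, vertex_of T (flip T h)) \<notin> (adj T (edges T - {{h, flip T h}}))\<^sup>*) \<and>
     (\<forall>i<n + 3. \<exists>h\<in>region_of T (Leaf i). rot T h = Leaf ((i + 1) mod (n + 3)))"

definition trivalent_tree :: "nat \<Rightarrow> ptree \<Rightarrow> bool" where
  "trivalent_tree n T \<longleftrightarrow> planar_tree n T \<and> (\<forall>v\<in>vertices T. card v = 3)"

definition tree_iso_map :: "ptree \<Rightarrow> ptree \<Rightarrow> (dart \<Rightarrow> dart) \<Rightarrow> bool" where
  "tree_iso_map T T' f \<longleftrightarrow>
     bij_betw f (darts T) (darts T') \<and>
     (\<forall>h\<in>darts T. f (rot T h) = rot T' (f h) \<and> f (flip T h) = flip T' (f h)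
                  \<and> (is_leaf h \<longrightarrow> f h = h))"

definition tree_iso :: "ptree \<Rightarrow> ptree \<Rightarrow> bool" where
  "tree_iso T T' \<longleftrightarrow> (\<exists>f. tree_iso_map T T' f)"

text \<open>
  Collapse of the internal edges whose half-edges form \<open>S\<close> (so \<open>T/e\<close> is \<open>contract T e\<close>). The
  counterclockwise successor of \<open>h\<close> is found by walking around the collapsed subtree until a
  surviving half-edge is met.
\<close>

definition contract :: "ptree \<Rightarrow> dart set \<Rightarrow> ptree" where
  "contract T S =
     (let walk = (\<lambda>h j. ((rot T \<circ> flip T) ^^ j) (rot T h)) in
      \<lparr>darts = darts T - S,
       rot = (\<lambda>h. if h \<in> darts T - S then walk h (LEAST j. walk h j \<notin> S) else h),
       flip = (\<lambda>h. if h \<in> darts T - S then flip T h else h)\<rparr>)"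

definition vertex_dist :: "ptree \<Rightarrow> vertex \<Rightarrow> vertex \<Rightarrow> nat" where
  "vertex_dist T u v = (LEAST j. (u, v) \<in> adj T (edges T) ^^ j)"

definition edge_dist :: "ptree \<Rightarrow> edge \<Rightarrow> vertex \<Rightarrow> nat" where
  "edge_dist T E v = Min ((\<lambda>u. vertex_dist T u v) ` endpoints T E)"

definition far_endpoint :: "ptree \<Rightarrow> edge \<Rightarrow> edge \<Rightarrow> vertex \<Rightarrow> bool" where
  "far_endpoint T E\<^sub>1 E v \<longleftrightarrow>
     v \<in> endpoints T E \<and> (\<forall>u\<in>endpoints T E - {v}. edge_dist T E\<^sub>1 u < edge_dist T E\<^sub>1 v)"


section \<open>Regions\<close>

text \<open>
  In a corner representation, the regions on the two sides of an edge \<open>{h, flip T h}\<close> are those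
  containing the corners \<open>h\<close> and \<open>flip T h\<close>. A region touches a vertex if it has a corner there;
  it meets the open edge only if it bounds the edge, and then it has a corner at both endpoints.
\<close>

definition bounding_regions :: "ptree \<Rightarrow> edge \<Rightarrow> region set" where
  "bounding_regions T E = region_of T ` E"

definition touching_regions :: "ptree \<Rightarrow> edge \<Rightarrow> region set" where
  "touching_regions T E = {R \<in> regions T. \<exists>v\<in>endpoints T E. R \<inter> v \<noteq> {}}"

definition touches_only_at :: "ptree \<Rightarrow> region \<Rightarrow> edge \<Rightarrow> vertex \<Rightarrow> bool" where
  "touches_only_at T R E v \<longleftrightarrow>
     R \<in> touching_regions T E \<and> R \<notin> bounding_regions T E \<and>
     {u \<in> endpoints T E. R \<inter> u \<noteq> {}} = {v}"

text \<open>
  The \<open>n + 3\<close> regions in counterclockwise order. The starting point is immaterial for signs when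
  \<open>n + 3\<close> is odd.
\<close>

definition ccw_regions :: "nat \<Rightarrow> ptree \<Rightarrow> region list" where
  "ccw_regions n T = map (\<lambda>i. region_of T (Leaf i)) [0..<n + 3]"

definition in_cyclic_order :: "'a list \<Rightarrow> 'a list \<Rightarrow> bool" where
  "in_cyclic_order cyc xs \<longleftrightarrow>
     (\<exists>r is. sorted_wrt (<) is \<and> set is \<subseteq> {..<length cyc} \<and> rotate r xs = map (nth cyc) is)"


section \<open>Orientations of trees\<close>

text \<open>Sign of the permutation that rearranges the distinct list \<open>xs\<close> into \<open>ys\<close>.\<close>

definition word_sign :: "'a list \<Rightarrow> 'a list \<Rightarrow> int" where
  "word_sign xs ys = sign (THE p. p permutes {..<length xs} \<and> permute_list p xs = ys)"

text \<open>
  An orientation of the vector space spanned by the vertices and half-edges is represented by an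
  ordering of this basis; two orderings give the same orientation iff they differ by an even
  permutation.
\<close>

datatype cell = Vertex vertex | Half dart

definition cells :: "ptree \<Rightarrow> cell set" where
  "cells T = Vertex ` vertices T \<union> Half ` darts T"

definition orientation_word :: "ptree \<Rightarrow> cell list \<Rightarrow> bool" where
  "orientation_word T \<omega> \<longleftrightarrow> distinct \<omega> \<and> set \<omega> = cells T"

definition same_orientation :: "ptree \<Rightarrow> cell list \<Rightarrow> cell list \<Rightarrow> bool" where
  "same_orientation T \<omega> \<omega>' \<longleftrightarrow>
     orientation_word T \<omega> \<and> orientation_word T \<omega>' \<and> word_sign \<omega> \<omega>' = 1"

text \<open>
  \<open>\<omega> = v\<^sub>1 v\<^sub>2 e\<^sup>- e\<^sup>+ \<dots>\<close> induces \<open>\<omega>' = v\<^sub>* \<dots>\<close> on \<open>T/E\<close>, where the half-edge \<open>h = e\<^sup>-\<close> is at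
  \<open>v\<^sub>1\<close> and \<open>flip T h = e\<^sup>+\<close> is at \<open>v\<^sub>2\<close>.
\<close>

definition induced_orientation :: "ptree \<Rightarrow> edge \<Rightarrow> cell list \<Rightarrow> cell list \<Rightarrow> bool" where
  "induced_orientation T E \<omega> \<omega>' \<longleftrightarrow>
     E \<in> edges T \<and>
     (\<exists>h\<in>E. \<exists>rest.
        let v\<^sub>1 = vertex_of T h; v\<^sub>2 = vertex_of T (flip T h) in
        same_orientation T \<omega>
          (Vertex v\<^sub>1 # Vertex v\<^sub>2 # Half h # Half (flip T h) # rest) \<and>
        same_orientation (contract T E) \<omega>' (Vertex (v\<^sub>1 \<union> v\<^sub>2 - E) # rest))"

text \<open>
  The natural orientation of a tree with all valences odd: every vertex is followed by its
  half-edges in counterclockwise order. The list \<open>hs\<close> picks one half-edge at every vertex.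
\<close>

definition vertex_block :: "ptree \<Rightarrow> dart \<Rightarrow> cell list" where
  "vertex_block T h =
     Vertex (vertex_of T h) # map (\<lambda>j. Half ((rot T ^^ j) h)) [0..<card (vertex_of T h)]"

definition natural_orientation :: "ptree \<Rightarrow> cell list \<Rightarrow> bool" where
  "natural_orientation T \<omega> \<longleftrightarrow>
     (\<forall>v\<in>vertices T. odd (card v)) \<and>
     (\<exists>hs. set hs \<subseteq> darts T \<and> distinct (map (vertex_of T) hs) \<and>
           vertex_of T ` set hs = vertices T \<and>
           same_orientation T \<omega> (concat (map (vertex_block T) hs)))"


section \<open>The Stasheff polyhedron\<close>

type_synonym mtree = "ptree \<times> (edge \<Rightarrow> real)"

definition metric_tree :: "nat \<Rightarrow> mtree \<Rightarrow> bool" where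
  "metric_tree n = (\<lambda>(T, len). planar_tree n T \<and> (\<forall>E\<in>edges T. 0 < len E \<and> len E \<le> 1))"

definition metric_iso :: "mtree \<Rightarrow> mtree \<Rightarrow> bool" where
  "metric_iso = (\<lambda>(T, len) (T', len').
     \<exists>f. tree_iso_map T T' f \<and> (\<forall>E\<in>edges T. len' (f ` E) = len E))"

text \<open>The combinatorial tree obtained by collapsing all internal edges of length less than 1.\<close>

definition core :: "mtree \<Rightarrow> ptree" where
  "core = (\<lambda>(T, len). contract T (\<Union>{E \<in> edges T. len E < 1}))"

text \<open>For lengths in \<open>[0,1]\<close>: edges of length 0 are collapsed.\<close>

definition degenerate :: "ptree \<Rightarrow> (edge \<Rightarrow> real) \<Rightarrow> mtree" where
  "degenerate T len = (contract T (\<Union>{E \<in> edges T. len E = 0}), len)"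

definition open_face :: "nat \<Rightarrow> (mtree \<Rightarrow> 'v) \<Rightarrow> ptree \<Rightarrow> 'v set" where
  "open_face n pt T = pt ` {M. metric_tree n M \<and> tree_iso (core M) T}"

text \<open>
  The curve through the vertex of the polyhedron given by a trivalent tree \<open>T\<close>, along which only
  the length of \<open>E\<close> varies, and its (one-sided) velocity: the coordinate vector
  \<open>\<partial>/\<partial>x\<^sub>E\<close> of the length coordinates at that vertex, where all lengths are 1.
\<close>

definition length_curve :: "(mtree \<Rightarrow> 'v) \<Rightarrow> ptree \<Rightarrow> edge \<Rightarrow> real \<Rightarrow> 'v" where
  "length_curve pt T E t = pt (T, (\<lambda>_. 1)(E := t))"

definition length_tangent :: "(mtree \<Rightarrow> 'v::real_normed_vector) \<Rightarrow> ptree \<Rightarrow> edge \<Rightarrow> 'v" where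
  "length_tangent pt T E = vector_derivative (length_curve pt T E) (at 1 within {0<..1})"

text \<open>
  \<open>P\<close> is the polyhedron \<open>K\<^sup>n\<close>, realised as a convex polytope of full dimension in an
  \<open>n\<close>-dimensional Euclidean space, and \<open>pt\<close> is the correspondence between isomorphism classes of
  metric trees and points of \<open>P\<close>. The conditions say, in this order:
  points are isomorphism classes; the open faces of \<open>P\<close> are the classes of metric trees with
  isomorphic core; inclusion of faces is collapse of edges; \<open>pt\<close> is continuous in the lengths; the
  lengths are coordinates near the vertices (the coordinate vectors exist and are independent),
  which is what gives a meaning to the orientation defined by these coordinates.
\<close>

definition stasheff_polytope ::
  "nat \<Rightarrow> 'v::euclidean_space set \<Rightarrow> (mtree \<Rightarrow> 'v) \<Rightarrow> bool" where
  "stasheff_polytope n P pt \<longleftrightarrow>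
     DIM('v) = n \<and> polytope P \<and> aff_dim P = int n \<and>
     pt ` {M. metric_tree n M} = P \<and>
     (\<forall>M M'. metric_tree n M \<longrightarrow> metric_tree n M' \<longrightarrow> (pt M = pt M' \<longleftrightarrow> metric_iso M M')) \<and>
     (\<forall>M M'. metric_tree n M \<longrightarrow> metric_tree n M' \<longrightarrow>
        ((\<exists>F. F face_of P \<and> pt M \<in> rel_interior F \<and> pt M' \<in> rel_interior F)
           \<longleftrightarrow> tree_iso (core M) (core M'))) \<and>
     (\<forall>T T'. planar_tree n T \<longrightarrow> planar_tree n T' \<longrightarrow>
        (closure (open_face n pt T) \<subseteq> closure (open_face n pt T')
           \<longleftrightarrow> (\<exists>\<E>\<subseteq>edges T. tree_iso (contract T (\<Union>\<E>)) T'))) \<and>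
     (\<forall>T. trivalent_tree n T \<longrightarrow>
        continuous_on {len. \<forall>E\<in>edges T. 0 \<le> len E \<and> len E \<le> 1} (\<lambda>len. pt (degenerate T len))) \<and>
     (\<forall>T. trivalent_tree n T \<longrightarrow>
        (\<forall>E\<in>edges T. length_curve pt T E differentiable (at 1 within {0<..1})) \<and>
        inj_on (length_tangent pt T) (edges T) \<and>
        independent (length_tangent pt T ` edges T))"

text \<open>
  A chain \<open>T 0 \<rightarrow> T 1 \<rightarrow> \<dots> \<rightarrow> T n\<close> of faces from a trivalent tree to the one-vertex tree, where
  \<open>e 1, \<dots>, e n\<close> are the internal edges of \<open>T 0\<close>. Half-edges keep their names under collapse, so
  \<open>e i\<close> is also an edge of \<open>T (i - 1)\<close>.
\<close>

definition full_chain :: "nat \<Rightarrow> (nat \<Rightarrow> ptree) \<Rightarrow> (nat \<Rightarrow> edge) \<Rightarrow> bool" where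
  "full_chain n T e \<longleftrightarrow>
     trivalent_tree n (T 0) \<and> bij_betw e {1..n} (edges (T 0)) \<and>
     (\<forall>i\<in>{1..n}. T i = contract (T (i - 1)) (e i))"


section \<open>Orientations of the polyhedron\<close>

text \<open>
  An orientation of the full-dimensional polytope is an orientation of the ambient space, and is
  represented by an ordered basis.
\<close>

definition ordered_basis :: "'v::euclidean_space list \<Rightarrow> bool" where
  "ordered_basis B \<longleftrightarrow> distinct B \<and> independent (set B) \<and> length B = DIM('v)"

text \<open>Sign of the determinant whose columns are the coordinates of \<open>C\<close> in the ordered basis \<open>B\<close>.\<close>

definition frame_sign :: "'v::euclidean_space list \<Rightarrow> 'v list \<Rightarrow> real" where
  "frame_sign B C =
     sgn (Determinant.det (Matrix.mat (length B) (length B)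
       (\<lambda>(i, j). representation (set B) (C ! j) (B ! i))))"

text \<open>
  The ordered basis \<open>B\<close> represents the geometric orientation corresponding to the orientation
  \<open>\<omega>\<close> of the one-vertex tree: for every trivalent tree and every order of its edges,
  the orientation by the coordinates \<open>(x\<^sub>n, \<dots>, x\<^sub>1)\<close> agrees with \<open>B\<close> if the orientation of the
  one-vertex tree induced from the natural one of \<open>T 0\<close> is \<open>\<omega>\<close>, and is opposite to it otherwise.
\<close>

definition geometric_orientation ::
  "nat \<Rightarrow> (mtree \<Rightarrow> 'v::euclidean_space) \<Rightarrow> cell list \<Rightarrow> 'v list \<Rightarrow> bool" where
  "geometric_orientation n pt \<omega> B \<longleftrightarrow>
     ordered_basis B \<and>
     (\<forall>T e W. full_chain n T e \<longrightarrow>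
        natural_orientation (T 0) (W 0) \<longrightarrow>
        (\<forall>i\<in>{1..n}. induced_orientation (T (i - 1)) (e i) (W (i - 1)) (W i)) \<longrightarrow>
        frame_sign B (map (\<lambda>i. length_tangent pt (T 0) (e i)) (rev [1..<Suc n]))
          = of_int (word_sign (W n) \<omega>))"

text \<open>Linear extension over the simplex of an assignment of points to its vertices.\<close>

definition simplex_embedding :: "nat \<Rightarrow> (nat \<Rightarrow> 'v::real_vector) \<Rightarrow> (nat \<Rightarrow> real) \<Rightarrow> 'v" where
  "simplex_embedding n x = (\<lambda>t\<in>standard_simplex n. \<Sum>i\<le>n. t i *\<^sub>R x i)"

definition simplex_vertex :: "nat \<Rightarrow> nat \<Rightarrow> real" where
  "simplex_vertex i = (\<lambda>j. if j = i then 1 else 0)"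

text \<open>
  Sign of an affine map from the standard simplex to the space oriented by \<open>B\<close>. The simplex is
  oriented by its vertex order, i.e. by the edge vectors from vertex 0 to the vertices \<open>1, \<dots>, n\<close>.
\<close>

definition simplex_sign ::
  "'v::euclidean_space list \<Rightarrow> nat \<Rightarrow> ((nat \<Rightarrow> real) \<Rightarrow> 'v) \<Rightarrow> real" where
  "simplex_sign B n \<sigma> =
     frame_sign B (map (\<lambda>i. \<sigma> (simplex_vertex i) - \<sigma> (simplex_vertex 0)) [1..<Suc n])"

end

theory Submission
  imports Defs
begin

text \<open>
  Write \<open>n = 2 k\<close>. Both signs are computed from orientation words of the trees \<open>T 0, \<dots>, T n\<close>.

  \<^emph>\<open>Geometry.\<close> The faces belonging to \<open>T 0, \<dots>, T n\<close> form a complete flag, so the \<open>i\<close>-th one has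
  dimension \<open>i\<close>, and the velocities \<open>t 1, \<dots>, t i\<close> of the length coordinates at the vertex \<open>T 0\<close>
  span its directions. All lengths are maximal at the vertex and decrease into the polyhedron.
  Hence, with respect to the basis \<open>t\<close>, the vector from \<open>x 0\<close> to \<open>x i\<close> has no coordinate beyond the
  \<open>i\<close>-th, and its \<open>i\<close>-th coordinate is negative (\<open>flag_coordinates\<close>). The change of basis is
  triangular with \<open>n\<close> negative diagonal entries, and \<open>n\<close> is even, so the simplex has the sign of the
  frame \<open>t 1, \<dots>, t n\<close>. The geometric orientation is given by the reversed frame \<open>t n, \<dots>, t 1\<close>; the
  reversal contributes \<open>(-1)^k\<close> (\<open>simplex_sign_eq\<close>).

  \<^emph>\<open>Combinatorics.\<close> Root \<open>T 0\<close> at the endpoint of \<open>e 1\<close> whose corners lie in \<open>a\<^sub>1, a\<^sub>2, a\<^sub>3\<close>. Every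
  other vertex \<open>w i\<close> is the far endpoint of exactly one edge \<open>e i\<close>; let \<open>u i\<close> be the half of \<open>e i\<close> at
  \<open>w i\<close>, let \<open>d i\<close> be its other half, and let \<open>u i, p i, q i\<close> be the half-edges at \<open>w i\<close> in
  counterclockwise order. Then \<open>b i\<close> is the region at the corner \<open>p i\<close>. In a word of the form
  \<open>v (w 1, d 1, u 1) \<dots> (w n, d n, u n) L\<close>,
  where \<open>L\<close> lists the leaves, collapsing \<open>e 1, e 2, \<dots>\<close> in this order amounts to deleting the triples
  one after the other (\<open>induced_chain_word_step\<close>), and \<open>v L\<close> remains on the one-vertex tree. So the
  question is how such a word compares with the natural orientation
  \<open>(v, h, h', h'') (w 1, u 1, p 1, q 1) \<dots> (w n, u n, p n, q n)\<close>, where \<open>h, h', h''\<close> are the half-edges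
  at the root. The corners \<open>q i\<close> and \<open>d i\<close> lie in the same region. Exchanging half-edges along these \<open>n\<close>
  coincidences, one at a time, replaces every \<open>q i\<close> by \<open>d i\<close> and each of the half-edges
  \<open>h, h', h'', p 1, \<dots>, p n\<close> by the leaf at which its region starts (\<open>to_leaf_invariant\<close>); this is a
  product of \<open>n\<close> transpositions, hence even. Moving the triples to the front costs \<open>(-1)^k\<close>
  (\<open>chain_word_sign\<close>), which cancels the factor from the reversal of the frame. The resulting list
  \<open>L\<close> consists of the leaves at which the regions \<open>a\<^sub>1, a\<^sub>2, a\<^sub>3, b 1, \<dots>, b n\<close> start, so comparing \<open>L\<close>
  with the counterclockwise order of the leaves is the same as sorting the regions.

  That the corners of \<open>a\<^sub>2\<close> and \<open>b 1\<close> are at the expected ends of \<open>e 1\<close> follows from the assumption on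
  the cyclic order of \<open>a\<^sub>1, a\<^sub>2, a\<^sub>3, b 1\<close>, because \<open>e 1\<close> separates the leaves into two intervals of the
  cyclic order (\<open>not_reversed_order\<close>).
\<close>

section \<open>Signs of rearrangements of words\<close>

lemma word_sign_permute_list:
  assumes "distinct xs" "p permutes {..<length xs}"
  shows "word_sign xs (permute_list p xs) = sign p"
proof -
  have "q = p" if q: "q permutes {..<length xs}" "permute_list q xs = permute_list p xs" for q
  proof
    fix i show "q i = p i"
    proof (cases "i < length xs")
      case True
      have "xs ! q i = xs ! p i"
        using permute_list_nth[OF q(1) True] permute_list_nth[OF assms(2) True] q(2) by simp
      moreover have "q i < length xs" "p i < length xs"
        using True permutes_in_image[OF q(1)] permutes_in_image[OF assms(2)] by auto
      ultimately show ?thesis using assms(1) by (simp add: nth_eq_iff_index_eq)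
    next
      case False
      then show ?thesis using permutes_not_in[OF q(1)] permutes_not_in[OF assms(2)] by simp
    qed
  qed
  then have "(THE q. q permutes {..<length xs} \<and> permute_list q xs = permute_list p xs) = p"
    using assms(2) by (intro the_equality) auto
  then show ?thesis unfolding word_sign_def by simp
qed

lemma ex_permute_list:
  assumes "distinct xs" "distinct ys" "set xs = set ys"
  obtains p where "p permutes {..<length xs}" "permute_list p xs = ys"
proof -
  have "mset ys = mset xs" using assms by (simp add: set_eq_iff_mset_eq_distinct)
  then show ?thesis using that mset_eq_permutation by metis
qed

lemma word_sign_trans:
  assumes "distinct xs" "distinct ys" "distinct zs" "set xs = set ys" "set ys = set zs"
  shows "word_sign xs zs = word_sign xs ys * word_sign ys zs"
proof -
  obtain p where p: "p permutes {..<length xs}" "permute_list p xs = ys"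
    using ex_permute_list assms by metis
  obtain q where q: "q permutes {..<length ys}" "permute_list q ys = zs"
    using ex_permute_list assms by metis
  have len: "length ys = length xs" using p(2) by auto
  have zs: "zs = permute_list (p \<circ> q) xs"
    using p q len by (simp add: permute_list_compose)
  have "(p \<circ> q) permutes {..<length xs}" using p(1) q(1) len by (simp add: permutes_compose)
  then have "word_sign xs zs = sign (p \<circ> q)" using zs word_sign_permute_list assms(1) by blast
  also have "\<dots> = sign p * sign q"
    using p(1) q(1) by (intro sign_compose) (auto simp: permutation_permutes)
  also have "sign p = word_sign xs ys" using word_sign_permute_list[OF assms(1) p(1)] p(2) by simp
  also have "sign q = word_sign ys zs" using word_sign_permute_list[OF assms(2) q(1)] q(2) by simp
  finally show ?thesis .
qed

lemma word_sign_refl: "distinct xs \<Longrightarrow> word_sign xs xs = 1"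
  using word_sign_permute_list[of xs id] permutes_id by (simp add: sign_id)

lemma word_sign_cases:
  assumes "distinct xs" "distinct ys" "set xs = set ys"
  shows "word_sign xs ys = 1 \<or> word_sign xs ys = -1"
proof -
  obtain p where "p permutes {..<length xs}" "permute_list p xs = ys"
    using ex_permute_list assms by metis
  then show ?thesis using word_sign_permute_list[OF assms(1)] by (auto simp: sign_def split: if_splits)
qed

lemma word_sign_sym:
  assumes "distinct xs" "distinct ys" "set xs = set ys"
  shows "word_sign ys xs = word_sign xs ys"
proof -
  have "word_sign xs xs = word_sign xs ys * word_sign ys xs"
    by (rule word_sign_trans) (use assms in auto)
  then show ?thesis
    using word_sign_refl[OF assms(1)] word_sign_cases[OF assms] by auto
qed

text \<open>
  A word sign is defined by permuting positions. For a word without repetitions one can permute the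
  letters instead, because the two permutations are conjugate by the bijection from positions to
  letters. This makes it easy to ignore the letters that do not move.
\<close>

lemma word_sign_map_permutes:
  assumes "distinct xs" "\<sigma> permutes set xs"
  shows "word_sign xs (map \<sigma> xs) = sign \<sigma>"
proof -
  define f where "f = (!) xs"
  have inj: "inj_on f {..<length xs}" 
    using assms(1) unfolding f_def by (simp add: inj_on_nth)
  have im: "f ` {..<length xs} = set xs" unfolding f_def
    by (metis atLeast_upt set_map map_nth)
  have "distinct (map \<sigma> xs)" using assms permutes_inj_on distinct_map by blast
  moreover have "set (map \<sigma> xs) = set xs" using assms(2) by (simp add: permutes_image)
  ultimately obtain p where p: "p permutes {..<length xs}" "permute_list p xs = map \<sigma> xs"
    using ex_permute_list[OF assms(1)] by metis
  have "map_permutation {..<length xs} f p = \<sigma>"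
  proof
    fix x
    show "map_permutation {..<length xs} f p x = \<sigma> x"
    proof (cases "x \<in> set xs")
      case True
      then obtain i where i: "i < length xs" "x = f i" unfolding f_def by (metis in_set_conv_nth)
      have "map_permutation {..<length xs} f p x = f (p i)"
        unfolding map_permutation_def using i inj im True by (simp add: restrict_id_def)
      also have "\<dots> = permute_list p xs ! i" using permute_list_nth[OF p(1) i(1)] f_def by simp
      also have "\<dots> = \<sigma> x" using p(2) i f_def by simp
      finally show ?thesis .
    next
      case False
      then show ?thesis using im permutes_not_in[OF assms(2)]
        by (simp add: map_permutation_def restrict_id_def)
    qed
  qed
  moreover have "sign (map_permutation {..<length xs} f p) = sign p"
    using sign_map_permutation[OF inj p(1)] by simp
  ultimately show ?thesis using word_sign_permute_list[OF assms(1) p(1)] p(2) by simp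
qed

lemma ex_map_permutes:
  assumes "distinct xs" "distinct ys" "set xs = set ys"
  obtains \<sigma> where "\<sigma> permutes set xs" "map \<sigma> xs = ys"
proof -
  define \<sigma> where "\<sigma> x = (if x \<in> set xs then the (map_of (zip xs ys) x) else x)" for x
  have len: "length xs = length ys" using assms by (metis distinct_card)
  have nth: "\<sigma> (xs ! i) = ys ! i" if "i < length xs" for i
    using that len assms(1) by (simp add: \<sigma>_def map_of_zip_nth)
  have map: "map \<sigma> xs = ys" using nth len by (simp add: list_eq_iff_nth_eq)
  have "inj_on \<sigma> (set xs)" using map assms distinct_map by metis
  moreover have "\<sigma> ` set xs = set xs" using map assms by (metis set_map)
  ultimately have "\<sigma> permutes set xs"
    by (intro bij_imp_permutes) (auto simp: bij_betw_def \<sigma>_def)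
  then show ?thesis using that map by blast
qed

text \<open>
  A permutation of the letters of \<open>xs\<close> fixes all other letters.
\<close>

lemma word_sign_context:
  assumes "distinct (as @ xs @ bs)" "distinct ys" "set xs = set ys"
  shows "word_sign (as @ xs @ bs) (as @ ys @ bs) = word_sign xs ys"
proof -
  obtain \<sigma> where s: "\<sigma> permutes set xs" "map \<sigma> xs = ys"
    by (rule ex_map_permutes[of xs ys]) (use assms in auto)
  have "map \<sigma> as = as" "map \<sigma> bs = bs"
    using assms(1) permutes_not_in[OF s(1)] by (auto intro!: map_idI)
  moreover have "\<sigma> permutes set (as @ xs @ bs)" using s(1) by (rule permutes_subset) auto
  ultimately have "word_sign (as @ xs @ bs) (as @ ys @ bs) = sign \<sigma>"
    using word_sign_map_permutes[OF assms(1), of \<sigma>] s(2) by simp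
  also have "\<dots> = word_sign xs ys" using word_sign_map_permutes[of xs \<sigma>] s assms(1) by simp
  finally show ?thesis .
qed

lemma word_sign_map_inj:
  assumes "inj_on f (set xs)" "distinct xs" "distinct ys" "set xs = set ys"
  shows "word_sign (map f xs) (map f ys) = word_sign xs ys"
proof -
  obtain p where p: "p permutes {..<length xs}" "permute_list p xs = ys"
    using ex_permute_list assms by metis
  have "distinct (map f xs)" using assms by (simp add: distinct_map)
  then have "word_sign (map f xs) (permute_list p (map f xs)) = sign p"
    using word_sign_permute_list p(1) by (metis length_map)
  moreover have "permute_list p (map f xs) = map f ys" using permute_list_map[OF p(1)] p(2) by simp
  ultimately show ?thesis using word_sign_permute_list[OF assms(2) p(1)] p(2) by simp
qed

lemma word_sign_swap_values:
  assumes "distinct xs" "x \<in> set xs" "y \<in> set xs" "x \<noteq> y"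
  shows "word_sign xs (map (Transposition.transpose x y) xs) = -1"
  unfolding word_sign_map_permutes[OF assms(1) permutes_swap_id[OF assms(2,3)]]
  using assms(4) by (rule sign_swap_id[THEN trans, OF if_not_P])

lemma word_sign_move_letter:
  "distinct (x # ys) \<Longrightarrow> word_sign (x # ys) (ys @ [x]) = (-1) ^ length ys"
proof (induction ys)
  case Nil
  then show ?case by (simp add: word_sign_refl)
next
  case (Cons y ys)
  have "word_sign (x # y # ys) (y # ys @ [x]) =
    word_sign (x # y # ys) (y # x # ys) * word_sign (y # x # ys) (y # ys @ [x])"
    by (rule word_sign_trans) (use Cons.prems in auto)
  also have "word_sign (x # y # ys) (y # x # ys) = -1"
  proof -
    have "map (Transposition.transpose x y) ys = ys" using Cons.prems by (intro map_idI) (auto simp: Transposition.transpose_def)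
    then have "map (Transposition.transpose x y) (x # y # ys) = y # x # ys" by simp
    then show ?thesis using word_sign_swap_values[OF Cons.prems, of x y] Cons.prems by simp
  qed
  also have "word_sign (y # x # ys) (y # ys @ [x]) = word_sign (x # ys) (ys @ [x])"
    using word_sign_context[of "[y]" "x # ys" "[]" "ys @ [x]"] Cons.prems by auto
  also have "\<dots> = (-1) ^ length ys" using Cons by simp
  finally show ?case by simp
qed

lemma word_sign_swap_blocks:
  "distinct (xs @ ys) \<Longrightarrow> word_sign (xs @ ys) (ys @ xs) = (-1) ^ (length xs * length ys)"
proof (induction xs arbitrary: ys)
  case Nil
  then show ?case by (simp add: word_sign_refl)
next
  case (Cons x xs)
  have "word_sign (x # xs @ ys) (ys @ x # xs) =
    word_sign (x # xs @ ys) (x # ys @ xs) * word_sign (x # ys @ xs) (ys @ x # xs)"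
    by (rule word_sign_trans) (use Cons.prems in auto)
  also have "word_sign (x # xs @ ys) (x # ys @ xs) = word_sign (xs @ ys) (ys @ xs)"
    using word_sign_context[of "[x]" "xs @ ys" "[]" "ys @ xs"] Cons.prems by auto
  also have "\<dots> = (-1) ^ (length xs * length ys)" using Cons by simp
  also have "word_sign (x # ys @ xs) (ys @ x # xs) = word_sign (x # ys) (ys @ [x])"
    using word_sign_context[of "[]" "x # ys" xs "ys @ [x]"] Cons.prems by auto
  also have "\<dots> = (-1) ^ length ys" using Cons.prems by (intro word_sign_move_letter) auto
  finally show ?case by (simp add: power_add)
qed

lemma word_sign_swap_blocks_context:
  assumes "distinct (as @ xs @ ys @ bs)"
  shows "word_sign (as @ xs @ ys @ bs) (as @ ys @ xs @ bs) = (-1) ^ (length xs * length ys)"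
proof -
  have "word_sign (as @ (xs @ ys) @ bs) (as @ (ys @ xs) @ bs) = word_sign (xs @ ys) (ys @ xs)"
    by (rule word_sign_context) (use assms in auto)
  also have "\<dots> = (-1) ^ (length xs * length ys)"
    using assms by (intro word_sign_swap_blocks) auto
  finally show ?thesis by simp
qed

lemma word_sign_rev:
  "distinct xs \<Longrightarrow> word_sign (rev xs) xs = (-1) ^ (length xs * (length xs - 1) div 2)"
proof (induction xs)
  case Nil
  then show ?case by (simp add: word_sign_refl)
next
  case (Cons x xs)
  have "word_sign (rev xs @ [x]) (x # xs) =
    word_sign (rev xs @ [x]) (xs @ [x]) * word_sign (xs @ [x]) (x # xs)"
    by (rule word_sign_trans) (use Cons.prems in auto)
  also have "word_sign (rev xs @ [x]) (xs @ [x]) = word_sign (rev xs) xs"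
    using word_sign_context[of "[]" "rev xs" "[x]" xs] Cons.prems by auto
  also have "\<dots> = (-1) ^ (length xs * (length xs - 1) div 2)" using Cons by simp
  also have "word_sign (xs @ [x]) (x # xs) = (-1) ^ length xs"
    using word_sign_swap_blocks[of xs "[x]"] Cons.prems by auto
  also have "(-1::int) ^ (length xs * (length xs - 1) div 2) * (-1) ^ length xs
     = (-1) ^ (Suc (length xs) * length xs div 2)"
  proof -
    have "length xs * (length xs - 1) div 2 + length xs = Suc (length xs) * length xs div 2"
      by (cases "length xs") (auto simp: algebra_simps)
    then show ?thesis by (metis power_add)
  qed
  finally show ?case by simp
qed

lemma word_sign_rotate:
  assumes "distinct xs" "odd (length xs)"
  shows "word_sign (rotate m xs) xs = 1"
proof -
  define j where "j = m mod length xs"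
  have "distinct (take j xs @ drop j xs)" using assms(1) by simp
  then have "distinct (drop j xs @ take j xs)" unfolding distinct_append by blast
  then have "word_sign (drop j xs @ take j xs) (take j xs @ drop j xs) = (-1) ^ (length (drop j xs) * length (take j xs))"
    by (rule word_sign_swap_blocks)
  moreover have "even (length (drop j xs) * length (take j xs))"
  proof -
    have "length (drop j xs) + length (take j xs) = length xs" by simp
    then show ?thesis using assms(2) by (metis even_add even_mult_iff)
  qed
  ultimately show ?thesis by (simp add: rotate_drop_take j_def)
qed


section \<open>Collapsing one edge of a planar tree\<close>

text \<open>
  The walk that defines the counterclockwise successor of a half-edge in a collapsed tree, as a
  relation: \<open>f\<close> is iterated until \<open>S\<close> is left. Unlike the least number of steps, it can be composed.
\<close>

inductive first_survivor :: "('a \<Rightarrow> 'a) \<Rightarrow> 'a set \<Rightarrow> 'a \<Rightarrow> 'a \<Rightarrow> bool" for f S where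
  here: "x \<notin> S \<Longrightarrow> first_survivor f S x x"
| walk: "x \<in> S \<Longrightarrow> first_survivor f S (f x) y \<Longrightarrow> first_survivor f S x y"

lemma first_survivor_LEAST:
  assumes "first_survivor f S x y"
  shows "(f ^^ (LEAST j. (f ^^ j) x \<notin> S)) x = y"
proof -
  have "(\<exists>j. (f ^^ j) x \<notin> S) \<and> (f ^^ (LEAST j. (f ^^ j) x \<notin> S)) x = y"
    using assms
  proof induction
    case (here x)
    then have "(LEAST j. (f ^^ j) x \<notin> S) = 0" by (intro Least_eq_0) simp
    then show ?case using here by (auto intro: exI[of _ 0])
  next
    case (walk x y)
    then obtain j where j: "(f ^^ j) (f x) \<notin> S" by auto
    have "(LEAST j. (f ^^ j) x \<notin> S) = Suc (LEAST j. (f ^^ Suc j) x \<notin> S)"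
      by (rule Least_Suc[of _ "Suc j"]) (use j walk.hyps in \<open>auto simp: funpow_swap1\<close>)
    moreover have "(f ^^ Suc i) x = (f ^^ i) (f x)" for i by (simp add: funpow_swap1)
    ultimately have "(f ^^ (LEAST j. (f ^^ j) x \<notin> S)) x = y" using walk.IH by simp
    moreover have "(f ^^ Suc j) x \<notin> S" using j by (simp add: funpow_swap1)
    ultimately show ?case by blast
  qed
  then show ?thesis by blast
qed

lemma first_survivor_extend:
  assumes "first_survivor f S x y" "first_survivor f (S \<union> S') y z"
  shows "first_survivor f (S \<union> S') x z"
  using assms
proof induction
  case (walk x y)
  from walk.hyps(1) show ?case using walk.IH[OF walk.prems] by (blast intro: first_survivor.walk)
qed

text \<open>
  First returns compose: leaving \<open>S \<union> S'\<close> under \<open>f\<close> is the same as leaving \<open>S'\<close> under the first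
  return map \<open>g\<close> of \<open>f\<close> to the complement of \<open>S\<close>. This is why collapses of different edges commute.
\<close>

lemma first_survivor_compose:
  assumes "first_survivor g S' y z"
    and "first_survivor f S x y"
    and "\<And>y. y \<in> S' \<Longrightarrow> first_survivor f S (f y) (g y)"
  shows "first_survivor f (S \<union> S') x z"
  using assms(1,2)
proof (induction arbitrary: x)
  case (here y)
  have "y \<notin> S" using here.prems by induction auto
  then have "first_survivor f (S \<union> S') y y" using here.hyps by (intro first_survivor.here) auto
  with here.prems show ?case by (rule first_survivor_extend)
next
  case (walk y z)
  have "first_survivor f (S \<union> S') (f y) z" using walk.IH assms(3) walk.hyps(1) by blast
  then have "first_survivor f (S \<union> S') y z" by (rule first_survivor.walk[rotated]) (use walk.hyps(1) in auto)
  with walk.prems show ?case by (rule first_survivor_extend)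
qed

lemma rot_contract_first_survivor:
  assumes "h \<in> darts T - S" "first_survivor (rot T \<circ> flip T) S (rot T h) y"
  shows "rot (contract T S) h = y"
proof -
  have "rot (contract T S) h =
      ((rot T \<circ> flip T) ^^ (LEAST j. ((rot T \<circ> flip T) ^^ j) (rot T h) \<notin> S)) (rot T h)"
    using assms(1) by (simp add: contract_def Let_def)
  also have "\<dots> = y" by (rule first_survivor_LEAST[OF assms(2)])
  finally show ?thesis .
qed

lemma darts_contract [simp]: "darts (contract T S) = darts T - S"
  by (simp add: contract_def Let_def)

lemma flip_contract: "flip (contract T S) h = (if h \<in> darts T - S then flip T h else h)"
  by (simp add: contract_def Let_def)

lemma rot_contract_outside: "h \<notin> darts T - S \<Longrightarrow> rot (contract T S) h = h"
  by (auto simp: contract_def Let_def)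

locale planar_ribbon_tree =
  fixes n :: nat and T :: ptree
  assumes planar: "planar_tree n T"
begin

lemma finite_darts: "finite (darts T)"
  using planar unfolding planar_tree_def by (elim conjE)

lemma rot_permutes: "rot T permutes darts T"
  using planar unfolding planar_tree_def by (elim conjE)

lemma flip_permutes: "flip T permutes darts T"
  using planar unfolding planar_tree_def by (elim conjE)

lemma leaves: "{h \<in> darts T. is_leaf h} = Leaf ` {..<n + 3}"
  using planar unfolding planar_tree_def by (elim conjE)

lemma flip_involution: "\<forall>h\<in>darts T. flip T (flip T h) = h \<and> (flip T h = h \<longleftrightarrow> is_leaf h)"
  using planar unfolding planar_tree_def by (elim conjE)

lemma flip_fixed: "h \<in> darts T \<Longrightarrow> flip T h = h \<longleftrightarrow> is_leaf h"
  using flip_involution by blast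

lemma valence: "w \<in> vertices T \<Longrightarrow> card w \<ge> 3"
  using planar unfolding planar_tree_def by (elim conjE) (rule bspec)

lemma connected: "w \<in> vertices T \<Longrightarrow> w' \<in> vertices T \<Longrightarrow> (w, w') \<in> (adj T (edges T))\<^sup>*"
  using planar unfolding planar_tree_def by (elim conjE) (drule (1) bspec, drule (1) bspec)

lemma acyclic: "h \<in> darts T \<Longrightarrow> \<not> is_leaf h \<Longrightarrow>
    (vertex_of T h, vertex_of T (flip T h)) \<notin> (adj T (edges T - {{h, flip T h}}))\<^sup>*"
proof -
  have "\<forall>h\<in>darts T. \<not> is_leaf h \<longrightarrow>
    (vertex_of T h, vertex_of T (flip T h)) \<notin> (adj T (edges T - {{h, flip T h}}))\<^sup>*"
    using planar unfolding planar_tree_def by (elim conjE)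
  then show "h \<in> darts T \<Longrightarrow> \<not> is_leaf h \<Longrightarrow> ?thesis" by blast
qed

lemma next_leaf: "i < n + 3 \<Longrightarrow> \<exists>h\<in>region_of T (Leaf i). rot T h = Leaf ((i + 1) mod (n + 3))"
  using planar unfolding planar_tree_def by (elim conjE) blast

lemma flip_flip [simp]: "flip T (flip T h) = h"
  using flip_involution permutes_not_in[OF flip_permutes, of h] by (cases "h \<in> darts T") simp_all

lemma rot_in_darts [simp]: "rot T h \<in> darts T \<longleftrightarrow> h \<in> darts T"
  using permutes_in_image[OF rot_permutes] .

lemma flip_in_darts [simp]: "flip T h \<in> darts T \<longleftrightarrow> h \<in> darts T"
  using permutes_in_image[OF flip_permutes] .

lemma leaf_in_darts [simp]: "Leaf i \<in> darts T \<longleftrightarrow> i < n + 3"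
  using leaves by auto

lemma rot_eq_iff [simp]: "rot T g = rot T h \<longleftrightarrow> g = h"
  using permutes_inj[OF rot_permutes] by (auto dest: injD)

lemma flip_eq_iff [simp]: "flip T g = flip T h \<longleftrightarrow> g = h"
  using permutes_inj[OF flip_permutes] by (auto dest: injD)

lemma is_leaf_flip: "h \<in> darts T \<Longrightarrow> is_leaf (flip T h) \<longleftrightarrow> is_leaf h"
  using flip_fixed flip_in_darts flip_flip by metis

lemma permutation_rot: "permutation (rot T)"
  using rot_permutes finite_darts by (auto simp: permutation_permutes)

lemma self_in_vertex_of [simp]: "h \<in> vertex_of T h"
  unfolding vertex_of_def by (rule permutation_self_in_orbit[OF permutation_rot])

lemma vertex_of_eq: "g \<in> vertex_of T h \<Longrightarrow> vertex_of T g = vertex_of T h"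
  unfolding vertex_of_def using orbit_cyclic_eq3 cyclic_on_orbit'[OF permutation_rot] by metis

lemma vertex_of_rot [simp]: "vertex_of T (rot T h) = vertex_of T h"
  unfolding vertex_of_def by (rule permutation_orbit_step[OF permutation_rot])

lemma vertex_of_subset: "h \<in> darts T \<Longrightarrow> vertex_of T h \<subseteq> darts T"
  unfolding vertex_of_def using permutes_orbit_subset[OF rot_permutes] .

lemma vertex_of_in_vertices [simp]: "h \<in> darts T \<Longrightarrow> vertex_of T h \<in> vertices T"
  unfolding vertices_def by simp

lemma rot_neq:
  assumes "h \<in> darts T" shows "rot T h \<noteq> h"
proof
  assume "rot T h = h"
  then have "vertex_of T h = {h}" unfolding vertex_of_def by (simp add: orbit_eq_singleton_iff)
  moreover have "vertex_of T h \<in> vertices T" using assms unfolding vertices_def by simp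
  ultimately show False using valence by fastforce
qed

lemma vertex_of_flip_neq: "h \<in> darts T \<Longrightarrow> \<not> is_leaf h \<Longrightarrow> vertex_of T (flip T h) \<noteq> vertex_of T h"
  using acyclic[of h] by auto

lemma adj_mono: "F \<subseteq> G \<Longrightarrow> adj T F \<subseteq> adj T G"
  unfolding adj_def by blast

lemma adj_sym: "(x, y) \<in> adj T F \<Longrightarrow> (y, x) \<in> adj T F"
proof -
  assume "(x, y) \<in> adj T F"
  then obtain h where "x = vertex_of T h" "y = vertex_of T (flip T h)" "{h, flip T h} \<in> F"
    unfolding adj_def by auto
  then show ?thesis unfolding adj_def by (intro CollectI exI[of _ "flip T h"]) (auto simp: insert_commute)
qed

lemma adj_rtrancl_sym: "(x, y) \<in> (adj T F)\<^sup>* \<Longrightarrow> (y, x) \<in> (adj T F)\<^sup>*"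
  using adj_sym by (meson symI symD sym_rtrancl)

lemma edgeI: "h \<in> darts T \<Longrightarrow> \<not> is_leaf h \<Longrightarrow> {h, flip T h} \<in> edges T"
  unfolding edges_def by blast

lemma edge_eq: "E \<in> edges T \<Longrightarrow> h \<in> E \<Longrightarrow> E = {h, flip T h}"
  unfolding edges_def by auto

lemma edge_dart: "E \<in> edges T \<Longrightarrow> h \<in> E \<Longrightarrow> h \<in> darts T \<and> \<not> is_leaf h"
  unfolding edges_def using is_leaf_flip by auto

lemma edge_nonempty: "E \<in> edges T \<Longrightarrow> \<exists>h. h \<in> E"
  unfolding edges_def by auto

lemma vertex_of_simps: "g \<in> vertex_of T h \<longleftrightarrow> vertex_of T g = vertex_of T h"
  using vertex_of_eq self_in_vertex_of by metis

lemma corner_step_iff: "(g, k) \<in> corner_step T \<longleftrightarrow> g \<in> darts T \<and> \<not> is_leaf (rot T g) \<and> k = flip T (rot T g)"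
  unfolding corner_step_def by simp (metis)

lemma corner_step_injective:
  "(g, k) \<in> corner_step T \<Longrightarrow> (g', k) \<in> corner_step T \<Longrightarrow> g = g'"
  unfolding corner_step_iff by (metis rot_eq_iff flip_eq_iff)

lemma no_corner_before_leaf: "(g, Leaf i) \<notin> corner_step T"
proof
  assume "(g, Leaf i) \<in> corner_step T"
  then have "Leaf i = flip T (rot T g)" "g \<in> darts T" "\<not> is_leaf (rot T g)"
    unfolding corner_step_def by auto
  then show False using is_leaf_flip[of "rot T g"] by (metis dart.disc(1) rot_in_darts)
qed

text \<open>
  No corner precedes a leaf and the corner steps are injective. So a region is traversed from its
  initial leaf by forward steps only, and it has only one such leaf.
\<close>

lemma region_of_leaf:
  assumes "g \<in> region_of T (Leaf i)"
  shows "(Leaf i, g) \<in> (corner_step T)\<^sup>*"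
proof -
  have "(Leaf i, g) \<in> (corner_step T \<union> (corner_step T)\<inverse>)\<^sup>*"
    using assms unfolding region_of_def by simp
  then show ?thesis
  proof induction
    case (step g k)
    from step.hyps(2) show ?case
    proof
      assume "(g, k) \<in> corner_step T"
      then show ?thesis using step.IH by simp
    next
      assume "(g, k) \<in> (corner_step T)\<inverse>"
      then have kg: "(k, g) \<in> corner_step T" by simp
      then have "g \<noteq> Leaf i" using no_corner_before_leaf by metis
      then obtain k' where "(Leaf i, k') \<in> (corner_step T)\<^sup>*" "(k', g) \<in> corner_step T"
        using step.IH by (metis rtranclE)
      then show ?thesis using corner_step_injective[OF kg] by metis
    qed
  qed simp
qed

lemma region_of_eq_iff: "region_of T g = region_of T h \<longleftrightarrow> g \<in> region_of T h"
proof -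
  let ?R = "(corner_step T \<union> (corner_step T)\<inverse>)\<^sup>*"
  have sym: "(x, y) \<in> ?R \<Longrightarrow> (y, x) \<in> ?R" for x y
    using sym_rtrancl[OF sym_Un_converse[of "corner_step T"]] by (meson symD)
  show ?thesis unfolding region_of_def using sym by (auto intro: rtrancl_trans)
qed

lemma self_in_region_of [simp]: "g \<in> region_of T g"
  by (simp add: region_of_def)

lemma region_of_flip_rot:
  assumes "g \<in> darts T" "\<not> is_leaf (rot T g)"
  shows "region_of T (flip T (rot T g)) = region_of T g"
proof -
  have "(g, flip T (rot T g)) \<in> corner_step T" unfolding corner_step_def using assms by blast
  then show ?thesis unfolding region_of_eq_iff unfolding region_of_def by blast
qed

lemma region_of_Leaf_eq_iff: "region_of T (Leaf i) = region_of T (Leaf j) \<longleftrightarrow> i = j"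
proof
  assume "region_of T (Leaf i) = region_of T (Leaf j)"
  then have "(Leaf j, Leaf i) \<in> (corner_step T)\<^sup>*" using region_of_leaf region_of_eq_iff by blast
  then show "i = j" using no_corner_before_leaf by (metis dart.inject(1) rtranclE)
qed simp

lemma verticesE: assumes "w \<in> vertices T" obtains h where "h \<in> darts T" "w = vertex_of T h"
  using assms unfolding vertices_def by blast

end

locale collapsed_edge = planar_ribbon_tree +
  fixes a b :: dart
  assumes a_dart: "a \<in> darts T" and a_inner: "\<not> is_leaf a" and b_def: "b = flip T a"
begin

abbreviation "T' \<equiv> contract T {a, b}"

lemma flip_a: "flip T a = b"
  using b_def by simp

lemma flip_b: "flip T b = a"
  unfolding b_def by simp

lemma b_dart: "b \<in> darts T"
  unfolding b_def by (simp add: a_dart)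

lemma b_inner: "\<not> is_leaf b"
  unfolding b_def by (simp add: a_dart a_inner is_leaf_flip)

lemma a_neq_b: "a \<noteq> b"
  using flip_fixed[OF a_dart] a_inner flip_a by metis

lemma flip_eq_ab: "flip T x = a \<longleftrightarrow> x = b" "flip T x = b \<longleftrightarrow> x = a"
  using flip_a flip_b flip_flip by metis+

lemma swapped: "collapsed_edge n T b a"
  using planar b_dart b_inner flip_b by unfold_locales auto

lemma vertices_ab_neq: "vertex_of T a \<noteq> vertex_of T b"
  using vertex_of_flip_neq[OF a_dart a_inner] flip_a by metis

lemma rot_ab_neq: "rot T a \<noteq> a" "rot T a \<noteq> b" "rot T b \<noteq> a" "rot T b \<noteq> b"
  using rot_neq a_dart b_dart vertices_ab_neq vertex_of_rot by metis+

definition merge :: "vertex \<Rightarrow> vertex" where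
  "merge w = (if w = vertex_of T a \<or> w = vertex_of T b
    then vertex_of T a \<union> vertex_of T b - {a, b} else w)"

text \<open>
  As \<open>a\<close> and \<open>b\<close> lie at different vertices of valence at least 2, the walk around the collapsed edge
  ends after at most one further step.
\<close>

lemma rot_contract:
  assumes "h \<in> darts T - {a, b}"
  shows "rot T' h = (if rot T h = a then rot T b else if rot T h = b then rot T a else rot T h)"
    and "first_survivor (rot T \<circ> flip T) {a, b} (rot T h) (rot T' h)"
proof -
  have "first_survivor (rot T \<circ> flip T) {a, b} (rot T h)
     (if rot T h = a then rot T b else if rot T h = b then rot T a else rot T h)"
  proof -
    have "first_survivor (rot T \<circ> flip T) {a, b} x x" if "x \<notin> {a, b}" for x
      using that by (rule first_survivor.here)
    moreover have "first_survivor (rot T \<circ> flip T) {a, b} x (rot T (flip T x))" if "x \<in> {a, b}" for x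
    proof (rule first_survivor.walk[OF that])
      have "rot T (flip T x) \<notin> {a, b}" using that rot_ab_neq flip_a flip_b by auto
      then show "first_survivor (rot T \<circ> flip T) {a, b} ((rot T \<circ> flip T) x) (rot T (flip T x))"
        by (simp add: first_survivor.here)
    qed
    ultimately show ?thesis using flip_a flip_b by fastforce
  qed
  then show *: "rot T' h = (if rot T h = a then rot T b else if rot T h = b then rot T a else rot T h)"
    and "first_survivor (rot T \<circ> flip T) {a, b} (rot T h) (rot T' h)"
    using rot_contract_first_survivor[OF assms] by simp_all
qed

lemma flip_contract_edge: "h \<in> darts T - {a, b} \<Longrightarrow> flip T' h = flip T h"
  by (simp add: flip_contract)

lemma rot_contract_permutes: "rot T' permutes darts T'"
proof (rule bij_imp_permutes)
  let ?D = "darts T - {a, b}"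
  have into: "rot T' ` ?D \<subseteq> ?D"
    using rot_ab_neq a_dart b_dart by (auto simp: rot_contract)
  have inj: "inj_on (rot T') ?D"
    by (rule inj_onI) (auto simp: rot_contract split: if_splits)
  have "rot T' ` ?D = ?D"
    using into inj finite_darts by (intro endo_inj_surj) auto
  then show "bij_betw (rot T') (darts T') (darts T')" using inj by (simp add: bij_betw_def)
qed (simp add: rot_contract_outside)

lemma flip_in_remaining: "h \<in> darts T - {a, b} \<Longrightarrow> flip T h \<in> darts T - {a, b}"
  by (simp add: flip_eq_ab)

lemma flip_contract_permutes: "flip T' permutes darts T'"
proof (rule bij_imp_permutes)
  let ?D = "darts T - {a, b}"
  have into: "flip T' ` ?D \<subseteq> ?D"
  proof (rule image_subsetI)
    fix h assume "h \<in> ?D"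
    then show "flip T' h \<in> ?D" using flip_in_remaining flip_contract_edge by metis
  qed
  have inj: "inj_on (flip T') ?D"
    by (rule inj_onI) (auto simp: flip_contract split: if_splits)
  have "flip T' ` ?D = ?D"
    using into inj finite_darts by (intro endo_inj_surj) auto
  then show "bij_betw (flip T') (darts T') (darts T')" using inj by (simp add: bij_betw_def)
qed (auto simp: flip_contract)

lemma permutation_rot_contract: "permutation (rot T')"
  using rot_contract_permutes finite_darts by (auto simp: permutation_permutes)

text \<open>
  Collapsing the edge splices the two cycles of half-edges at its ends into one.
\<close>

lemma orbit_rot_contract:
  "vertex_of T a - {a} \<subseteq> orbit (rot T') (rot T a)"
  "orbit (rot T') (rot T a) = orbit (rot T') (rot T b)"
proof -
  have *: "vertex_of T a - {a} \<subseteq> orbit (rot (contract T {a, b})) (rot T a) \<and>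
      orbit (rot (contract T {a, b})) (rot T b) \<subseteq> orbit (rot (contract T {a, b})) (rot T a)" if "collapsed_edge n T a b" for a b
  proof -
    interpret c: collapsed_edge n T a b by fact
    let ?T = "contract T {a, b}"
    let ?Q = "orbit (rot ?T) (rot T a)"
    have "?Q \<subseteq> darts ?T"
      using permutes_orbit_subset[OF c.rot_contract_permutes] c.rot_ab_neq c.a_dart by auto
    have sub: "x = a \<or> x \<in> ?Q" if "x \<in> vertex_of T a" for x
      using that unfolding vertex_of_def
    proof induction
      case base
      show ?case using permutation_self_in_orbit[OF c.permutation_rot_contract] by blast
    next
      case (step x)
      then have x: "x \<in> vertex_of T a" unfolding vertex_of_def by simp
      show ?case
      proof (cases "x = a")
        case True
        then show ?thesis using permutation_self_in_orbit[OF c.permutation_rot_contract] by blast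
      next
        case False
        then have xQ: "x \<in> ?Q" using step by blast
        then have "rot ?T x \<in> ?Q" by (rule orbit.step)
        moreover have "x \<in> darts T - {a, b}" using xQ \<open>?Q \<subseteq> darts ?T\<close> by auto
        moreover have "rot T x \<noteq> b"
          using x c.vertices_ab_neq vertex_of_eq vertex_of_rot by metis
        ultimately show ?thesis by (auto simp: c.rot_contract split: if_splits)
      qed
    qed
    obtain x where x: "rot T x = a" using permutes_surj[OF rot_permutes] by (metis surjD)
    then have "x \<in> vertex_of T a" using vertex_of_rot[of x] by (simp add: vertex_of_simps)
    moreover have "x \<noteq> a" using x c.rot_ab_neq by metis
    ultimately have xQ: "x \<in> ?Q" using sub by blast
    then have "rot ?T x \<in> ?Q" by (rule orbit.step)
    moreover have "x \<in> darts T - {a, b}" using xQ \<open>?Q \<subseteq> darts ?T\<close> by auto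
    ultimately have "rot T b \<in> ?Q" using x by (simp add: c.rot_contract)
    then have "orbit (rot ?T) (rot T b) \<subseteq> ?Q" using orbit_trans[of _ "rot ?T" "rot T b" "rot T a"] by blast
    then show ?thesis using sub by blast
  qed
  have sw: "contract T {b, a} = contract T {a, b}" by (simp add: insert_commute)
  show "vertex_of T a - {a} \<subseteq> orbit (rot T') (rot T a)"
    using *[of a b] collapsed_edge_axioms by blast
  show "orbit (rot T') (rot T a) = orbit (rot T') (rot T b)"
    using *[OF collapsed_edge_axioms] *[OF swapped] unfolding sw by blast
qed

lemma orbit_rot_contract_merged:
  "orbit (rot T') (rot T a) = vertex_of T a \<union> vertex_of T b - {a, b}"
proof
  let ?Q = "orbit (rot T') (rot T a)"
  have Q: "?Q \<subseteq> darts T'"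
    using permutes_orbit_subset[OF rot_contract_permutes] rot_ab_neq a_dart by auto
  have sw: "contract T {b, a} = contract T {a, b}" by (simp add: insert_commute)
  have "vertex_of T b - {b} \<subseteq> ?Q"
    using collapsed_edge.orbit_rot_contract(1)[OF swapped] orbit_rot_contract(2) unfolding sw by simp
  then show "vertex_of T a \<union> vertex_of T b - {a, b} \<subseteq> ?Q" using orbit_rot_contract(1) by blast
  have "x \<in> vertex_of T a \<union> vertex_of T b" if "x \<in> ?Q" for x
    using that
  proof induction
    case base
    then show ?case using rot_ab_neq a_dart by (auto simp: vertex_of_simps rot_contract)
  next
    case (step x)
    then have "x \<in> darts T - {a, b}" using Q by auto
    then show ?case using step by (auto simp: vertex_of_simps rot_contract)
  qed
  then show "?Q \<subseteq> vertex_of T a \<union> vertex_of T b - {a, b}" using Q by auto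
qed

lemma vertex_of_contract:
  assumes "h \<in> darts T - {a, b}"
  shows "vertex_of T' h = merge (vertex_of T h)"
proof (cases "vertex_of T h = vertex_of T a \<or> vertex_of T h = vertex_of T b")
  case True
  then have "h \<in> orbit (rot T') (rot T a)"
    using assms unfolding orbit_rot_contract_merged by (auto simp: vertex_of_simps)
  then have "orbit (rot T') h = orbit (rot T') (rot T a)"
    using orbit_cyclic_eq3 cyclic_on_orbit'[OF permutation_rot_contract] by metis
  then show ?thesis using True unfolding orbit_rot_contract_merged by (simp add: vertex_of_def merge_def)
next
  case False
  have "orbit (rot T') h = orbit (rot T) h"
  proof (rule orbit_cong)
    show "h \<in> orbit (rot T) h" using self_in_vertex_of unfolding vertex_of_def .
    fix g assume "g \<in> orbit (rot T) h"
    then have g: "vertex_of T g = vertex_of T h" "g \<in> darts T"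
      using vertex_of_eq vertex_of_subset[of h] assms unfolding vertex_of_def by auto
    moreover have "rot T g \<noteq> a" "rot T g \<noteq> b" using False g vertex_of_rot[of g] by metis+
    moreover have "g \<noteq> a" "g \<noteq> b" using False g by metis+
    ultimately show "rot T' g = rot T g" by (simp add: rot_contract)
  qed
  then show ?thesis using False by (simp add: vertex_of_def merge_def)
qed

lemma vertices_contract: "vertices T' = merge ` vertices T"
proof
  show "vertices T' \<subseteq> merge ` vertices T"
    unfolding vertices_def using vertex_of_contract by auto
  have "\<exists>g\<in>darts T - {a, b}. vertex_of T g = vertex_of T h" if "h \<in> darts T" for h
    using that rot_ab_neq by (metis Diff_iff empty_iff insert_iff vertex_of_rot rot_in_darts)
  then show "merge ` vertices T \<subseteq> vertices T'"
    unfolding vertices_def using vertex_of_contract by (auto simp: image_iff) metis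
qed

lemma edges_contract: "edges T' = edges T - {{a, b}}"
proof -
  have *: "{h, flip T h} = {a, b} \<longleftrightarrow> h \<in> {a, b}" for h
    unfolding doubleton_eq_iff using flip_a flip_b by blast
  have "edges T' = {{h, flip T h} | h. h \<in> darts T - {a, b} \<and> \<not> is_leaf h}"
    unfolding edges_def darts_contract using flip_contract_edge by (metis (lifting))
  also have "\<dots> = edges T - {{a, b}}"
    unfolding edges_def using * by blast
  finally show ?thesis .
qed

lemma edge_contract_dart:
  assumes "F \<in> edges T'" "h \<in> F"
  shows "h \<in> darts T - {a, b}"
proof -
  obtain g where g: "F = {g, flip T' g}" "g \<in> darts T - {a, b}"
    using assms(1) unfolding edges_def by auto
  have "flip T' g \<in> darts T - {a, b}"
    unfolding flip_contract_edge[OF g(2)] by (rule flip_in_remaining[OF g(2)])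
  then show ?thesis using g assms(2) by (metis insertE singletonD)
qed

lemma card_merged: "card (vertex_of T a \<union> vertex_of T b - {a, b}) \<ge> 3"
proof -
  have fin: "finite (vertex_of T a)" "finite (vertex_of T b)"
    using vertex_of_subset a_dart b_dart finite_darts finite_subset by blast+
  have "vertex_of T a \<inter> vertex_of T b = {}"
    using vertices_ab_neq vertex_of_simps by auto
  then have "card (vertex_of T a \<union> vertex_of T b) = card (vertex_of T a) + card (vertex_of T b)"
    using fin by (simp add: card_Un_disjoint)
  moreover have "card (vertex_of T a) \<ge> 3" "card (vertex_of T b) \<ge> 3"
    using valence a_dart b_dart by auto
  moreover have "card (vertex_of T a \<union> vertex_of T b - {a, b})
     = card (vertex_of T a \<union> vertex_of T b) - card {a, b}"
    by (rule card_Diff_subset) auto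
  moreover have "card {a, b} = 2" using a_neq_b by simp
  ultimately show ?thesis by linarith
qed

lemma merge_adj:
  assumes "(x, y) \<in> adj T (edges T)" shows "(merge x, merge y) \<in> (adj T' (edges T'))\<^sup>*"
proof -
  obtain h where h: "x = vertex_of T h" "y = vertex_of T (flip T h)" "{h, flip T h} \<in> edges T"
    using assms unfolding adj_def by auto
  show ?thesis
  proof (cases "h = a \<or> h = b")
    case True
    moreover have "merge (vertex_of T a) = merge (vertex_of T b)" by (simp add: merge_def)
    ultimately have "merge x = merge y" using h(1,2) flip_a flip_b by metis
    then show ?thesis by simp
  next
    case False
    then have h': "h \<in> darts T - {a, b}" using edge_dart[OF h(3)] by simp
    moreover have "flip T h \<in> darts T - {a, b}"
      by (rule flip_in_remaining[OF h'])
    moreover have "{h, flip T h} \<in> edges T'"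
      using h(3) False unfolding edges_contract by (simp add: doubleton_eq_iff)
    ultimately have "(merge x, merge y) \<in> adj T' (edges T')"
      unfolding adj_def h(1,2) using vertex_of_contract flip_contract_edge[OF h']
      by (intro CollectI exI[of _ h]) simp
    then show ?thesis by blast
  qed
qed

text \<open>
  Two vertices that are identified by the collapse are joined by the collapsed edge.
\<close>

lemma merge_eqD:
  assumes "merge x = merge y" "x \<in> vertices T" "y \<in> vertices T"
  shows "(x, y) \<in> (adj T (insert {a, b} F))\<^sup>*"
proof -
  have ab: "(vertex_of T a, vertex_of T b) \<in> adj T (insert {a, b} F)"
    unfolding adj_def using flip_a by auto
  have ne: "merge w = vertex_of T a \<union> vertex_of T b - {a, b} \<Longrightarrow> w \<in> vertices T \<Longrightarrow>
     w = vertex_of T a \<or> w = vertex_of T b" for w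
  proof (rule ccontr)
    assume w: "merge w = vertex_of T a \<union> vertex_of T b - {a, b}" "w \<in> vertices T"
      "\<not> (w = vertex_of T a \<or> w = vertex_of T b)"
    then have "rot T a \<in> w" using rot_ab_neq by (simp add: merge_def vertex_of_simps)
    then show False using w verticesE vertex_of_eq vertex_of_rot by metis
  qed
  have "x = y \<or> {x, y} = {vertex_of T a, vertex_of T b}"
    using ne[of x] ne[of y] assms by (auto simp: merge_def split: if_splits)
  then show ?thesis using ab adj_sym[OF ab] by (auto simp: doubleton_eq_iff)
qed

text \<open>
  A path in the collapsed tree lifts to the original tree if the collapsed edge may be used. Thus a
  cycle through an edge of the collapsed tree would come from a cycle in the original tree.
\<close>

lemma lift_path:
  assumes "(x', y') \<in> (adj T' F)\<^sup>*" "F \<subseteq> edges T'" "x' = merge x" "x \<in> vertices T"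
    "y' = merge y" "y \<in> vertices T"
  shows "(x, y) \<in> (adj T (insert {a, b} F))\<^sup>*"
  using assms(1,5,6)
proof (induction arbitrary: y)
  case base
  then show ?case using merge_eqD assms(3,4) by simp
next
  case (step y' z')
  then obtain h where h: "y' = vertex_of T' h" "z' = vertex_of T' (flip T' h)" "{h, flip T' h} \<in> F"
    unfolding adj_def by auto
  have "{h, flip T' h} \<in> edges T'" using h assms(2) by blast
  then have hD: "h \<in> darts T - {a, b}" using edge_contract_dart by blast
  have flip: "flip T' h = flip T h" by (rule flip_contract_edge[OF hD])
  have hD': "flip T h \<in> darts T - {a, b}" by (rule flip_in_remaining[OF hD])
  have "(x, vertex_of T h) \<in> (adj T (insert {a, b} F))\<^sup>*"
    by (rule step.IH) (use h(1) vertex_of_contract[OF hD] hD in auto)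
  moreover have "(vertex_of T h, vertex_of T (flip T h)) \<in> adj T (insert {a, b} F)"
    unfolding adj_def using h(3) unfolding flip by blast
  moreover have "(vertex_of T (flip T h), y) \<in> (adj T (insert {a, b} F))\<^sup>*"
    by (rule merge_eqD) (use step.prems h(2) flip vertex_of_contract[OF hD'] hD' in auto)
  ultimately show ?case by (meson rtrancl.rtrancl_into_rtrancl rtrancl_trans)
qed

text \<open>
  The walk along a region survives the collapse, except that a corner \<open>g\<close> at one of the two deleted
  half-edges is skipped. In the collapsed tree, the corner before it is bounded by \<open>rot T g\<close> instead.
\<close>

lemma corner_walk_contract:
  assumes "(Leaf i, g) \<in> (corner_step T)\<^sup>*" "i < n + 3"
  shows "(g \<notin> {a, b} \<and> g \<in> darts T \<and> g \<in> region_of T' (Leaf i)) \<or>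
    (g \<in> {a, b} \<and> (\<exists>g'\<in>region_of T' (Leaf i). g' \<in> darts T - {a, b} \<and> rot T' g' = rot T g))"
  using assms(1)
proof induction
  case base
  have "Leaf i \<notin> {a, b}" using a_inner b_inner by (metis dart.disc(1) insertE singletonD)
  then show ?case using assms(2) by (simp add: region_of_def)
next
  case (step g k)
  then have k: "k = flip T (rot T g)" "g \<in> darts T" "\<not> is_leaf (rot T g)"
    unfolding corner_step_def by auto
  have fl: "flip T x \<in> {a, b} \<longleftrightarrow> x \<in> {a, b}" for x
    using flip_a flip_b by (metis flip_flip insert_iff singleton_iff)
  have next_in: "k \<in> region_of T' (Leaf i)"
    if "g' \<in> region_of T' (Leaf i)" "g' \<in> darts T - {a, b}" "rot T' g' = rot T g" "rot T g \<notin> {a, b}" for g'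
  proof -
    have "(g', k) \<in> corner_step T'"
      unfolding corner_step_def using that k by (auto simp: flip_contract)
    then show ?thesis using that(1) unfolding region_of_def
      by (metis (no_types, lifting) UnI1 mem_Collect_eq rtrancl.rtrancl_into_rtrancl)
  qed
  show ?case
  proof (cases "rot T g \<in> {a, b}")
    case True
    then have g: "g \<notin> {a, b}" "g \<in> region_of T' (Leaf i)" using step.IH rot_ab_neq by auto
    have "rot T' g = rot T k" using g k True flip_a flip_b by (auto simp: rot_contract)
    then show ?thesis using g k True fl by blast
  next
    case False
    have "\<exists>g'\<in>region_of T' (Leaf i). g' \<in> darts T - {a, b} \<and> rot T' g' = rot T g"
      using step.IH False by (auto simp: rot_contract)
    then have "k \<in> region_of T' (Leaf i)" using next_in False by blast
    then show ?thesis using False k fl by auto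
  qed
qed

lemma planar_contract: "planar_tree n T'"
proof -
  have "Leaf i \<noteq> a" "Leaf i \<noteq> b" for i
    using a_inner b_inner by (metis dart.disc(1))+
  then have leaves': "{h \<in> darts T'. is_leaf h} = Leaf ` {..<n + 3}"
    using leaves a_inner b_inner by auto
  have flips: "\<forall>h\<in>darts T'. flip T' (flip T' h) = h \<and> (flip T' h = h \<longleftrightarrow> is_leaf h)"
  proof
    fix h assume "h \<in> darts T'"
    then have h: "h \<in> darts T - {a, b}" by simp
    then show "flip T' (flip T' h) = h \<and> (flip T' h = h \<longleftrightarrow> is_leaf h)"
      using flip_contract_edge[OF h] flip_contract_edge[OF flip_in_remaining[OF h]] flip_fixed by simp
  qed
  have val: "\<forall>w\<in>vertices T'. card w \<ge> 3"
  proof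
    fix w assume "w \<in> vertices T'"
    then obtain w' where "w' \<in> vertices T" "w = merge w'" unfolding vertices_contract by blast
    then show "card w \<ge> 3" using card_merged valence[of w'] by (cases "w = w'") (auto simp: merge_def)
  qed
  have conn: "\<forall>u\<in>vertices T'. \<forall>w\<in>vertices T'. (u, w) \<in> (adj T' (edges T'))\<^sup>*"
  proof -
    have "(merge x, merge y) \<in> (adj T' (edges T'))\<^sup>*" if "(x, y) \<in> (adj T (edges T))\<^sup>*" for x y
      using that
    proof induction
      case (step y z)
      show ?case by (rule rtrancl_trans[OF step.IH merge_adj[OF step.hyps(2)]])
    qed simp
    then show ?thesis unfolding vertices_contract using connected by blast
  qed
  have acyc: "\<forall>h\<in>darts T'. \<not> is_leaf h \<longrightarrow>
        (vertex_of T' h, vertex_of T' (flip T' h)) \<notin> (adj T' (edges T' - {{h, flip T' h}}))\<^sup>*"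
  proof (intro ballI impI notI)
    fix h assume "h \<in> darts T'" and inner: "\<not> is_leaf h"
      and path: "(vertex_of T' h, vertex_of T' (flip T' h)) \<in> (adj T' (edges T' - {{h, flip T' h}}))\<^sup>*"
    then have h: "h \<in> darts T - {a, b}" by simp
    have h': "flip T h \<in> darts T - {a, b}" by (rule flip_in_remaining[OF h])
    have "(vertex_of T h, vertex_of T (flip T h)) \<in> (adj T (insert {a, b} (edges T' - {{h, flip T' h}})))\<^sup>*"
      by (rule lift_path[OF path])
        (use h h' vertex_of_contract[OF h] vertex_of_contract[OF h'] flip_contract_edge[OF h] in auto)
    moreover have "insert {a, b} (edges T' - {{h, flip T' h}}) \<subseteq> edges T - {{h, flip T h}}"
    proof -
      have "{a, b} \<in> edges T" using edgeI[OF a_dart a_inner] flip_a by simp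
      moreover have "{a, b} \<noteq> {h, flip T h}" using h by (metis DiffD2 insertI1)
      ultimately show ?thesis unfolding edges_contract flip_contract_edge[OF h] by blast
    qed
    then have "adj T (insert {a, b} (edges T' - {{h, flip T' h}})) \<subseteq> adj T (edges T - {{h, flip T h}})"
      by (rule adj_mono)
    ultimately have "(vertex_of T h, vertex_of T (flip T h)) \<in> (adj T (edges T - {{h, flip T h}}))\<^sup>*"
      using rtrancl_mono by blast
    then show False using acyclic h inner by blast
  qed
  have next_leaf': "\<forall>i<n + 3. \<exists>h\<in>region_of T' (Leaf i). rot T' h = Leaf ((i + 1) mod (n + 3))"
  proof (intro allI impI)
    fix i assume i: "i < n + 3"
    obtain h where h: "h \<in> region_of T (Leaf i)" "rot T h = Leaf ((i + 1) mod (n + 3))"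
      using next_leaf[OF i] by blast
    have "rot T h \<noteq> a" "rot T h \<noteq> b" using a_inner b_inner h(2) by (metis dart.disc(1))+
    then show "\<exists>h\<in>region_of T' (Leaf i). rot T' h = Leaf ((i + 1) mod (n + 3))"
      using corner_walk_contract[OF region_of_leaf[OF h(1)] i] h(2) rot_contract(1)[of h] by auto
  qed
  show ?thesis unfolding planar_tree_def
    using finite_darts rot_contract_permutes flip_contract_permutes flips leaves' val conn acyc next_leaf'
    by (intro conjI) simp_all
qed

end


section \<open>Orientations along a chain of collapses\<close>

lemma collapsed_edgeI:
  assumes "planar_tree n T" "E \<in> edges T" "h \<in> E"
  shows "collapsed_edge n T h (flip T h)" "E = {h, flip T h}"
proof -
  interpret planar_ribbon_tree n T using assms(1) by unfold_locales
  show "collapsed_edge n T h (flip T h)" using edge_dart[OF assms(2,3)] by unfold_locales auto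
  show "E = {h, flip T h}" by (rule edge_eq[OF assms(2,3)])
qed

lemma planar_tree_contract:
  assumes "planar_tree n T" "E \<in> edges T"
  shows "planar_tree n (contract T E)" "edges (contract T E) = edges T - {E}"
proof -
  obtain h where h: "h \<in> E" using assms(2) unfolding edges_def by auto
  interpret collapsed_edge n T h "flip T h" by (rule collapsed_edgeI[OF assms h])
  show "planar_tree n (contract T E)" "edges (contract T E) = edges T - {E}"
    using planar_contract edges_contract collapsed_edgeI(2)[OF assms h] by simp_all
qed

lemma contract_contract:
  assumes "planar_tree n T" "E \<in> edges T" "E' \<in> edges T" "E \<noteq> E'"
  shows "contract (contract T E) E' = contract T (E \<union> E')"
proof -
  obtain a where a: "a \<in> E" using assms(2) unfolding edges_def by auto
  obtain a' where a': "a' \<in> E'" using assms(3) unfolding edges_def by auto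
  interpret c: collapsed_edge n T a "flip T a" by (rule collapsed_edgeI[OF assms(1,2) a])
  have E: "E = {a, flip T a}" by (rule collapsed_edgeI(2)[OF assms(1,2) a])
  have T': "planar_tree n (contract T E)" "E' \<in> edges (contract T E)"
    using planar_tree_contract[OF assms(1,2)] assms(3,4) by auto
  interpret c': collapsed_edge n "contract T E" a' "flip (contract T E) a'"
    by (rule collapsed_edgeI[OF T' a'])
  have E': "E' = {a', flip (contract T E) a'}" by (rule collapsed_edgeI(2)[OF T' a'])
  let ?f = "rot T \<circ> flip T" and ?g = "rot (contract T E) \<circ> flip (contract T E)"
  have darts: "darts (contract (contract T E) E') = darts (contract T (E \<union> E'))"
    by auto
  have E'_darts: "y \<in> darts T - E" if "y \<in> E'" for y
    using c.edge_contract_dart[of E' y] T'(2) that unfolding E by blast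
  have first: "first_survivor ?f E (rot T h) (rot (contract T E) h)" if "h \<in> darts T - E" for h
    using c.rot_contract(2)[of h] that unfolding E by blast
  have "first_survivor ?f (E \<union> E') (rot T h) (rot (contract (contract T E) E') h)"
    if h: "h \<in> darts T - (E \<union> E')" for h
  proof (rule first_survivor_compose)
    show "first_survivor ?g E' (rot (contract T E) h) (rot (contract (contract T E) E') h)"
      using c'.rot_contract(2)[of h] h E' by simp
    show "first_survivor ?f E (rot T h) (rot (contract T E) h)" using first h by blast
    fix y assume "y \<in> E'"
    then have y: "y \<in> darts T - E" by (rule E'_darts)
    then have "flip T y \<in> darts T - E" using c.flip_in_remaining unfolding E by blast
    then show "first_survivor ?f E (?f y) (?g y)"
      using first y by (simp add: flip_contract)
  qed
  then have "rot (contract (contract T E) E') h = rot (contract T (E \<union> E')) h" for h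
  proof (cases "h \<in> darts T - (E \<union> E')")
    case False
    then show ?thesis using rot_contract_outside[of h "contract T E" E'] rot_contract_outside[of h T "E \<union> E'"] by auto
  qed (metis rot_contract_first_survivor)
  moreover have "flip (contract (contract T E) E') h = flip (contract T (E \<union> E')) h" for h
    by (auto simp: flip_contract)
  ultimately show ?thesis using darts by (intro ptree.equality) (auto simp: fun_eq_iff)
qed

lemma contract_commute:
  assumes "planar_tree n T" "E \<in> edges T" "E' \<in> edges T" "E \<noteq> E'"
  shows "contract (contract T E) E' = contract (contract T E') E"
  using contract_contract[OF assms] contract_contract[OF assms(1,3,2)] assms(4) by (simp add: Un_commute)

lemma orientation_word_distinct: "orientation_word T \<omega> \<Longrightarrow> distinct \<omega>"
  and orientation_word_set: "orientation_word T \<omega> \<Longrightarrow> set \<omega> = cells T"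
  unfolding orientation_word_def by auto

text \<open>
  The definition of an induced orientation asks for equality of orientations. Equal signs suffice: if
  both are negative, exchange the first two letters of the common rest.
\<close>

lemma induced_orientationI:
  assumes "h \<in> E" "E \<in> edges T"
    and "\<omega>\<^sub>1 = Vertex (vertex_of T h) # Vertex (vertex_of T (flip T h)) # Half h # Half (flip T h) # rest"
    and "\<omega>\<^sub>1' = Vertex (vertex_of T h \<union> vertex_of T (flip T h) - E) # rest"
    and "orientation_word T \<omega>" "orientation_word T \<omega>\<^sub>1"
    and "orientation_word (contract T E) \<omega>'" "orientation_word (contract T E) \<omega>\<^sub>1'"
    and "word_sign \<omega> \<omega>\<^sub>1 = word_sign \<omega>' \<omega>\<^sub>1'" "length rest \<ge> 2"
  shows "induced_orientation T E \<omega> \<omega>'"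
proof -
  note W = orientation_word_distinct orientation_word_set
  have goal: "induced_orientation T E \<omega> \<omega>'" if "same_orientation T \<omega>
      (Vertex (vertex_of T h) # Vertex (vertex_of T (flip T h)) # Half h # Half (flip T h) # r)"
    "same_orientation (contract T E) \<omega>' (Vertex (vertex_of T h \<union> vertex_of T (flip T h) - E) # r)" for r
    unfolding induced_orientation_def Let_def using assms(1,2) that by blast
  show ?thesis
  proof (cases "word_sign \<omega> \<omega>\<^sub>1 = 1")
    case True
    then show ?thesis using goal[of rest] assms(3-9) unfolding same_orientation_def by simp
  next
    case False
    then have m: "word_sign \<omega> \<omega>\<^sub>1 = -1" "word_sign \<omega>' \<omega>\<^sub>1' = -1"
      using word_sign_cases[of \<omega> \<omega>\<^sub>1] W assms(5,6,9) by metis+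
    obtain x y r where rest: "rest = x # y # r"
      using assms(10) by (metis Suc_le_length_iff numeral_2_eq_2)
    have swap: "word_sign (as @ x # y # r) (as @ y # x # r) = -1" if "distinct (as @ x # y # r)" for as
      using word_sign_swap_blocks_context[of as "[x]" "[y]" r] that by simp
    have flip_sign: "word_sign w (as @ y # x # r) = 1 \<and> orientation_word U (as @ y # x # r)"
      if "orientation_word U w" "orientation_word U (as @ x # y # r)" "word_sign w (as @ x # y # r) = -1" for U w as
    proof -
      have d: "distinct (as @ x # y # r)" and s: "set (as @ x # y # r) = cells U"
        using that(2) unfolding orientation_word_def by simp_all
      have d': "distinct (as @ y # x # r)" using d by auto
      have s': "set (as @ y # x # r) = set (as @ x # y # r)" by auto
      have "word_sign w (as @ y # x # r) = word_sign w (as @ x # y # r) * word_sign (as @ x # y # r) (as @ y # x # r)"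
        by (rule word_sign_trans[OF W(1)[OF that(1)] d d']) (use W(2)[OF that(1)] s s' in simp_all)
      then have "word_sign w (as @ y # x # r) = 1" unfolding that(3) swap[OF d] by simp
      then show ?thesis using d' s s' unfolding orientation_word_def by simp
    qed
    show ?thesis
    proof (rule goal[of "y # x # r"])
      show "same_orientation T \<omega> (Vertex (vertex_of T h) # Vertex (vertex_of T (flip T h)) # Half h # Half (flip T h) # y # x # r)"
        using flip_sign[of T \<omega> "[Vertex (vertex_of T h), Vertex (vertex_of T (flip T h)), Half h, Half (flip T h)]"]
          m(1) assms(3,5,6) rest unfolding same_orientation_def by simp
      show "same_orientation (contract T E) \<omega>' (Vertex (vertex_of T h \<union> vertex_of T (flip T h) - E) # y # x # r)"
        using flip_sign[of "contract T E" \<omega>' "[Vertex (vertex_of T h \<union> vertex_of T (flip T h) - E)]"]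
          m(2) assms(4,7,8) rest unfolding same_orientation_def by simp
    qed
  qed
qed

context collapsed_edge
begin

definition merge_cell :: "cell \<Rightarrow> cell" where
  "merge_cell c = (if c = Vertex (vertex_of T a) then Vertex (merge (vertex_of T a)) else c)"

lemma merge_cell_Half [simp]: "merge_cell (Half h) = Half h"
  by (simp add: merge_cell_def)

text \<open>
  The merged vertex contains \<open>rot T a\<close> but not \<open>a\<close>.
\<close>

lemma merged_not_vertex: "merge (vertex_of T a) \<notin> vertices T"
proof
  assume "merge (vertex_of T a) \<in> vertices T"
  then obtain h where h: "merge (vertex_of T a) = vertex_of T h" by (rule verticesE)
  have "rot T a \<in> merge (vertex_of T a)" using rot_ab_neq by (simp add: merge_def vertex_of_simps)
  then have "a \<in> merge (vertex_of T a)" unfolding h by (simp add: vertex_of_simps)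
  then show False by (simp add: merge_def)
qed

lemma Vertex_in_cells: "Vertex w \<in> cells T \<longleftrightarrow> w \<in> vertices T"
  unfolding cells_def by auto

text \<open>
  If the first letter \<open>r\<close> is the vertex of \<open>a\<close>, this is the definition of the induced orientation. If
  not, exchange \<open>r\<close> with the vertex of \<open>a\<close> in the rest of the word, collapse, and exchange \<open>r\<close> with the
  merged vertex; the two signs cancel. So the first letter need not be a vertex of the edge, and the
  triple formed by the vertex of \<open>b\<close> and the two half-edges can just be deleted.
\<close>

lemma drop_edge_word:
  assumes w: "orientation_word T (Vertex r # Vertex (vertex_of T b) # Half a # Half b # R)"
    and len: "length R \<ge> 2"
  shows "orientation_word T' (map merge_cell (Vertex r # R))"
    and "induced_orientation T {a, b} (Vertex r # Vertex (vertex_of T b) # Half a # Half b # R)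
      (map merge_cell (Vertex r # R))"
proof -
  let ?w' = "map merge_cell (Vertex r # R)"
  let ?va = "Vertex (vertex_of T a)" and ?vb = "Vertex (vertex_of T b)"
  let ?c = "Vertex (merge (vertex_of T a))"
  let ?\<omega> = "Vertex r # ?vb # Half a # Half b # R"
  have dist: "distinct ?\<omega>" and set: "set ?\<omega> = cells T"
    using w unfolding orientation_word_def by auto
  have S: "set (Vertex r # R) = cells T - {?vb, Half a, Half b}"
    using dist unfolding set[symmetric] by auto
  have va: "?va \<in> set (Vertex r # R)"
    unfolding S using vertices_ab_neq a_dart by (simp add: Vertex_in_cells)
  have c_notin: "?c \<notin> cells T" using merged_not_vertex by (simp add: Vertex_in_cells)
  have merge_ab: "merge (vertex_of T a) = merge (vertex_of T b)" by (simp add: merge_def)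
  have inj: "inj_on merge_cell (cells T)"
    using c_notin by (intro inj_onI) (auto simp: merge_cell_def split: if_splits)
  have "merge_cell ` (cells T - {?vb, Half a, Half b}) = cells T'"
  proof -
    have "merge_cell ` (cells T - {?vb, Half a, Half b})
        = merge_cell ` Vertex ` (vertices T - {vertex_of T b}) \<union> merge_cell ` Half ` (darts T - {a, b})"
      unfolding cells_def by auto
    also have "merge_cell ` Half ` (darts T - {a, b}) = Half ` darts T'"
      by (simp add: image_image)
    also have "merge_cell ` Vertex ` (vertices T - {vertex_of T b}) = Vertex ` merge ` (vertices T - {vertex_of T b})"
      unfolding image_image by (rule image_cong) (auto simp: merge_cell_def merge_def)
    also have "merge ` (vertices T - {vertex_of T b}) = merge ` vertices T"
    proof -
      have "merge (vertex_of T b) \<in> merge ` (vertices T - {vertex_of T b})"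
        using merge_ab[symmetric] vertices_ab_neq a_dart by auto
      then show ?thesis by (metis (no_types, lifting) image_insert insert_Diff_single insert_absorb insert_image vertex_of_in_vertices b_dart)
    qed
    finally show ?thesis unfolding cells_def vertices_contract .
  qed
  then have "set ?w' = cells T'" using S by (simp only: set_map)
  moreover have "distinct ?w'"
    using dist inj_on_subset[OF inj, of "set (Vertex r # R)"] S by (simp only: distinct_map) auto
  ultimately show w': "orientation_word T' ?w'"
    unfolding orientation_word_def by blast
  \<comment> \<open>both exchanges are the identity if \<open>r\<close> is the vertex of \<open>a\<close>\<close>
  let ?t = "Transposition.transpose ?va (Vertex r)"
  let ?R = "map ?t R"
  have "Vertex r \<in> cells T" unfolding set[symmetric] by simp
  moreover have "?va \<in> cells T" using a_dart by (simp add: Vertex_in_cells)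
  ultimately have c_neq: "?c \<noteq> Vertex r" "?c \<noteq> ?va" using c_notin by metis+
  have fix_t: "?t ?vb = ?vb" "?t (Half a) = Half a" "?t (Half b) = Half b" "?t ?c = ?c"
  proof -
    have "?vb \<noteq> Vertex r" using dist by auto
    then show "?t ?vb = ?vb" "?t (Half a) = Half a" "?t (Half b) = Half b" "?t ?c = ?c"
      using vertices_ab_neq c_neq by (simp_all add: Transposition.transpose_def)
  qed
  let ?u = "Transposition.transpose ?c (merge_cell (Vertex r))"
  have \<omega>1: "map ?t ?\<omega> = ?va # ?vb # Half a # Half b # ?R"
    using fix_t by simp
  have \<omega>1': "map ?u ?w' = ?c # ?R"
  proof -
    have "?u (merge_cell x) = ?t x" if "x \<in> set R" for x
    proof -
      have "x \<in> set ?\<omega>" using that by simp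
      then have "x \<noteq> ?c" using c_notin unfolding set by blast
      moreover have "x \<noteq> Vertex r" using that dist by auto
      ultimately show ?thesis by (auto simp: merge_cell_def Transposition.transpose_def)
    qed
    moreover have "?u (merge_cell (Vertex r)) = ?c"
      by (auto simp: merge_cell_def)
    ultimately show ?thesis by simp
  qed
  have rset: "Vertex r \<in> set ?\<omega>" "?va \<in> set ?\<omega>" using va by auto
  have t_perm: "?t permutes set ?\<omega>" by (rule permutes_swap_id[OF rset(2,1)])
  have cset: "?c \<in> set ?w'"
  proof -
    have "merge_cell ?va = ?c" by (simp add: merge_cell_def)
    then show ?thesis using va by (metis image_eqI set_map)
  qed
  have w1: "orientation_word T (map ?t ?\<omega>)"
    unfolding orientation_word_def using dist set permutes_image[OF t_perm] permutes_inj_on[OF t_perm]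
    by (simp only: distinct_map set_map)
  have sgn1: "word_sign ?\<omega> (map ?t ?\<omega>) = (if r = vertex_of T a then 1 else -1)"
    unfolding word_sign_map_permutes[OF dist t_perm] by (simp add: sign_swap_id sign_id)
  show "induced_orientation T {a, b} ?\<omega> ?w'"
  proof (rule induced_orientationI[where h = a and rest = ?R])
    show "a \<in> {a, b}" by simp
    show "{a, b} \<in> edges T" using edgeI[OF a_dart a_inner] flip_a by simp
    show "map ?t ?\<omega> = Vertex (vertex_of T a) # Vertex (vertex_of T (flip T a)) # Half a # Half (flip T a) # ?R"
      using \<omega>1 flip_a by simp
    show "map ?u ?w'
        = Vertex (vertex_of T a \<union> vertex_of T (flip T a) - {a, b}) # ?R"
      using \<omega>1' flip_a by (simp add: merge_def)
    show "orientation_word T ?\<omega>" "orientation_word T (map ?t ?\<omega>)"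
      "orientation_word T' ?w'" by fact+
    have d': "distinct ?w'" "set ?w' = cells T'"
      using w' unfolding orientation_word_def by auto
    show "2 \<le> length ?R" using len by simp
    show "orientation_word T' (map ?u ?w') "
      "word_sign ?\<omega> (map ?t ?\<omega>) =
      word_sign ?w' (map ?u ?w')"
    proof -
      have "orientation_word T' (map ?u ?w') \<and>
        word_sign ?w' (map ?u ?w')
          = (if r = vertex_of T a then 1 else -1)"
      proof (cases "r = vertex_of T a")
        case True
        have "merge_cell (Vertex r) = ?c" using True by (simp add: merge_cell_def)
        then have "map ?u ?w' = map merge_cell (Vertex r # R)" by simp
        then show ?thesis using w' word_sign_refl[OF d'(1)] True by metis
      next
        case False
        have r: "merge_cell (Vertex r) = Vertex r" using False by (simp add: merge_cell_def)
        have "merge_cell (Vertex r) \<in> set ?w'" by simp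
        then have u: "?u permutes set ?w'" by (rule permutes_swap_id[OF cset])
        have "word_sign ?w' (map ?u ?w') = -1"
          unfolding word_sign_map_permutes[OF d'(1) u] using c_neq(1) r by (simp add: sign_swap_id)
        moreover have "orientation_word T' (map ?u ?w')"
          unfolding orientation_word_def using d' permutes_image[OF u] permutes_inj_on[OF u]
          by (simp only: distinct_map set_map)
        ultimately show ?thesis using False by simp
      qed
      then show "orientation_word T' (map ?u ?w') "
      "word_sign ?\<omega> (map ?t ?\<omega>) =
      word_sign ?w' (map ?u ?w')"
        unfolding sgn1 by simp_all
    qed
  qed
qed

end

locale collapse_chain =
  fixes n :: nat and T :: "nat \<Rightarrow> ptree" and e :: "nat \<Rightarrow> edge"
  assumes chain: "full_chain n T e"
begin

lemma trivalent: "trivalent_tree n (T 0)"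
  and edges_bij: "bij_betw e {1..n} (edges (T 0))"
  and T_Suc: "i < n \<Longrightarrow> T (Suc i) = contract (T i) (e (Suc i))"
  using chain unfolding full_chain_def by auto

lemma planar_edges_chain:
  "i \<le> n \<Longrightarrow> planar_tree n (T i) \<and> edges (T i) = e ` {Suc i..n}"
proof (induction i)
  case 0
  then show ?case using trivalent edges_bij by (simp add: trivalent_tree_def bij_betw_def)
next
  case (Suc i)
  then have IH: "planar_tree n (T i)" "edges (T i) = e ` {Suc i..n}" and i: "i < n" by auto
  have "e (Suc i) \<in> edges (T i)" using IH(2) i by auto
  then have "planar_tree n (T (Suc i))" and ed: "edges (T (Suc i)) = edges (T i) - {e (Suc i)}"
    using planar_tree_contract[OF IH(1)] T_Suc[OF i] by auto
  moreover have "edges (T i) - {e (Suc i)} = e ` {Suc (Suc i)..n}"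
  proof -
    have "{Suc i..n} = insert (Suc i) {Suc (Suc i)..n}" using i by auto
    moreover have "e (Suc i) \<notin> e ` {Suc (Suc i)..n}"
      using inj_onD[OF bij_betw_imp_inj_on[OF edges_bij], of "Suc i"] i by fastforce
    ultimately show ?thesis unfolding IH(2) by auto
  qed
  ultimately show ?case by simp
qed

lemma planar_chain: "i \<le> n \<Longrightarrow> planar_tree n (T i)"
  and edges_chain: "i \<le> n \<Longrightarrow> edges (T i) = e ` {Suc i..n}"
  using planar_edges_chain by blast+

lemma edge_in_chain: "i < j \<Longrightarrow> j \<le> n \<Longrightarrow> e j \<in> edges (T i)"
  using edges_chain[of i] by auto

lemma flip_chain: "i \<le> n \<Longrightarrow> h \<in> darts (T i) \<Longrightarrow> flip (T i) h = flip (T 0) h"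
proof (induction i)
  case (Suc i)
  then show ?case using T_Suc[of i] by (simp add: flip_contract)
qed simp

lemma edge_dart_chain:
  assumes "i < j" "j \<le> n" "h \<in> e j"
  shows "h \<in> darts (T i)" "\<not> is_leaf h" "e j = {h, flip (T 0) h}"
proof -
  interpret planar_ribbon_tree n "T i" using planar_chain assms by unfold_locales auto
  have ej: "e j \<in> edges (T i)" by (rule edge_in_chain[OF assms(1,2)])
  show "h \<in> darts (T i)" "\<not> is_leaf h" using edge_dart[OF ej assms(3)] by auto
  then show "e j = {h, flip (T 0) h}" using edge_eq[OF ej assms(3)] flip_chain assms by simp
qed

definition edge_triple :: "(nat \<Rightarrow> dart) \<Rightarrow> nat \<Rightarrow> nat \<Rightarrow> cell list" where
  "edge_triple u i j = [Vertex (vertex_of (T i) (u j)), Half (flip (T 0) (u j)), Half (u j)]"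

text \<open>
  A word for \<open>T i\<close> in which the collapses of the remaining edges can be read off: one triple for
  every remaining edge, in the order of the collapses. The vertex in the triple is the one at \<open>u j\<close>
  in \<open>T i\<close>; the letter \<open>r\<close> is the only vertex left over.
\<close>

definition chain_word :: "(nat \<Rightarrow> dart) \<Rightarrow> dart list \<Rightarrow> nat \<Rightarrow> vertex \<Rightarrow> cell list" where
  "chain_word u L i r = Vertex r # concat (map (edge_triple u i) [Suc i..<Suc n]) @ map Half L"

text \<open>
  Deleting the first triple and renaming the merged vertex turns the word for \<open>T i\<close> into the one for
  \<open>T (Suc i)\<close>. The vertices at the other \<open>u j\<close> are different from the one at \<open>u (Suc i)\<close>, since the
  letters of an orientation word are distinct; so at most one of them is renamed, and it is renamed
  correctly.
\<close>

lemma induced_chain_word_step: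
  assumes i: "i < n" and u: "\<And>j. j \<in> {1..n} \<Longrightarrow> u j \<in> e j"
    and L: "length L \<ge> 2" and w: "orientation_word (T i) (chain_word u L i r)"
  shows "\<exists>r'. orientation_word (T (Suc i)) (chain_word u L (Suc i) r') \<and>
    induced_orientation (T i) (e (Suc i)) (chain_word u L i r) (chain_word u L (Suc i) r')"
proof -
  let ?b = "u (Suc i)" let ?a = "flip (T 0) ?b"
  have b: "?b \<in> e (Suc i)" using u i by simp
  have e: "e (Suc i) = {?b, ?a}" "?b \<in> darts (T i)" "\<not> is_leaf ?b" 
    using edge_dart_chain[OF _ _ b] i by auto
  have flip: "flip (T i) ?b = ?a" using flip_chain e i by simp
  interpret P: planar_ribbon_tree n "T i" using planar_chain i by unfold_locales auto
  have "?a \<in> darts (T i)" "\<not> is_leaf ?a"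
    using P.flip_in_darts[of ?b] P.is_leaf_flip[of ?b] e flip by simp_all
  then interpret collapsed_edge n "T i" ?a ?b
    using flip P.flip_flip[of ?b] by unfold_locales auto
  have e': "e (Suc i) = {?a, ?b}" using e by blast
  define R where "R = concat (map (edge_triple u i) [Suc (Suc i)..<Suc n]) @ map Half L"
  have word: "chain_word u L i r = Vertex r # Vertex (vertex_of (T i) ?b) # Half ?a # Half ?b # R"
    using i unfolding chain_word_def R_def by (simp add: upt_rec[of "Suc i"] edge_triple_def del: upt_Suc)
  have triple: "map merge_cell (edge_triple u i j) = edge_triple u (Suc i) j" if j: "j \<in> {Suc (Suc i)..n}" for j
  proof -
    have uj: "u j \<in> e j" using u j by simp
    have "u j \<in> darts (T (Suc i))" using edge_dart_chain(1)[OF _ _ uj, of "Suc i"] j by simp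
    then have D: "u j \<in> darts (T i) - {?a, ?b}" using T_Suc[OF i] e' by simp
    have "Vertex (vertex_of (T i) (u j)) \<in> set R"
      unfolding R_def using j by (auto simp: edge_triple_def intro!: bexI[of _ j])
    then have "vertex_of (T i) (u j) \<noteq> vertex_of (T i) ?b"
      using w unfolding word orientation_word_def by auto
    then have "merge_cell (Vertex (vertex_of (T i) (u j))) = Vertex (merge (vertex_of (T i) (u j)))"
      by (simp add: merge_cell_def merge_def)
    also have "\<dots> = Vertex (vertex_of (T (Suc i)) (u j))"
      using vertex_of_contract[OF D] T_Suc[OF i] e' by simp
    finally show ?thesis by (simp add: edge_triple_def)
  qed
  have mapR: "map merge_cell R = concat (map (edge_triple u (Suc i)) [Suc (Suc i)..<Suc n]) @ map Half L"
  proof -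
    have *: "map (\<lambda>j. map merge_cell (edge_triple u i j)) [Suc (Suc i)..<Suc n] = map (edge_triple u (Suc i)) [Suc (Suc i)..<Suc n]"
      using triple by (intro map_cong) (auto simp: less_Suc_eq_le)
    show ?thesis unfolding R_def map_append map_concat map_map o_def * by simp
  qed
  obtain r' where r': "merge_cell (Vertex r) = Vertex r'" by atomize_elim (simp add: merge_cell_def)
  have "map merge_cell (Vertex r # R) = chain_word u L (Suc i) r'"
    unfolding chain_word_def using mapR r' by simp
  moreover have "length R \<ge> 2" unfolding R_def using L by simp
  ultimately show ?thesis
    using drop_edge_word[of r R] w unfolding word T_Suc[OF i] e' by metis
qed

lemma induced_chain_words:
  assumes u: "\<And>j. j \<in> {1..n} \<Longrightarrow> u j \<in> e j" and L: "length L \<ge> 2"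
    and w: "orientation_word (T 0) (chain_word u L 0 r\<^sub>0)"
  shows "\<exists>r. r 0 = r\<^sub>0 \<and> (\<forall>i\<le>n. orientation_word (T i) (chain_word u L i (r i))) \<and>
    (\<forall>i\<in>{1..n}. induced_orientation (T (i - 1)) (e i) (chain_word u L (i - 1) (r (i - 1))) (chain_word u L i (r i)))"
proof -
  define P where "P i r \<longleftrightarrow> (i \<le> n \<longrightarrow> orientation_word (T i) (chain_word u L i r)) \<and> (i = 0 \<longrightarrow> r = r\<^sub>0)" for i r
  define Q where "Q i r r' \<longleftrightarrow> (i < n \<longrightarrow>
    induced_orientation (T i) (e (Suc i)) (chain_word u L i r) (chain_word u L (Suc i) r'))" for i r r'
  have "\<exists>r. \<forall>i. P i (r i) \<and> Q i (r i) (r (Suc i))"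
  proof (rule dependent_nat_choice)
    show "\<exists>r. P 0 r" using w by (auto simp: P_def)
    fix r i assume r: "P i r"
    show "\<exists>r'. P (Suc i) r' \<and> Q i r r'"
      using induced_chain_word_step[OF _ u L, of i r] r
      by (cases "i < n") (auto simp: P_def Q_def)
  qed
  then obtain r where r: "\<And>i. P i (r i) \<and> Q i (r i) (r (Suc i))" by blast
  have "induced_orientation (T (i - 1)) (e i) (chain_word u L (i - 1) (r (i - 1))) (chain_word u L i (r i))"
    if "i \<in> {1..n}" for i
    using r[of "i - 1"] that by (cases i) (auto simp: Q_def)
  then show ?thesis using r unfolding P_def by blast
qed

end


section \<open>The cyclic order of the regions around an edge\<close>

context collapsed_edge
begin

definition near_side :: "dart set" where
  "near_side = {g \<in> darts T. (vertex_of T a, vertex_of T g) \<in> (adj T (edges T - {{a, b}}))\<^sup>*}"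

lemma near_side_rot [simp]: "rot T g \<in> near_side \<longleftrightarrow> g \<in> near_side"
  unfolding near_side_def by simp

lemma a_near: "a \<in> near_side"
  unfolding near_side_def using a_dart by simp

lemma b_far: "b \<notin> near_side"
  unfolding near_side_def using acyclic[OF a_dart a_inner] flip_a by simp

lemma near_side_flip:
  assumes "g \<in> darts T" "\<not> is_leaf g" "g \<noteq> a" "g \<noteq> b"
  shows "flip T g \<in> near_side \<longleftrightarrow> g \<in> near_side"
proof -
  have "{g, flip T g} \<in> edges T - {{a, b}}"
    using edgeI[OF assms(1,2)] assms(3,4) by (simp add: doubleton_eq_iff)
  then have "(vertex_of T g, vertex_of T (flip T g)) \<in> adj T (edges T - {{a, b}})"
    unfolding adj_def by blast
  then have *: "(vertex_of T g, vertex_of T (flip T g)) \<in> (adj T (edges T - {{a, b}}))\<^sup>*"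
    "(vertex_of T (flip T g), vertex_of T g) \<in> (adj T (edges T - {{a, b}}))\<^sup>*"
    using adj_sym by blast+
  show ?thesis unfolding near_side_def using assms(1) *[THEN rtrancl_trans[rotated]] by auto
qed

lemma corner_step_near_side:
  assumes "(g, g') \<in> corner_step T" "g' \<noteq> a" "g' \<noteq> b"
  shows "g' \<in> near_side \<longleftrightarrow> g \<in> near_side"
proof -
  have g: "g \<in> darts T" "\<not> is_leaf (rot T g)" "g' = flip T (rot T g)"
    using assms(1) by (simp_all add: corner_step_iff)
  have "rot T g \<noteq> a" "rot T g \<noteq> b" using assms(2,3) g(3) flip_a flip_b by metis+
  then show ?thesis using near_side_flip[of "rot T g"] g by simp
qed

text \<open>
  A corner step leaves the far side only by crossing the edge along \<open>b\<close>, which leads to the corner \<open>a\<close>.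
\<close>

lemma corner_step_far_side:
  assumes "(g, g') \<in> corner_step T" "g' \<noteq> a" "g \<notin> near_side"
  shows "g' \<notin> near_side"
  using corner_step_near_side[OF assms(1,2)] assms(3) b_far by metis

lemma region_on_one_side:
  assumes "g' \<in> region_of T g" "a \<notin> region_of T g" "b \<notin> region_of T g"
  shows "g' \<in> near_side \<longleftrightarrow> g \<in> near_side"
proof -
  have "(g, g') \<in> (corner_step T \<union> (corner_step T)\<inverse>)\<^sup>*" using assms(1) unfolding region_of_def by simp
  then show ?thesis
  proof induction
    case (step x y)
    have "x \<in> region_of T g" "y \<in> region_of T g"
      using step.hyps unfolding region_of_def by (auto intro: rtrancl.rtrancl_into_rtrancl)
    then have "x \<noteq> a" "x \<noteq> b" "y \<noteq> a" "y \<noteq> b" using assms(2,3) by auto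
    then show ?case using step corner_step_near_side by auto
  qed simp
qed

text \<open>
  The region starting at \<open>Leaf i\<close> ends at the next leaf. Unless it contains the corner \<open>a\<close>, its walk
  stays on the far side.
\<close>

lemma next_leaf_far_side:
  assumes "i < n + 3" "Leaf i \<notin> near_side" "a \<notin> region_of T (Leaf i)"
  shows "Leaf ((i + 1) mod (n + 3)) \<notin> near_side"
proof -
  obtain h where h: "h \<in> region_of T (Leaf i)" "rot T h = Leaf ((i + 1) mod (n + 3))"
    using next_leaf[OF assms(1)] by blast
  have "h \<notin> near_side" using region_of_leaf[OF h(1)]
  proof induction
    case (step x y)
    have "y \<in> region_of T (Leaf i)" unfolding region_of_def
      using step.hyps rtrancl_mono[of "corner_step T" "corner_step T \<union> (corner_step T)\<inverse>"]
      by (blast intro: rtrancl.rtrancl_into_rtrancl)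
    then have "y \<noteq> a" using assms(3) by blast
    then show ?case using corner_step_far_side[OF step.hyps(2)] step.IH by blast
  qed (rule assms(2))
  then show ?thesis using near_side_rot[of h] h(2) by simp
qed

lemma far_side_run:
  assumes "i < n + 3" "Leaf i \<notin> near_side"
    and "\<And>j. j < m \<Longrightarrow> a \<notin> region_of T (Leaf ((i + j) mod (n + 3)))"
  shows "Leaf ((i + m) mod (n + 3)) \<notin> near_side"
  using assms(3)
proof (induction m)
  case 0
  then show ?case using assms by simp
next
  case (Suc m)
  have "Leaf ((i + m) mod (n + 3)) \<notin> near_side" using Suc by simp
  moreover have "a \<notin> region_of T (Leaf ((i + m) mod (n + 3)))" using Suc.prems by simp
  ultimately have "Leaf (((i + m) mod (n + 3) + 1) mod (n + 3)) \<notin> near_side"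
    by (intro next_leaf_far_side) simp_all
  then show ?case by (simp add: mod_Suc_eq)
qed

end

context planar_ribbon_tree
begin

lemma ccw_regions_simps: "length (ccw_regions n T) = n + 3" "i < n + 3 \<Longrightarrow> ccw_regions n T ! i = region_of T (Leaf i)"
  unfolding ccw_regions_def by (simp_all del: upt_Suc)

text \<open>
  Regions are numbered by their initial leaves; the rotation in the definition of cyclic order is
  absorbed by counting from the leaf of \<open>r\<^sub>0\<close>.
\<close>

lemma cyclic_order4:
  assumes "in_cyclic_order (ccw_regions n T) [r\<^sub>0, r\<^sub>1, r\<^sub>2, r\<^sub>3]"
  obtains i\<^sub>0 m\<^sub>1 m\<^sub>2 m\<^sub>3 where "i\<^sub>0 < n + 3" "0 < m\<^sub>1" "m\<^sub>1 < m\<^sub>2" "m\<^sub>2 < m\<^sub>3" "m\<^sub>3 < n + 3"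
    "r\<^sub>0 = region_of T (Leaf i\<^sub>0)" "r\<^sub>1 = region_of T (Leaf ((i\<^sub>0 + m\<^sub>1) mod (n + 3)))"
    "r\<^sub>2 = region_of T (Leaf ((i\<^sub>0 + m\<^sub>2) mod (n + 3)))" "r\<^sub>3 = region_of T (Leaf ((i\<^sub>0 + m\<^sub>3) mod (n + 3)))"
proof -
  obtain r idx where idx: "sorted_wrt (<) idx" "set idx \<subseteq> {..<n + 3}"
    "rotate r [r\<^sub>0, r\<^sub>1, r\<^sub>2, r\<^sub>3] = map (nth (ccw_regions n T)) idx"
    using assms unfolding in_cyclic_order_def ccw_regions_simps(1) by blast
  have "length idx = 4" using arg_cong[OF idx(3), of length] by simp
  then obtain p q s t where pq: "idx = [p, q, s, t]"
    by (auto simp: numeral_eq_Suc length_Suc_conv)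
  have lt: "p < q" "q < s" "s < t" "t < n + 3" using idx(1,2) unfolding pq by auto
  have R: "map (nth (ccw_regions n T)) idx = map (\<lambda>i. region_of T (Leaf i)) [p, q, s, t]"
    unfolding pq using lt by (simp add: ccw_regions_simps(2))
  have rot: "rotate r [r\<^sub>0, r\<^sub>1, r\<^sub>2, r\<^sub>3] = rotate (r mod 4) [r\<^sub>0, r\<^sub>1, r\<^sub>2, r\<^sub>3]"
    using rotate_conv_mod[of r "[r\<^sub>0, r\<^sub>1, r\<^sub>2, r\<^sub>3]"] by simp
  have "r mod 4 = 0 \<or> r mod 4 = 1 \<or> r mod 4 = 2 \<or> r mod 4 = 3" by arith
  then consider "r\<^sub>0 = region_of T (Leaf p)" "r\<^sub>1 = region_of T (Leaf q)" "r\<^sub>2 = region_of T (Leaf s)" "r\<^sub>3 = region_of T (Leaf t)"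
    | "r\<^sub>1 = region_of T (Leaf p)" "r\<^sub>2 = region_of T (Leaf q)" "r\<^sub>3 = region_of T (Leaf s)" "r\<^sub>0 = region_of T (Leaf t)"
    | "r\<^sub>2 = region_of T (Leaf p)" "r\<^sub>3 = region_of T (Leaf q)" "r\<^sub>0 = region_of T (Leaf s)" "r\<^sub>1 = region_of T (Leaf t)"
    | "r\<^sub>3 = region_of T (Leaf p)" "r\<^sub>0 = region_of T (Leaf q)" "r\<^sub>1 = region_of T (Leaf s)" "r\<^sub>2 = region_of T (Leaf t)"
  proof (elim disjE)
    assume "r mod 4 = 0"
    then show ?thesis using idx(3) that(1) unfolding R rot by simp
  next
    assume "r mod 4 = 1"
    then show ?thesis using idx(3) that(2) unfolding R rot by (simp add: rotate_drop_take)
  next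
    assume "r mod 4 = 2"
    then show ?thesis using idx(3) that(3) unfolding R rot by (simp add: rotate_drop_take)
  next
    assume "r mod 4 = 3"
    then show ?thesis using idx(3) that(4) unfolding R rot by (simp add: rotate_drop_take)
  qed
  then show ?thesis
  proof cases
    case 1
    show ?thesis by (rule that[of p "q - p" "s - p" "t - p"]) (use 1 lt in auto)
  next
    case 2
    show ?thesis
      by (rule that[of t "n + 3 + p - t" "n + 3 + q - t" "n + 3 + s - t"]) (use 2 lt in \<open>auto\<close>)
  next
    case 3
    show ?thesis
      by (rule that[of s "t - s" "n + 3 + p - s" "n + 3 + q - s"]) (use 3 lt in \<open>auto\<close>)
  next
    case 4
    show ?thesis
      by (rule that[of q "s - q" "t - q" "n + 3 + p - q"]) (use 4 lt in \<open>auto\<close>)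
  qed
qed

lemma Leaf_mod_neq:
  assumes "m < m'" "m' < n + 3"
  shows "(i + m) mod (n + 3) \<noteq> (i + m') mod (n + 3)"
proof
  assume "(i + m) mod (n + 3) = (i + m') mod (n + 3)"
  then have "(n + 3) dvd (i + m') - (i + m)" using mod_eq_dvd_iff_nat[of "i + m" "i + m'" "n + 3"] assms by simp
  then show False using assms by (auto dest: dvd_imp_le)
qed

end

context collapsed_edge
begin

text \<open>
  The region at \<open>rot T b\<close> does not run along the edge, so it lies on the far side with its leaf. In the
  reversed order, no region from there up to the one at \<open>rot T a\<close> would contain the corner \<open>a\<close>. Hence the
  leaves of all these regions would lie on the far side; but the region at \<open>rot T a\<close> lies on the near
  side.
\<close>

lemma not_reversed_order:
  assumes "in_cyclic_order (ccw_regions n T)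
    [region_of T a, region_of T (rot T b), region_of T b, region_of T (rot T a)]"
  shows False
proof -
  obtain i\<^sub>0 m\<^sub>1 m\<^sub>2 m\<^sub>3 where m: "i\<^sub>0 < n + 3" "0 < m\<^sub>1" "m\<^sub>1 < m\<^sub>2" "m\<^sub>2 < m\<^sub>3" "m\<^sub>3 < n + 3"
    "region_of T a = region_of T (Leaf i\<^sub>0)" "region_of T (rot T b) = region_of T (Leaf ((i\<^sub>0 + m\<^sub>1) mod (n + 3)))"
    "region_of T b = region_of T (Leaf ((i\<^sub>0 + m\<^sub>2) mod (n + 3)))" "region_of T (rot T a) = region_of T (Leaf ((i\<^sub>0 + m\<^sub>3) mod (n + 3)))"
    using cyclic_order4[OF assms] by metis
  let ?L = "\<lambda>m. (i\<^sub>0 + m) mod (n + 3)"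
  have L: "region_of T (Leaf (?L m)) \<noteq> region_of T (Leaf (?L m'))" if "m < m'" "m' < n + 3" for m m'
    using Leaf_mod_neq[OF that] by (simp add: region_of_Leaf_eq_iff)
  have shift: "(?L m\<^sub>1 + j) mod (n + 3) = ?L (m\<^sub>1 + j)" for j
    by (simp add: mod_add_left_eq add.assoc)
  have L0: "?L 0 = i\<^sub>0" using m(1) by simp
  have ra: "a \<in> region_of T x \<longleftrightarrow> region_of T a = region_of T x" for x using region_of_eq_iff by blast
  have rb: "b \<in> region_of T x \<longleftrightarrow> region_of T b = region_of T x" for x using region_of_eq_iff by blast
  have "region_of T a \<noteq> region_of T (rot T b)" "region_of T b \<noteq> region_of T (rot T b)"
    using L[of 0 m\<^sub>1] L[of m\<^sub>1 m\<^sub>2] m L0 by auto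
  then have "Leaf (?L m\<^sub>1) \<in> near_side \<longleftrightarrow> rot T b \<in> near_side"
    using region_on_one_side[of "Leaf (?L m\<^sub>1)" "rot T b"] m(7) region_of_eq_iff ra rb by (metis self_in_region_of)
  then have far: "Leaf (?L m\<^sub>1) \<notin> near_side" using b_far by simp
  have "Leaf ((?L m\<^sub>1 + (m\<^sub>3 - m\<^sub>1)) mod (n + 3)) \<notin> near_side"
  proof (rule far_side_run[OF _ far])
    show "?L m\<^sub>1 < n + 3" by simp
    fix j assume j: "j < m\<^sub>3 - m\<^sub>1"
    have "(?L m\<^sub>1 + j) mod (n + 3) = ?L (m\<^sub>1 + j)" by (rule shift)
    moreover have "region_of T a \<noteq> region_of T (Leaf (?L (m\<^sub>1 + j)))"
      using L[of 0 "m\<^sub>1 + j"] j m L0 by simp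
    ultimately show "a \<notin> region_of T (Leaf ((?L m\<^sub>1 + j) mod (n + 3)))" using ra by simp
  qed
  moreover have "(?L m\<^sub>1 + (m\<^sub>3 - m\<^sub>1)) mod (n + 3) = ?L m\<^sub>3"
    unfolding shift using m by simp
  ultimately have far3: "Leaf (?L m\<^sub>3) \<notin> near_side" by simp
  have "region_of T a \<noteq> region_of T (rot T a)" "region_of T b \<noteq> region_of T (rot T a)"
    using L[of 0 m\<^sub>3] L[of m\<^sub>2 m\<^sub>3] m L0 by auto
  then have "Leaf (?L m\<^sub>3) \<in> near_side \<longleftrightarrow> rot T a \<in> near_side"
    using region_on_one_side[of "Leaf (?L m\<^sub>3)" "rot T a"] m(9) region_of_eq_iff ra rb by (metis self_in_region_of)
  then show False using far3 a_near by simp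
qed

end


section \<open>Flags of faces of a convex set\<close>

lemma trivial_limit_left_end: "at (1::real) within {0<..1} \<noteq> bot"
proof -
  have "at_left (1::real) \<le> at 1 within {0<..1}"
  proof (rule filter_leI)
    fix Q assume "eventually Q (at (1::real) within {0<..1})"
    then have "eventually (\<lambda>s. s \<in> {0<..1} \<longrightarrow> s \<noteq> 1 \<longrightarrow> Q s) (nhds 1)"
      by (simp add: eventually_at_filter eventually_mono)
    moreover have "eventually (\<lambda>s::real. s > 0) (nhds 1)"
      by (rule eventually_nhds_in_open[of "{0<..}", simplified]) simp_all
    ultimately show "eventually Q (at_left (1::real))"
      unfolding eventually_at_filter by eventually_elim auto
  qed
  then show ?thesis using trivial_limit_at_left_real[of "1::real"] by (metis bot.extremum_uniqueI trivial_limit_def eventually_False)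
qed

lemma velocity_limit:
  fixes c :: "real \<Rightarrow> 'v::euclidean_space"
  assumes "c differentiable (at 1 within {0<..1})"
  shows "((\<lambda>s. (c s - c 1) /\<^sub>R (s - 1)) \<longlongrightarrow> vector_derivative c (at 1 within {0<..1})) (at 1 within {0<..1})"
proof -
  let ?D = "vector_derivative c (at 1 within {0<..1})"
  let ?g = "\<lambda>s. (1 / norm (s - 1)) *\<^sub>R (c s - (c 1 + (s - 1) *\<^sub>R ?D))"
  have "(c has_vector_derivative ?D) (at 1 within {0<..1})"
    using assms by (simp add: vector_derivative_works)
  then have "(?g \<longlongrightarrow> 0) (at 1 within {0<..1})"
    unfolding has_vector_derivative_def has_derivative_within by blast
  then have "((\<lambda>s. norm (?g s)) \<longlongrightarrow> 0) (at 1 within {0<..1})" by (rule tendsto_norm_zero)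
  moreover have "norm (?g s) = norm ((c s - c 1) /\<^sub>R (s - 1) - ?D)" if "s \<noteq> 1" for s
  proof -
    have "(c s - c 1) /\<^sub>R (s - 1) - ?D = (1 / (s - 1)) *\<^sub>R (c s - (c 1 + (s - 1) *\<^sub>R ?D))"
    proof -
      have "(1 / (s - 1)) *\<^sub>R (c s - (c 1 + (s - 1) *\<^sub>R ?D))
        = (1 / (s - 1)) *\<^sub>R (c s - c 1) - (1 / (s - 1)) *\<^sub>R ((s - 1) *\<^sub>R ?D)"
        by (simp only: scaleR_diff_right[symmetric] diff_diff_eq)
      then show ?thesis using that by (simp add: inverse_eq_divide)
    qed
    then show ?thesis by simp
  qed
  then have "eventually (\<lambda>s. norm (?g s) = norm ((c s - c 1) /\<^sub>R (s - 1) - ?D)) (at 1 within {0<..1})"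
    unfolding eventually_at_filter by (intro always_eventually) blast
  ultimately have "((\<lambda>s. norm ((c s - c 1) /\<^sub>R (s - 1) - ?D)) \<longlongrightarrow> 0) (at 1 within {0<..1})"
    by (rule Lim_transform_eventually)
  then show ?thesis by (rule LIM_zero_cancel[OF tendsto_norm_zero_cancel])
qed

text \<open>
  A complete flag of faces starting at a vertex \<open>p\<close>, together with curves that end at \<open>p\<close> and run in
  the faces of the flag. Time runs towards \<open>p\<close>, so the velocities \<open>t j\<close> point out of the faces.
\<close>

locale flag_of_faces =
  fixes n :: nat and F :: "nat \<Rightarrow> 'v::euclidean_space set" and c :: "nat \<Rightarrow> real \<Rightarrow> 'v" and p :: 'v
    and t :: "nat \<Rightarrow> 'v"
  assumes convex_F: "i \<le> n \<Longrightarrow> convex (F i)"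
    and face: "i < n \<Longrightarrow> F i face_of F (Suc i)"
    and dim_F: "i \<le> n \<Longrightarrow> aff_dim (F i) = int i"
    and base: "p \<in> F 0"
    and curve: "j \<in> {1..n} \<Longrightarrow> c j differentiable (at 1 within {0<..1})"
    and curve_end: "j \<in> {1..n} \<Longrightarrow> c j 1 = p"
    and curve_in: "j \<in> {1..n} \<Longrightarrow> 0 < s \<Longrightarrow> s < 1 \<Longrightarrow> c j s \<in> F j"
    and velocity: "j \<in> {1..n} \<Longrightarrow> t j = vector_derivative (c j) (at 1 within {0<..1})"
    and inj_t: "inj_on t {1..n}"
    and independent_t: "independent (t ` {1..n})"
begin

lemma F_mono: "i \<le> j \<Longrightarrow> j \<le> n \<Longrightarrow> F i \<subseteq> F j"
proof (induction rule: dec_induct)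
  case (step k)
  then show ?case using face_of_imp_subset[OF face[of k]] by auto
qed simp

lemma p_in: "i \<le> n \<Longrightarrow> p \<in> F i"
  using F_mono[of 0 i] base by auto

lemma curve_mem:
  assumes "j \<in> {1..n}" "j \<le> i" "i \<le> n" "s \<in> {0<..1}"
  shows "c j s \<in> F i"
proof (cases "s = 1")
  case True
  then show ?thesis unfolding True curve_end[OF assms(1)] by (intro p_in assms(3))
next
  case False
  then have "c j s \<in> F j" using curve_in[OF assms(1), of s] assms(4) by simp
  then show ?thesis using F_mono[OF assms(2,3)] by blast
qed

definition directions :: "nat \<Rightarrow> 'v set" where
  "directions i = span ((\<lambda>y. y - p) ` F i)"

lemma directionsI: "y \<in> F i \<Longrightarrow> y - p \<in> directions i"
  unfolding directions_def by (intro span_base) auto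

lemma dim_directions: "i \<le> n \<Longrightarrow> dim (directions i) = i"
proof -
  assume i: "i \<le> n"
  have "aff_dim (F i) = int (dim ((\<lambda>y. y - p) ` F i))"
    by (rule aff_dim_eq_dim_subtract[OF hull_inc[OF p_in[OF i]]])
  then show "dim (directions i) = i" unfolding directions_def dim_span dim_F[OF i] by linarith
qed

text \<open>
  The difference quotients lie in the subspace of directions, which is closed.
\<close>

lemma velocity_in_directions:
  assumes j: "j \<in> {1..n}" "j \<le> i" "i \<le> n"
  shows "t j \<in> directions i"
proof (rule Lim_in_closed_set)
  show "closed (directions i)" unfolding directions_def by (simp add: closed_subspace)
  show "((\<lambda>s. (c j s - c j 1) /\<^sub>R (s - 1)) \<longlongrightarrow> t j) (at 1 within {0<..1})"
    unfolding velocity[OF j(1)] by (rule velocity_limit[OF curve[OF j(1)]])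
  show "eventually (\<lambda>s. (c j s - c j 1) /\<^sub>R (s - 1) \<in> directions i) (at 1 within {0<..1})"
    unfolding eventually_at_filter curve_end[OF j(1)]
    by (rule always_eventually) (auto intro!: directionsI[THEN span_scale[of _ "(\<lambda>y. y - p) ` F i", folded directions_def]] curve_mem[OF j])
qed (rule trivial_limit_left_end)

lemma span_velocities:
  assumes "i \<le> n"
  shows "span (t ` {1..i}) = directions i"
proof
  have sub: "t ` {1..i} \<subseteq> directions i"
  proof (rule image_subsetI)
    fix j assume "j \<in> {1..i}"
    then show "t j \<in> directions i" by (intro velocity_in_directions) (use assms in simp_all)
  qed
  then show "span (t ` {1..i}) \<subseteq> directions i" unfolding directions_def by (simp add: span_minimal)
  have "{1..i} \<subseteq> {1..n}" using assms by auto
  then have "independent (t ` {1..i})" by (intro independent_mono[OF independent_t] image_mono)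
  moreover have "card (t ` {1..i}) = i"
    using card_image[OF inj_on_subset[OF inj_t \<open>{1..i} \<subseteq> {1..n}\<close>]] by simp
  ultimately show "directions i \<subseteq> span (t ` {1..i})"
    using card_ge_dim_independent[OF sub] dim_directions[OF assms] by simp
qed

text \<open>
  A face is the intersection of its affine hull with the larger face.
\<close>

lemma mem_F_iff:
  assumes "i < n" "y \<in> F (Suc i)"
  shows "y \<in> F i \<longleftrightarrow> y - p \<in> directions i"
proof
  assume "y - p \<in> directions i"
  moreover have "affine hull F i = (\<lambda>x. p + x) ` span ((\<lambda>x. - p + x) ` F i)"
    by (rule affine_hull_span_gen[OF hull_inc[OF p_in]]) (use assms(1) in simp)
  moreover have "(\<lambda>x. - p + x) ` F i = (\<lambda>y. y - p) ` F i" by simp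
  ultimately have "p + (y - p) \<in> affine hull F i" unfolding directions_def by (metis imageI)
  moreover have "F i = affine hull F i \<inter> F (Suc i)"
    by (rule face_of_imp_eq_affine_Int[OF convex_F face]) (use assms(1) in simp_all)
  ultimately show "y \<in> F i" using assms(2) by auto
qed (rule directionsI)

text \<open>
  The \<open>i\<close>-th coordinate \<open>\<phi>\<close> of \<open>y - p\<close> with respect to the basis \<open>t\<close> vanishes on \<open>F (i - 1)\<close> and nowhere else on
  \<open>F i\<close>. As \<open>F (i - 1)\<close> is a face, \<open>\<phi>\<close> has constant sign on the rest of \<open>F i\<close>. If it were positive there,
  then \<open>\<phi>\<close> would decrease along the curve \<open>c i\<close> to the value 0 at \<open>p\<close>, whereas \<open>\<phi> (t i) = 1\<close>.
\<close>

lemma flag_coordinates: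
  assumes i: "i \<in> {1..n}" and x: "x \<in> F i" "x \<notin> F (i - 1)"
  shows "\<exists>a. x - p = (\<Sum>l=1..i. a l *\<^sub>R t l) \<and> a i < 0"
proof -
  obtain k where k: "i = Suc k" "k < n" using i by (cases i) auto
  have inj: "inj_on t {1..i}" by (rule inj_on_subset[OF inj_t]) (use i in simp)
  have "x - p \<in> span (t ` {1..i})" using directionsI[OF x(1)] span_velocities[of i] i by simp
  then obtain r where "x - p = (\<Sum>v\<in>t ` {1..i}. r v *\<^sub>R v)"
    using span_finite[of "t ` {1..i}"] by auto
  then have a: "x - p = (\<Sum>l=1..i. r (t l) *\<^sub>R t l)" unfolding sum.reindex[OF inj] o_def .
  obtain \<phi> :: "'v \<Rightarrow> real" where \<phi>: "linear \<phi>" "\<And>v. v \<in> t ` {1..n} \<Longrightarrow> \<phi> v = (if v = t i then 1 else 0)"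
    using linear_independent_extend[OF independent_t, of "\<lambda>v. if v = t i then 1 else 0"] by blast
  have \<phi>t: "\<phi> (t l) = (if l = i then 1 else 0)" if "l \<in> {1..n}" for l
  proof -
    have "t l = t i \<longleftrightarrow> l = i" using inj_on_eq_iff[OF inj_t that i] .
    then show ?thesis using \<phi>(2)[of "t l"] that by simp
  qed
  have \<phi>x: "\<phi> (x - p) = r (t i)"
  proof -
    have "\<phi> (x - p) = (\<Sum>l=1..i. r (t l) * \<phi> (t l))"
      unfolding a using \<phi>(1) by (simp add: linear_sum linear_cmul)
    also have "\<dots> = (\<Sum>l=1..i. if l = i then r (t i) else 0)"
      using \<phi>t i by (intro sum.cong) auto
    also have "\<dots> = r (t i)" using i by simp
    finally show ?thesis .
  qed
  have \<phi>0: "\<phi> v = 0" if "v \<in> directions k" for v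
  proof -
    have "v \<in> span (t ` {1..k})" using that span_velocities[of k] k by simp
    then show ?thesis by (rule linear_eq_0_on_span[OF \<phi>(1), rotated]) (use \<phi>t k in auto)
  qed
  have zero: "y \<in> F k" if y: "y \<in> F i" "\<phi> (y - p) = 0" for y
  proof -
    have "{1..i} = insert i {1..k}" using k by auto
    then have "y - p \<in> span (insert (t i) (t ` {1..k}))"
      using directionsI[OF y(1)] span_velocities[of i] i by simp
    then obtain m where m: "y - p - m *\<^sub>R t i \<in> span (t ` {1..k})" unfolding span_breakdown_eq by blast
    then have "\<phi> (y - p - m *\<^sub>R t i) = 0" using \<phi>0 span_velocities[of k] k by simp
    then have "m = 0" using y(2) \<phi>t[OF i] by (simp add: linear_diff[OF \<phi>(1)] linear_cmul[OF \<phi>(1)])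
    then have "y - p \<in> directions k" using m span_velocities[of k] k by simp
    then show ?thesis using mem_F_iff[OF k(2)] y(1) k by simp
  qed
  have xk: "x \<notin> F k" using x(2) k by simp
  then have "\<phi> (x - p) \<noteq> 0" using zero x(1) by blast
  moreover have "\<not> \<phi> (x - p) > 0"
  proof
    assume pos: "\<phi> (x - p) > 0"
    have nonneg: "\<phi> (y - p) \<ge> 0" if y: "y \<in> F i" for y
    proof (rule ccontr)
      assume "\<not> \<phi> (y - p) \<ge> 0"
      then have neg: "\<phi> (y - p) < 0" by simp
      \<comment> \<open>the zero of \<open>\<phi>\<close> on the segment from \<open>x\<close> to \<open>y\<close> lies in \<open>F k\<close>\<close>
      define u where "u = \<phi> (x - p) / (\<phi> (x - p) - \<phi> (y - p))"
      have u: "0 < u" "u < 1" using pos neg by (simp_all add: u_def field_simps)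
      define z where "z = (1 - u) *\<^sub>R x + u *\<^sub>R y"
      have "x \<noteq> y" using pos neg by auto
      then have z: "z \<in> open_segment x y" unfolding in_segment z_def using u by blast
      have "z \<in> F i" unfolding z_def using convex_F[of i] x(1) y u i by (simp add: convex_def)
      moreover have "\<phi> (z - p) = 0"
      proof -
        have "z - p = (1 - u) *\<^sub>R (x - p) + u *\<^sub>R (y - p)" unfolding z_def by (simp add: algebra_simps)
        then have "\<phi> (z - p) = (1 - u) * \<phi> (x - p) + u * \<phi> (y - p)"
          using \<phi>(1) by (simp add: linear_add linear_cmul)
        also have "\<dots> = \<phi> (x - p) - u * (\<phi> (x - p) - \<phi> (y - p))" by (simp add: algebra_simps)
        also have "\<dots> = 0" using pos neg by (simp add: u_def)
        finally show ?thesis .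
      qed
      ultimately have "z \<in> F k" by (rule zero)
      then have "x \<in> F k" using face_ofD[OF face[OF k(2)] z] x(1) y k by blast
      then show False using xk by blast
    qed
    have lim: "((\<lambda>s. \<phi> ((c i s - c i 1) /\<^sub>R (s - 1))) \<longlongrightarrow> \<phi> (t i)) (at 1 within {0<..1})"
    proof -
      have "isCont \<phi> (t i)" using \<phi>(1) by (simp add: linear_continuous_at linear_conv_bounded_linear)
      moreover have "((\<lambda>s. (c i s - c i 1) /\<^sub>R (s - 1)) \<longlongrightarrow> t i) (at 1 within {0<..1})"
        unfolding velocity[OF i] by (rule velocity_limit[OF curve[OF i]])
      ultimately show ?thesis by (rule isCont_tendsto_compose)
    qed
    have "eventually (\<lambda>s. \<phi> ((c i s - c i 1) /\<^sub>R (s - 1)) \<le> 0) (at 1 within {0<..1})"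
      unfolding eventually_at_filter
    proof (rule always_eventually, intro allI impI)
      fix s :: real assume s: "s \<noteq> 1" "s \<in> {0<..1}"
      have "\<phi> (c i s - p) \<ge> 0" using nonneg curve_mem[OF i _ _ s(2), of i] i by simp
      moreover have "s - 1 < 0" using s by simp
      ultimately show "\<phi> ((c i s - c i 1) /\<^sub>R (s - 1)) \<le> 0"
        unfolding curve_end[OF i] linear_cmul[OF \<phi>(1)]
        by (simp add: mult_nonpos_nonneg)
    qed
    then have "\<phi> (t i) \<le> 0" using tendsto_upperbound[OF lim _ trivial_limit_left_end] by blast
    then show False using \<phi>t[OF i] by simp
  qed
  ultimately have "r (t i) < 0" using \<phi>x by simp
  then show ?thesis using a by (intro exI[of _ "\<lambda>l. r (t l)"]) simp
qed

end

lemma ordered_basis_span: "ordered_basis (B :: 'v::euclidean_space list) \<Longrightarrow> span (set B) = UNIV"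
proof -
  assume B: "ordered_basis B"
  then have "card (set B) = DIM('v)" "independent (set B)"
    by (simp_all add: ordered_basis_def distinct_card)
  then have "UNIV \<subseteq> span (set B)" by (intro card_ge_dim_independent) auto
  then show ?thesis by blast
qed

text \<open>
  The matrix of the new frame is the old one times an upper triangular matrix with \<open>n\<close> negative
  diagonal entries, whose determinant is positive because \<open>n\<close> is even.
\<close>

lemma frame_sign_triangular:
  fixes y t :: "nat \<Rightarrow> 'v::euclidean_space"
  assumes B: "ordered_basis B" "length B = n" and n: "even n"
    and tri: "\<And>j. j \<in> {1..n} \<Longrightarrow> y j = (\<Sum>l=1..j. a j l *\<^sub>R t l)"
    and diag: "\<And>j. j \<in> {1..n} \<Longrightarrow> a j j < (0::real)"
  shows "frame_sign B (map y [1..<Suc n]) = frame_sign B (map t [1..<Suc n])"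
proof -
  define r where "r b v = representation (set B) v b" for b v
  have r_sum: "r b (\<Sum>l\<in>S. f l *\<^sub>R g l) = (\<Sum>l\<in>S. f l * r b (g l))" for b S and f :: "nat \<Rightarrow> real" and g :: "nat \<Rightarrow> 'v"
  proof -
    have ind: "independent (set B)" using B(1) unfolding ordered_basis_def by blast
    have sp: "v \<in> span (set B)" for v using ordered_basis_span[OF B(1)] by simp
    show ?thesis unfolding r_def by (simp add: representation_sum[OF ind sp] representation_scale[OF ind sp])
  qed
  let ?M = "\<lambda>z. Matrix.mat n n (\<lambda>(i, j). r (B ! i) (z (Suc j)))"
  have frame: "frame_sign B (map z [1..<Suc n]) = sgn (Determinant.det (?M z))" for z
  proof -
    have "Matrix.mat n n (\<lambda>(i, j). representation (set B) (map z [1..<Suc n] ! j) (B ! i)) = ?M z"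
      by (rule Matrix.eq_matI) (auto simp: r_def simp del: upt_Suc)
    then show ?thesis unfolding frame_sign_def B(2) by simp
  qed
  define U where "U = Matrix.mat n n (\<lambda>(l, j). if l \<le> j then a (Suc j) (Suc l) else 0)"
  have U: "U \<in> carrier_mat n n" unfolding U_def by simp
  have "?M y = ?M t * U"
  proof (rule Matrix.eq_matI)
    fix i j assume "i < dim_row (?M t * U)" "j < dim_col (?M t * U)"
    then have ij: "i < n" "j < n" by (simp_all add: U_def)
    have "(?M t * U) $$ (i, j) = (\<Sum>l\<in>{0..<n}. r (B ! i) (t (Suc l)) * (if l \<le> j then a (Suc j) (Suc l) else 0))"
      using ij by (simp add: U_def scalar_prod_def)
    also have "\<dots> = (\<Sum>l\<in>{0..j}. a (Suc j) (Suc l) * r (B ! i) (t (Suc l)))"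
      using ij by (intro sum.mono_neutral_cong_right) auto
    also have "\<dots> = (\<Sum>l=1..Suc j. a (Suc j) l * r (B ! i) (t l))"
      by (subst sum.shift_bounds_cl_Suc_ivl[symmetric]) simp
    also have "\<dots> = r (B ! i) (y (Suc j))"
    proof -
      have "Suc j \<in> {1..n}" using ij by simp
      show ?thesis unfolding tri[OF \<open>Suc j \<in> {1..n}\<close>] r_sum by (rule refl)
    qed
    finally show "?M y $$ (i, j) = (?M t * U) $$ (i, j)" using ij by simp
  qed (simp_all add: U_def)
  then have "Determinant.det (?M y) = Determinant.det (?M t) * Determinant.det U"
    using det_mult[of "?M t" n U] U by simp
  moreover have "Determinant.det U > 0"
  proof -
    have "Determinant.det U = prod_list (diag_mat U)"
      by (rule det_upper_triangular[OF _ U]) (auto simp: U_def upper_triangular_def)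
    also have "diag_mat U = map (\<lambda>j. a (Suc j) (Suc j)) [0..<n]"
      unfolding diag_mat_def U_def by (intro nth_equalityI) auto
    also have "prod_list (map (\<lambda>j. a (Suc j) (Suc j)) [0..<m]) * (-1) ^ m > 0" if "m \<le> n" for m
      using that
    proof (induction m)
      case (Suc m)
      then have "a (Suc m) (Suc m) < 0" using diag by simp
      then show ?case using Suc by (simp add: mult_neg_neg mult.assoc) (simp add: mult.left_commute mult_pos_neg zero_less_mult_iff mult_less_0_iff)
    qed simp
    note this[of n]
    finally show ?thesis using n by simp
  qed
  ultimately show ?thesis unfolding frame by (simp add: sgn_mult)
qed

lemma frame_sign_permute:
  fixes B C :: "'v::euclidean_space list"
  assumes "length C = length B" "p permutes {..<length C}"
  shows "frame_sign B (permute_list p C) = of_int (sign p) * frame_sign B C"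
proof -
  let ?n = "length B"
  define r where "r i v = representation (set B) v (B ! i)" for i v
  define A where "A = Matrix.mat ?n ?n (\<lambda>(i, j). r j (C ! i))"
  have p: "p permutes {0..<?n}" using assms by (simp add: atLeast0LessThan)
  have A: "A \<in> carrier_mat ?n ?n" unfolding A_def by simp
  have tr: "Determinant.det (Matrix.mat ?n ?n (\<lambda>(i, j). f j i)) = Determinant.det (Matrix.mat ?n ?n (\<lambda>(i, j). f i j))"
    for f :: "nat \<Rightarrow> nat \<Rightarrow> real"
  proof -
    have "transpose_mat (Matrix.mat ?n ?n (\<lambda>(i, j). f i j)) = Matrix.mat ?n ?n (\<lambda>(i, j). f j i)"
      by (rule Matrix.eq_matI) auto
    then show ?thesis using Determinant.det_transpose[of "Matrix.mat ?n ?n (\<lambda>(i, j). f i j)" ?n] by simp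
  qed
  have "frame_sign B (permute_list p C) = sgn (Determinant.det (Matrix.mat ?n ?n (\<lambda>(i, j). r j (permute_list p C ! i))))"
    unfolding frame_sign_def r_def using tr[of "\<lambda>i j. representation (set B) (permute_list p C ! i) (B ! j)"] by simp
  also have "Matrix.mat ?n ?n (\<lambda>(i, j). r j (permute_list p C ! i)) = Matrix.mat ?n ?n (\<lambda>(i, j). A $$ (p i, j))"
  proof (rule Matrix.eq_matI)
    fix i j assume "i < dim_row (Matrix.mat ?n ?n (\<lambda>(i, j). A $$ (p i, j)))" "j < dim_col (Matrix.mat ?n ?n (\<lambda>(i, j). A $$ (p i, j)))"
    then have ij: "i < ?n" "j < ?n" by simp_all
    then have "p i < ?n" using permutes_in_image[OF p] by simp
    then show "Matrix.mat ?n ?n (\<lambda>(i, j). r j (permute_list p C ! i)) $$ (i, j) = Matrix.mat ?n ?n (\<lambda>(i, j). A $$ (p i, j)) $$ (i, j)"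
      using ij permute_list_nth[OF assms(2)] assms(1) by (simp add: A_def)
  qed simp_all
  also have "Determinant.det \<dots> = signof p * Determinant.det A" by (rule det_permute_rows[OF A p])
  also have "sgn (signof p * Determinant.det A) = of_int (sign p) * sgn (Determinant.det A)"
    by (simp add: sgn_mult sign_def)
  also have "sgn (Determinant.det A) = frame_sign B C"
    unfolding frame_sign_def A_def r_def using tr[of "\<lambda>i j. representation (set B) (C ! i) (B ! j)"] by simp
  finally show ?thesis .
qed

lemma frame_sign_rev:
  fixes B C :: "'v::euclidean_space list"
  assumes "distinct C" "length C = length B"
  shows "frame_sign B C = (-1) ^ (length C * (length C - 1) div 2) * frame_sign B (rev C)"
proof -
  obtain p where p: "p permutes {..<length (rev C)}" "permute_list p (rev C) = C"
    by (rule ex_permute_list[of "rev C" C]) (use assms in auto)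
  have "frame_sign B (permute_list p (rev C)) = of_int (sign p) * frame_sign B (rev C)"
    using frame_sign_permute[of "rev C" B p] p(1) assms(2) by simp
  moreover have "sign p = (-1) ^ (length C * (length C - 1) div 2)"
    using word_sign_permute_list[of "rev C" p] word_sign_rev[OF assms(1)] p assms(1) by simp
  ultimately show ?thesis unfolding p(2) by simp
qed


section \<open>The natural orientation of a rooted trivalent tree\<close>

declare upt_Suc [simp del]

lemma distinct_concat_mapD: "distinct (concat (map f xs)) \<Longrightarrow> x \<in> set xs \<Longrightarrow> distinct (f x)"
  by (induction xs) auto

text \<open>
  The triple \<open>f j\<close> has odd length, so moving it to the front contributes one factor \<open>-1\<close> for every
  letter that it passes. The prefix \<open>as\<close> grows by the letter \<open>g j\<close> in each round.
\<close>

lemma shuffle_triples_sign: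
  assumes "distinct (as @ concat (map blk js))"
    and "\<And>j. j \<in> set js \<Longrightarrow> mset (blk j) = mset (f j @ [g j]) \<and> word_sign (blk j) (f j @ [g j]) = 1 \<and> length (f j) = 3"
  shows "mset (as @ concat (map blk js)) = mset (concat (map f js) @ as @ map g js) \<and>
    word_sign (as @ concat (map blk js)) (concat (map f js) @ as @ map g js)
      = (-1) ^ (\<Sum>i<length js. length as + i)"
  using assms
proof (induction js arbitrary: as)
  case Nil
  then show ?case by (simp add: word_sign_refl)
next
  case (Cons j js)
  have j: "mset (blk j) = mset (f j @ [g j])" "word_sign (blk j) (f j @ [g j]) = 1" "length (f j) = 3"
    using Cons.prems(2)[of j] by simp_all
  let ?B = "concat (map blk js)"
  let ?w0 = "as @ blk j @ ?B" and ?w1 = "as @ (f j @ [g j]) @ ?B" and ?w2 = "f j @ (as @ [g j]) @ ?B"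
  let ?w3 = "f j @ (concat (map f js) @ (as @ [g j]) @ map g js)"
  have d0: "distinct ?w0" using Cons.prems(1) by simp
  have m1: "mset ?w1 = mset ?w0" and m2: "mset ?w2 = mset ?w0" using j(1) by simp_all
  have d1: "distinct ?w1" and d2: "distinct ?w2" using d0 m1 m2 mset_eq_imp_distinct_iff by blast+
  have IH: "mset ((as @ [g j]) @ ?B) = mset (concat (map f js) @ (as @ [g j]) @ map g js) \<and>
    word_sign ((as @ [g j]) @ ?B) (concat (map f js) @ (as @ [g j]) @ map g js)
      = (-1) ^ (\<Sum>i<length js. length (as @ [g j]) + i)"
  proof (rule Cons.IH)
    show "distinct ((as @ [g j]) @ ?B)" using d2 by simp
  qed (use Cons.prems(2) in simp)
  then have m3: "mset ?w3 = mset ?w0" using m2 by simp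
  then have d3: "distinct ?w3" using d0 mset_eq_imp_distinct_iff by blast
  note s = mset_eq_setD[OF m1] mset_eq_setD[OF m2] mset_eq_setD[OF m3]
  have d1': "distinct (f j @ [g j])" using d1 by simp
  have w01: "word_sign ?w0 ?w1 = 1"
    using word_sign_context[of as "blk j" ?B "f j @ [g j]"] d0 d1' j mset_eq_setD[OF j(1)] by simp
  have w12: "word_sign ?w1 ?w2 = (-1) ^ length as"
    using word_sign_swap_blocks_context[of "[]" as "f j" "[g j] @ ?B"] d1 j(3)
    by (cases "even (length as)") simp_all
  have d3': "distinct (concat (map f js) @ (as @ [g j]) @ map g js)" using d3 by simp
  have w23: "word_sign ?w2 ?w3 = (-1) ^ (\<Sum>i<length js. Suc (length as) + i)"
    using word_sign_context[of "f j" "(as @ [g j]) @ ?B" "[]" "concat (map f js) @ (as @ [g j]) @ map g js"]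
      d2 d3' IH mset_eq_setD[OF conjunct1[OF IH]] by simp
  have "word_sign ?w0 ?w3 = word_sign ?w0 ?w1 * word_sign ?w1 ?w3"
    by (rule word_sign_trans[OF d0 d1 d3]) (use s in simp_all)
  also have "word_sign ?w1 ?w3 = word_sign ?w1 ?w2 * word_sign ?w2 ?w3"
    by (rule word_sign_trans[OF d1 d2 d3]) (use s in simp_all)
  finally have "word_sign ?w0 ?w3 = (-1) ^ (length as + (\<Sum>i<length js. Suc (length as) + i))"
    using w01 w12 w23 by (simp add: power_add)
  moreover have "(\<Sum>i<length (j # js). length as + i) = length as + (\<Sum>i<length js. Suc (length as) + i)"
    by (simp only: list.size(4) add_Suc_right add_0_right sum.lessThan_Suc_shift) simp
  moreover have "?w0 = as @ concat (map blk (j # js))"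
    and "?w3 = concat (map f (j # js)) @ as @ map g (j # js)" by simp_all
  ultimately show ?case using m3 by (simp only:)
qed

locale trivalent_ribbon_tree = planar_ribbon_tree +
  assumes trivalent: "w \<in> vertices T \<Longrightarrow> card w = 3"
begin

lemma vertex_triple:
  assumes "h \<in> darts T"
  shows "rot T (rot T h) \<noteq> h" "rot T (rot T (rot T h)) = h"
    "vertex_of T h = {h, rot T h, rot T (rot T h)}"
proof -
  have c: "card (vertex_of T h) = 3" using trivalent assms by simp
  then have fin: "finite (vertex_of T h)" using card.infinite by fastforce
  show 1: "rot T (rot T h) \<noteq> h"
  proof
    assume r: "rot T (rot T h) = h"
    have "g \<in> {h, rot T h}" if "g \<in> vertex_of T h" for g
      using that unfolding vertex_of_def by induction (use r in auto)
    then have "card (vertex_of T h) \<le> card {h, rot T h}" by (intro card_mono) auto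
    also have "\<dots> \<le> 2" by (simp add: card_insert_if)
    finally show False using c by simp
  qed
  have "{h, rot T h, rot T (rot T h)} \<subseteq> vertex_of T h" by (auto simp: vertex_of_simps)
  moreover have "card {h, rot T h, rot T (rot T h)} = 3"
    using 1 rot_neq[OF assms] by (auto simp: card_insert_if)
  ultimately show v: "vertex_of T h = {h, rot T h, rot T (rot T h)}"
    using card_subset_eq[OF fin] c by metis
  have "rot T (rot T (rot T h)) \<in> vertex_of T h" by (simp add: vertex_of_simps)
  then show "rot T (rot T (rot T h)) = h" unfolding v using 1 rot_neq[OF assms] by auto
qed

lemma vertex_block_trivalent:
  assumes "h \<in> darts T"
  shows "vertex_block T h = [Vertex (vertex_of T h), Half h, Half (rot T h), Half (rot T (rot T h))]"
  using trivalent[OF vertex_of_in_vertices[OF assms]]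
  by (simp add: vertex_block_def numeral_3_eq_3 upt_conv_Cons)

end

text \<open>
  The half-edge \<open>h\<^sub>0\<close> lies at the root, and \<open>u j\<close> is the half of \<open>e j\<close> that points towards the root. Every
  vertex but the root has exactly one such half-edge, by distinctness and counting. The depth grows away from the root.
\<close>

locale rooted_trivalent_tree = trivalent_ribbon_tree +
  fixes e :: "nat \<Rightarrow> edge" and u :: "nat \<Rightarrow> dart" and h\<^sub>0 :: dart and depth :: "vertex \<Rightarrow> nat"
  assumes edges_bij: "bij_betw e {1..n} (edges T)"
    and up: "j \<in> {1..n} \<Longrightarrow> u j \<in> e j"
    and root: "h\<^sub>0 \<in> darts T"
    and vertices_distinct: "distinct (map (vertex_of T) (h\<^sub>0 # map u [1..<Suc n]))"
    and depth_up: "j \<in> {1..n} \<Longrightarrow> depth (vertex_of T (flip T (u j))) < depth (vertex_of T (u j))"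
begin

lemma up_edge_in: "j \<in> {1..n} \<Longrightarrow> e j \<in> edges T"
  using bij_betwE[OF edges_bij] by blast

lemma up_dart: "j \<in> {1..n} \<Longrightarrow> u j \<in> darts T" "j \<in> {1..n} \<Longrightarrow> \<not> is_leaf (u j)"
  using edge_dart[OF up_edge_in up] by blast+

lemma up_edge: "j \<in> {1..n} \<Longrightarrow> e j = {u j, flip T (u j)}"
  by (rule edge_eq[OF up_edge_in up])

text \<open>
  Counting half-edges: there are three at every vertex, two on every edge and one on every leaf.
\<close>

lemma card_vertices: "card (vertices T) = Suc n"
proof -
  have fin: "finite (vertices T)" unfolding vertices_def using finite_darts by simp
  have "\<Union> (vertices T) = darts T"
    using vertex_of_subset self_in_vertex_of unfolding vertices_def by blast
  moreover have "card (\<Union> (vertices T)) = (\<Sum>w\<in>vertices T. card w)"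
  proof (rule card_Union_disjoint)
    show "pairwise disjnt (vertices T)"
      unfolding pairwise_def disjnt_def vertices_def by (auto simp: vertex_of_simps)
    show "finite w" if "w \<in> vertices T" for w
      using trivalent[OF that] card.infinite by fastforce
  qed
  ultimately have 1: "card (darts T) = 3 * card (vertices T)" using trivalent by simp
  have dE: "\<Union> (edges T) = darts T - Leaf ` {..<n + 3}"
  proof
    show "\<Union> (edges T) \<subseteq> darts T - Leaf ` {..<n + 3}"
      using edge_dart leaves by fastforce
    show "darts T - Leaf ` {..<n + 3} \<subseteq> \<Union> (edges T)"
      unfolding leaves[symmetric] using edgeI by auto
  qed
  have "card (\<Union> (edges T)) = (\<Sum>E\<in>edges T. card E)"
  proof (rule card_Union_disjoint)
    show "pairwise disjnt (edges T)"
      unfolding pairwise_def disjnt_def using edge_eq by blast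
    show "finite E" if "E \<in> edges T" for E
      using that edge_nonempty edge_eq by fastforce
  qed
  also have "\<dots> = (\<Sum>E\<in>edges T. 2)"
  proof (rule sum.cong)
    fix E assume E: "E \<in> edges T"
    then obtain h where h: "h \<in> E" using edge_nonempty by blast
    have "flip T h \<noteq> h" using flip_fixed edge_dart[OF E h] by blast
    then show "card E = 2" using edge_eq[OF E h] by simp
  qed simp
  also have "\<dots> = 2 * n" using bij_betw_same_card[OF edges_bij] by simp
  finally have "card (darts T - Leaf ` {..<n + 3}) = 2 * n" unfolding dE .
  moreover have "card (Leaf ` {..<n + 3}) = n + 3" by (subst card_image) (auto simp: inj_on_def)
  moreover have "Leaf ` {..<n + 3} \<subseteq> darts T" using leaves by blast
  ultimately have "card (darts T) = 3 * n + 3"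
    using card_Diff_subset[of "Leaf ` {..<n + 3}" "darts T"] card_mono[OF finite_darts, of "Leaf ` {..<n + 3}"] by simp
  then show ?thesis using 1 by simp
qed

lemma vertices_listed: "vertices T = set (map (vertex_of T) (h\<^sub>0 # map u [1..<Suc n]))"
proof -
  have fin: "finite (vertices T)" unfolding vertices_def using finite_darts by simp
  have "set (map (vertex_of T) (h\<^sub>0 # map u [1..<Suc n])) \<subseteq> vertices T"
    using up_dart root by auto
  moreover have "card (set (map (vertex_of T) (h\<^sub>0 # map u [1..<Suc n]))) = Suc n"
    using distinct_card[OF vertices_distinct] by simp
  ultimately show ?thesis using card_subset_eq[OF fin] card_vertices by metis
qed

definition block_word :: "cell list" where
  "block_word = concat (map (vertex_block T) (h\<^sub>0 # map u [1..<Suc n]))"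

lemma block_word_eq: "block_word = Vertex (vertex_of T h\<^sub>0) #
   [Half h\<^sub>0, Half (rot T h\<^sub>0), Half (rot T (rot T h\<^sub>0))] @
   concat (map (\<lambda>j. [Vertex (vertex_of T (u j)), Half (u j), Half (rot T (u j)), Half (rot T (rot T (u j)))]) [1..<Suc n])"
proof -
  have *: "map (\<lambda>j. vertex_block T (u j)) [1..<Suc n] =
    map (\<lambda>j. [Vertex (vertex_of T (u j)), Half (u j), Half (rot T (u j)), Half (rot T (rot T (u j)))]) [1..<Suc n]"
    using up_dart by (intro map_cong) (auto simp: vertex_block_trivalent)
  show ?thesis unfolding block_word_def list.map(2) map_map o_def * vertex_block_trivalent[OF root]
    by simp
qed

lemma block_cells: "h \<in> darts T \<Longrightarrow> set (vertex_block T h) = insert (Vertex (vertex_of T h)) (Half ` vertex_of T h)"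
  by (simp add: vertex_block_trivalent) (simp add: vertex_triple(3)[of h])

lemma block_word_orientation: "orientation_word T block_word"
proof -
  let ?hs = "h\<^sub>0 # map u [1..<Suc n]"
  have hs: "set ?hs \<subseteq> darts T" using up_dart root by auto
  have "set block_word = (\<Union>h\<in>set ?hs. insert (Vertex (vertex_of T h)) (Half ` vertex_of T h))"
    unfolding block_word_def using block_cells hs by (simp add: subset_iff)
  also have "\<dots> = Vertex ` (vertex_of T ` set ?hs) \<union> Half ` \<Union> (vertex_of T ` set ?hs)"
    by auto
  also have "vertex_of T ` set ?hs = vertices T" unfolding vertices_listed set_map ..
  also have "\<Union> (vertices T) = darts T"
    using vertex_of_subset self_in_vertex_of unfolding vertices_def by blast
  finally have "set block_word = cells T" unfolding cells_def .
  moreover have "distinct (concat (map (vertex_block T) hs))"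
    if "set hs \<subseteq> darts T" "distinct (map (vertex_of T) hs)" for hs
    using that
  proof (induction hs)
    case (Cons h hs)
    have h: "h \<in> darts T" using Cons.prems by simp
    have "set (vertex_block T h) \<inter> set (vertex_block T g) = {}" if "g \<in> set hs" for g
    proof -
      have "vertex_of T g \<noteq> vertex_of T h" "g \<in> darts T" using that Cons.prems by auto
      then show ?thesis using h by (auto simp: block_cells vertex_of_simps)
    qed
    moreover have "distinct (vertex_block T h)"
      using vertex_triple(1)[OF h] rot_neq[OF h] by (auto simp: vertex_block_trivalent[OF h])
    ultimately show ?case using Cons by auto
  qed simp
  ultimately show ?thesis
    unfolding orientation_word_def block_word_def using hs vertices_distinct by blast
qed

lemma natural_orientationI:
  assumes "orientation_word T w" "word_sign block_word w = 1"
  shows "natural_orientation T w"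
proof -
  let ?hs = "h\<^sub>0 # map u [1..<Suc n]"
  have "word_sign w block_word = 1"
    using assms block_word_orientation word_sign_sym[of block_word w]
    unfolding orientation_word_def by simp
  then have "same_orientation T w (concat (map (vertex_block T) ?hs))"
    using assms(1) block_word_orientation unfolding same_orientation_def block_word_def by blast
  moreover have "set ?hs \<subseteq> darts T" using up_dart root by auto
  moreover have "vertex_of T ` set ?hs = vertices T" unfolding vertices_listed set_map ..
  moreover have "\<forall>v\<in>vertices T. odd (card v)" using trivalent by simp
  ultimately show ?thesis
    unfolding natural_orientation_def using vertices_distinct by blast
qed

text \<open>
  The half-edge \<open>q j\<close>: of the two half-edges at the vertex of \<open>u j\<close> that point away from the root, the
  second one in counterclockwise order.
\<close>

definition last_child :: "nat \<Rightarrow> dart" where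
  "last_child j = rot T (rot T (u j))"

lemma up_inj: "i \<in> {1..n} \<Longrightarrow> j \<in> {1..n} \<Longrightarrow> vertex_of T (u i) = vertex_of T (u j) \<Longrightarrow> i = j"
proof -
  assume ij: "i \<in> {1..n}" "j \<in> {1..n}" "vertex_of T (u i) = vertex_of T (u j)"
  have "distinct (map (\<lambda>j. vertex_of T (u j)) [1..<Suc n])" using vertices_distinct by (simp add: o_def)
  then have "inj_on (\<lambda>j. vertex_of T (u j)) {1..<Suc n}" unfolding distinct_map set_upt by blast
  then show "i = j" using ij by (auto dest: inj_onD)
qed

lemma edge_inj: "i \<in> {1..n} \<Longrightarrow> j \<in> {1..n} \<Longrightarrow> h \<in> e i \<Longrightarrow> h \<in> e j \<Longrightarrow> i = j"
proof -
  assume ij: "i \<in> {1..n}" "j \<in> {1..n}" "h \<in> e i" "h \<in> e j"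
  have "e i \<in> edges T" "e j \<in> edges T" using ij bij_betwE[OF edges_bij] by auto
  then have "e i = e j" using ij edge_eq by metis
  then show "i = j" using ij edges_bij by (auto simp: bij_betw_def dest: inj_onD)
qed

lemma flip_up_neq_up: "i \<in> {1..n} \<Longrightarrow> j \<in> {1..n} \<Longrightarrow> flip T (u i) \<noteq> u j"
proof
  assume ij: "i \<in> {1..n}" "j \<in> {1..n}" "flip T (u i) = u j"
  then have "u j \<in> e i" using up_edge[of i] by auto
  then have "i = j" using edge_inj up ij by metis
  then show False using ij flip_fixed up_dart by metis
qed

lemma last_child_neq_up: "i \<in> {1..n} \<Longrightarrow> j \<in> {1..n} \<Longrightarrow> last_child i \<noteq> u j"
proof
  assume ij: "i \<in> {1..n}" "j \<in> {1..n}" "last_child i = u j"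
  then have "vertex_of T (u i) = vertex_of T (u j)" unfolding last_child_def using vertex_of_rot by metis
  then have "i = j" using up_inj ij by blast
  then show False using ij vertex_triple(1) up_dart unfolding last_child_def by metis
qed

lemma last_child_inj: "i \<in> {1..n} \<Longrightarrow> j \<in> {1..n} \<Longrightarrow> last_child i = last_child j \<Longrightarrow> i = j"
  unfolding last_child_def rot_eq_iff by (rule up_inj) simp_all

text \<open>
  The corner at \<open>last_child j\<close> is followed by \<open>u j\<close>, hence it continues as the corner at the other half
  of the edge.
\<close>

lemma region_last_child: "j \<in> {1..n} \<Longrightarrow> region_of T (last_child j) = region_of T (flip T (u j))"
  using region_of_flip_rot[of "last_child j"] up_dart vertex_triple(2)[of "u j"]
  unfolding last_child_def by simp

text \<open>
  After all \<open>n\<close> steps, the half-edges \<open>last_child j\<close> have been mapped to \<open>flip T (u j)\<close> and the other half-edges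
  pointing away from the root to the initial leaves of their regions.
\<close>

fun to_leaf :: "nat \<Rightarrow> dart \<Rightarrow> dart" where
  "to_leaf 0 = id"
| "to_leaf (Suc i) = Transposition.transpose (flip T (u (Suc i))) (to_leaf i (last_child (Suc i))) \<circ> to_leaf i"

definition half_map :: "(dart \<Rightarrow> dart) \<Rightarrow> cell \<Rightarrow> cell" where
  "half_map p c = (case c of Vertex w \<Rightarrow> Vertex w | Half h \<Rightarrow> Half (p h))"

lemma half_map_simps [simp]: "half_map p (Vertex w) = Vertex w" "half_map p (Half h) = Half (p h)"
  unfolding half_map_def by simp_all

lemma half_map_transpose:
  "half_map (Transposition.transpose x y \<circ> p) = Transposition.transpose (Half x) (Half y) \<circ> half_map p"
proof
  fix c show "half_map (Transposition.transpose x y \<circ> p) c = (Transposition.transpose (Half x) (Half y) \<circ> half_map p) c"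
    by (cases c) (auto simp: Transposition.transpose_def)
qed

lemma half_map_id: "half_map id = id"
proof
  fix c show "half_map id c = id c" by (cases c) auto
qed

text \<open>
  Every step is a transposition of two half-edges whose corners lie in the same region, so regions
  are preserved. It is a genuine transposition because \<open>to_leaf\<close> moves half-edges that have not been
  replaced away from the root, so that the image of \<open>last_child (Suc i)\<close> is deeper than
  \<open>flip T (u (Suc i))\<close>. Hence the sign after \<open>i\<close> steps is \<open>(-1) ^ i\<close>.
\<close>

lemma to_leaf_invariant:
  assumes "i \<le> n"
  shows "to_leaf i permutes darts T \<and> half_map (to_leaf i) permutes cells T \<and>
    sign (half_map (to_leaf i)) = (-1) ^ i \<and>
    (\<forall>j\<in>{1..n}. to_leaf i (u j) = u j) \<and>
    (\<forall>d\<in>darts T. region_of T (to_leaf i d) = region_of T d) \<and>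
    (\<forall>j\<in>{1..i}. to_leaf i (last_child j) = flip T (u j)) \<and>
    (\<forall>d\<in>darts T. d \<notin> last_child ` {1..i} \<longrightarrow> depth (vertex_of T d) \<le> depth (vertex_of T (to_leaf i d)))"
  using assms
proof (induction i)
  case 0
  show ?case by (simp add: half_map_id permutes_id sign_id del: id_apply) simp
next
  case (Suc i)
  then have IH: "to_leaf i permutes darts T" "half_map (to_leaf i) permutes cells T"
    "sign (half_map (to_leaf i)) = (-1) ^ i"
    "\<forall>j\<in>{1..n}. to_leaf i (u j) = u j"
    "\<forall>d\<in>darts T. region_of T (to_leaf i d) = region_of T d"
    "\<forall>j\<in>{1..i}. to_leaf i (last_child j) = flip T (u j)"
    "\<forall>d\<in>darts T. d \<notin> last_child ` {1..i} \<longrightarrow> depth (vertex_of T d) \<le> depth (vertex_of T (to_leaf i d))"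
    by simp_all
  let ?j = "Suc i"
  have j: "?j \<in> {1..n}" using Suc.prems by simp
  let ?x = "flip T (u ?j)" and ?q = "last_child ?j"
  let ?y = "to_leaf i ?q"
  have q: "?q \<in> darts T" unfolding last_child_def using up_dart[OF j] by simp
  have x: "?x \<in> darts T" using up_dart[OF j] by simp
  have y: "?y \<in> darts T" using q permutes_in_image[OF IH(1)] by blast
  have inj: "to_leaf i d = to_leaf i d' \<longleftrightarrow> d = d'" for d d'
    using permutes_inj[OF IH(1)] by (auto dest: injD)
  have new: "?q \<notin> last_child ` {1..i}" using last_child_inj[OF j] j by fastforce
  have "depth (vertex_of T ?x) < depth (vertex_of T ?q)"
    using depth_up[OF j] by (simp add: last_child_def)
  also have "\<dots> \<le> depth (vertex_of T ?y)" using IH(7) q new by blast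
  finally have depth_xy: "depth (vertex_of T ?x) < depth (vertex_of T ?y)" .
  then have xy: "?x \<noteq> ?y" by auto
  let ?t = "Transposition.transpose ?x ?y"
  have tl: "to_leaf ?j = ?t \<circ> to_leaf i" by simp
  have 1: "to_leaf ?j permutes darts T"
    unfolding tl by (rule permutes_compose[OF IH(1) permutes_swap_id[OF x y]])
  have c: "Half ?x \<in> cells T" "Half ?y \<in> cells T" using x y unfolding cells_def by auto
  have swap: "Transposition.transpose (Half ?x) (Half ?y) permutes cells T" by (rule permutes_swap_id[OF c])
  have 2: "half_map (to_leaf ?j) permutes cells T"
    unfolding tl half_map_transpose by (rule permutes_compose[OF IH(2) swap])
  have fin: "finite (cells T)" unfolding cells_def vertices_def using finite_darts by simp
  have 3: "sign (half_map (to_leaf ?j)) = (-1) ^ ?j"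
  proof -
    have "sign (half_map (to_leaf ?j)) = sign (Transposition.transpose (Half ?x) (Half ?y)) * sign (half_map (to_leaf i))"
      unfolding tl half_map_transpose
      by (rule sign_compose) (use swap IH(2) fin permutation_permutes in blast)+
    then show ?thesis using IH(3) xy by (simp add: sign_swap_id)
  qed
  have 4: "\<forall>k\<in>{1..n}. to_leaf ?j (u k) = u k"
  proof
    fix k assume k: "k \<in> {1..n}"
    have "u k \<noteq> ?x" using flip_up_neq_up[OF j k] by simp
    moreover have "u k \<noteq> ?y" using IH(4) k inj last_child_neq_up[OF j k] by metis
    ultimately show "to_leaf ?j (u k) = u k" using IH(4) k by (simp add: Transposition.transpose_def)
  qed
  have 5: "\<forall>d\<in>darts T. region_of T (to_leaf ?j d) = region_of T d"
  proof
    fix d assume d: "d \<in> darts T"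
    have "region_of T ?y = region_of T ?x" using IH(5) q region_last_child[OF j] by simp
    then have "region_of T (?t z) = region_of T z" for z by (simp add: Transposition.transpose_def)
    then show "region_of T (to_leaf ?j d) = region_of T d" using IH(5) d by simp
  qed
  have 6: "\<forall>k\<in>{1..?j}. to_leaf ?j (last_child k) = flip T (u k)"
  proof
    fix k assume k: "k \<in> {1..?j}"
    show "to_leaf ?j (last_child k) = flip T (u k)"
    proof (cases "k = ?j")
      case True
      then show ?thesis by simp
    next
      case False
      then have ki: "k \<in> {1..i}" "k \<in> {1..n}" using k j by auto
      have "flip T (u k) \<noteq> ?x"
      proof
        assume "flip T (u k) = ?x"
        then have "u k = u ?j" by simp
        then show False using up_inj[OF ki(2) j] False by simp
      qed
      moreover have "flip T (u k) \<noteq> ?y"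
        using IH(6) ki inj last_child_inj[OF ki(2) j] False by metis
      ultimately show ?thesis using IH(6) ki by (simp add: Transposition.transpose_def)
    qed
  qed
  have 7: "\<forall>d\<in>darts T. d \<notin> last_child ` {1..?j} \<longrightarrow> depth (vertex_of T d) \<le> depth (vertex_of T (to_leaf ?j d))"
  proof (intro ballI impI)
    fix d assume d: "d \<in> darts T" "d \<notin> last_child ` {1..?j}"
    have dq: "d \<noteq> ?q" "d \<notin> last_child ` {1..i}" using d(2) by auto
    have IHd: "depth (vertex_of T d) \<le> depth (vertex_of T (to_leaf i d))" using IH(7) d(1) dq(2) by blast
    have "to_leaf i d \<noteq> ?y" using inj dq(1) by simp
    then show "depth (vertex_of T d) \<le> depth (vertex_of T (to_leaf ?j d))"
      using IHd depth_xy by (auto simp: Transposition.transpose_def)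
  qed
  show ?case using 1 2 3 4 5 6 7 by blast
qed

lemma to_leaf_permutes: "to_leaf n permutes darts T"
  and half_map_to_leaf_permutes: "half_map (to_leaf n) permutes cells T"
  and sign_half_map_to_leaf: "sign (half_map (to_leaf n)) = (-1) ^ n"
  and to_leaf_up: "j \<in> {1..n} \<Longrightarrow> to_leaf n (u j) = u j"
  and region_to_leaf: "d \<in> darts T \<Longrightarrow> region_of T (to_leaf n d) = region_of T d"
  and to_leaf_last_child: "j \<in> {1..n} \<Longrightarrow> to_leaf n (last_child j) = flip T (u j)"
proof -
  note inv = to_leaf_invariant[OF order_refl]
  show "to_leaf n permutes darts T" using inv by (elim conjE)
  show "half_map (to_leaf n) permutes cells T" using inv by (elim conjE)
  show "sign (half_map (to_leaf n)) = (-1) ^ n" using inv by (elim conjE)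
  show "j \<in> {1..n} \<Longrightarrow> to_leaf n (u j) = u j" using inv by (elim conjE) (rule bspec)
  have "\<forall>d\<in>darts T. region_of T (to_leaf n d) = region_of T d" using inv by (elim conjE)
  then show "d \<in> darts T \<Longrightarrow> region_of T (to_leaf n d) = region_of T d" by (rule bspec)
  have "\<forall>j\<in>{1..n}. to_leaf n (last_child j) = flip T (u j)" using inv by (elim conjE)
  then show "j \<in> {1..n} \<Longrightarrow> to_leaf n (last_child j) = flip T (u j)" by (rule bspec)
qed

text \<open>
  An internal half-edge is some \<open>u j\<close> or \<open>flip T (u j)\<close>, and these are already the images of \<open>u j\<close> and
  \<open>last_child j\<close> under the bijection \<open>to_leaf n\<close>.
\<close>

lemma to_leaf_is_leaf:
  assumes "d \<in> darts T" "\<And>j. j \<in> {1..n} \<Longrightarrow> d \<noteq> u j" "\<And>j. j \<in> {1..n} \<Longrightarrow> d \<noteq> last_child j"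
  shows "is_leaf (to_leaf n d)"
proof (rule ccontr)
  note perm = to_leaf_permutes
  assume "\<not> is_leaf (to_leaf n d)"
  moreover have "to_leaf n d \<in> darts T" using assms(1) by (simp add: permutes_in_image[OF perm])
  ultimately have "{to_leaf n d, flip T (to_leaf n d)} \<in> edges T" by (intro edgeI)
  then obtain j where j: "j \<in> {1..n}" "e j = {to_leaf n d, flip T (to_leaf n d)}"
    using edges_bij unfolding bij_betw_def by (metis imageE)
  then have "to_leaf n d \<in> {u j, flip T (u j)}" using up_edge by blast
  then have "to_leaf n d = to_leaf n (u j) \<or> to_leaf n d = to_leaf n (last_child j)"
    using to_leaf_up to_leaf_last_child j by auto
  then have "d = u j \<or> d = last_child j" using permutes_inj[OF perm] by (auto dest: injD)
  then show False using assms j by blast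
qed

definition leaf_list :: "dart list" where
  "leaf_list = map (to_leaf n) ([h\<^sub>0, rot T h\<^sub>0, rot T (rot T h\<^sub>0)] @ map (\<lambda>j. rot T (u j)) [1..<Suc n])"

text \<open>
  Apply \<open>to_leaf\<close> to the half-edges, move \<open>flip T (u j)\<close> in front of \<open>u j\<close> by an even permutation of three
  letters, and shuffle the triples past the leaves listed before them.
\<close>

lemma chain_word_sign:
  defines "w \<equiv> Vertex (vertex_of T h\<^sub>0) #
    concat (map (\<lambda>j. [Vertex (vertex_of T (u j)), Half (flip T (u j)), Half (u j)]) [1..<Suc n]) @ map Half leaf_list"
  shows "orientation_word T w" "word_sign block_word w = (-1) ^ (n + (\<Sum>i<n. 3 + i))"
proof -
  let ?p = "half_map (to_leaf n)"
  note p = half_map_to_leaf_permutes sign_half_map_to_leaf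
  note bw = block_word_orientation[unfolded orientation_word_def, THEN conjunct1]
    block_word_orientation[unfolded orientation_word_def, THEN conjunct2]
  let ?A = "map Half (map (to_leaf n) [h\<^sub>0, rot T h\<^sub>0, rot T (rot T h\<^sub>0)])"
  let ?blk = "\<lambda>j. [Vertex (vertex_of T (u j)), Half (u j), Half (to_leaf n (rot T (u j))), Half (flip T (u j))]"
  let ?f = "\<lambda>j. [Vertex (vertex_of T (u j)), Half (flip T (u j)), Half (u j)]"
  let ?g = "\<lambda>j. Half (to_leaf n (rot T (u j)))"
  let ?v = "Vertex (vertex_of T h\<^sub>0)"
  have map: "map ?p block_word = ?v # ?A @ concat (map ?blk [1..<Suc n])"
  proof -
    have *: "map (\<lambda>j. [Vertex (vertex_of T (u j)), Half (to_leaf n (u j)), Half (to_leaf n (rot T (u j))),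
        Half (to_leaf n (rot T (rot T (u j))))]) [1..<Suc n] = map ?blk [1..<Suc n]"
      using to_leaf_up to_leaf_last_child by (intro map_cong) (auto simp: last_child_def)
    show ?thesis unfolding block_word_eq by (simp add: map_concat o_def * del: One_nat_def)
  qed
  have s1: "word_sign block_word (map ?p block_word) = (-1) ^ n"
    using word_sign_map_permutes[OF bw(1), of ?p] p bw(2) by simp
  have d: "distinct (map ?p block_word)" and set: "set (map ?p block_word) = cells T"
    using bw p permutes_image[OF p(1)] permutes_inj_on[OF p(1)] by (simp_all add: distinct_map)
  have blk: "distinct (?blk j)" if "j \<in> {1..n}" for j
  proof -
    have "distinct (concat (map ?blk [1..<Suc n]))" using d unfolding map by simp
    then show ?thesis by (rule distinct_concat_mapD) (use that in auto)
  qed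
  have w: "w = ?v # concat (map ?f [1..<Suc n]) @ ?A @ map ?g [1..<Suc n]"
    unfolding w_def leaf_list_def by (simp add: o_def)
  have shuffle: "mset (?A @ concat (map ?blk [1..<Suc n])) = mset (concat (map ?f [1..<Suc n]) @ ?A @ map ?g [1..<Suc n]) \<and>
    word_sign (?A @ concat (map ?blk [1..<Suc n])) (concat (map ?f [1..<Suc n]) @ ?A @ map ?g [1..<Suc n])
      = (-1) ^ (\<Sum>i<length [1..<Suc n]. length ?A + i)"
  proof (rule shuffle_triples_sign)
    show "distinct (?A @ concat (map ?blk [1..<Suc n]))" using d unfolding map by simp
    fix j assume "j \<in> set [1..<Suc n]"
    then have dj: "distinct (?blk j)" using blk by (auto)
    have "word_sign (?blk j) (?f j @ [?g j]) = 1"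
      using word_sign_swap_blocks_context[of "[Vertex (vertex_of T (u j))]" "[Half (u j), ?g j]" "[Half (flip T (u j))]" "[]"] dj
      by simp
    then show "mset (?blk j) = mset (?f j @ [?g j]) \<and> word_sign (?blk j) (?f j @ [?g j]) = 1 \<and> length (?f j) = 3"
      by simp
  qed
  have mset: "mset w = mset (map ?p block_word)" unfolding w map using shuffle by simp
  then have dw: "distinct w" and sw: "set w = cells T"
    using d set mset_eq_imp_distinct_iff mset_eq_setD by metis+
  then show "orientation_word T w" unfolding orientation_word_def by blast
  have dA: "distinct (concat (map ?f [1..<Suc n]) @ ?A @ map ?g [1..<Suc n])" using dw unfolding w by simp
  let ?X = "?A @ concat (map ?blk [1..<Suc n])"
  let ?Y = "concat (map ?f [1..<Suc n]) @ ?A @ map ?g [1..<Suc n]"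
  have "word_sign ([?v] @ ?X @ []) ([?v] @ ?Y @ []) = word_sign ?X ?Y"
  proof (rule word_sign_context)
    show "distinct ([?v] @ ?X @ [])" using d unfolding map by simp
    show "set ?X = set ?Y" by (rule mset_eq_setD[OF conjunct1[OF shuffle]])
  qed (rule dA)
  moreover have "map ?p block_word = [?v] @ ?X @ []" "w = [?v] @ ?Y @ []"
    unfolding map w by simp_all
  moreover have "(\<Sum>i<length [1..<Suc n]. length ?A + i) = (\<Sum>i<n. 3 + i)"
    by (rule sum.cong) simp_all
  ultimately have s2: "word_sign (map ?p block_word) w = (-1) ^ (\<Sum>i<n. 3 + i)"
    using conjunct2[OF shuffle] by (simp only:)
  have "word_sign block_word w = word_sign block_word (map ?p block_word) * word_sign (map ?p block_word) w"
    by (rule word_sign_trans[OF bw(1) d dw]) (use bw set sw in auto)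
  then show "word_sign block_word w = (-1) ^ (n + (\<Sum>i<n. 3 + i))"
    unfolding s1 s2 by (simp add: power_add)
qed

lemma leaf_list_leaves: "distinct leaf_list" "set leaf_list = Leaf ` {..<n + 3}" "length leaf_list = n + 3"
proof -
  have w: "orientation_word T (Vertex (vertex_of T h\<^sub>0) #
    concat (map (\<lambda>j. [Vertex (vertex_of T (u j)), Half (flip T (u j)), Half (u j)]) [1..<Suc n]) @ map Half leaf_list)"
    by (rule chain_word_sign(1))
  then show d: "distinct leaf_list" unfolding orientation_word_def by (simp add: distinct_map)
  show len: "length leaf_list = n + 3" unfolding leaf_list_def by simp
  have h0: "vertex_of T h\<^sub>0 \<noteq> vertex_of T (u j)" if "j \<in> {1..n}" for j
    using vertices_distinct that by (auto)
  have root_leaf: "is_leaf (to_leaf n d)" if "d \<in> darts T" "vertex_of T d = vertex_of T h\<^sub>0" for d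
  proof (rule to_leaf_is_leaf[OF that(1)])
    fix j assume j: "j \<in> {1..n}"
    show "d \<noteq> u j" using h0[OF j] that(2) by metis
    show "d \<noteq> last_child j" using h0[OF j] that(2) vertex_of_rot unfolding last_child_def by metis
  qed
  have child: "is_leaf (to_leaf n (rot T (u j)))" if j: "j \<in> {1..n}" for j
  proof (rule to_leaf_is_leaf)
    show "rot T (u j) \<in> darts T" using up_dart[OF j] by simp
    fix i assume i: "i \<in> {1..n}"
    show "rot T (u j) \<noteq> u i" using up_inj[OF i j] vertex_of_rot[of "u j"] rot_neq up_dart j by metis
    show "rot T (u j) \<noteq> last_child i"
      unfolding last_child_def using up_inj[OF i j] vertex_of_rot[of "u i"] vertex_of_rot[of "u j"] vertex_of_rot[of "rot T (u i)"] rot_neq up_dart j rot_eq_iff by metis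
  qed
  have "set leaf_list \<subseteq> {h \<in> darts T. is_leaf h}"
    using root_leaf[of h\<^sub>0] root_leaf[of "rot T h\<^sub>0"] root_leaf[of "rot T (rot T h\<^sub>0)"] child root
      permutes_in_image[OF to_leaf_permutes] up_dart
    unfolding leaf_list_def by (auto)
  then have sub: "set leaf_list \<subseteq> Leaf ` {..<n + 3}" unfolding leaves .
  have "card (set leaf_list) = n + 3" using distinct_card[OF d] len by simp
  moreover have "card (Leaf ` {..<n + 3}) = n + 3" by (subst card_image) (auto simp: inj_on_def)
  ultimately show "set leaf_list = Leaf ` {..<n + 3}" using card_subset_eq[OF _ sub] by simp
qed

lemma region_leaf_list:
  "map (region_of T) leaf_list = map (region_of T) ([h\<^sub>0, rot T h\<^sub>0, rot T (rot T h\<^sub>0)] @ map (\<lambda>j. rot T (u j)) [1..<Suc n])"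
  unfolding leaf_list_def map_map
  by (rule map_cong) (use region_to_leaf up_dart root in \<open>auto\<close>)

end


section \<open>The flag of faces of a chain of trees\<close>

lemma contract_empty: "planar_tree n U \<Longrightarrow> contract U {} = U"
proof -
  assume "planar_tree n U"
  then interpret planar_ribbon_tree n U by unfold_locales
  have "rot (contract U {}) h = rot U h" for h
  proof (cases "h \<in> darts U")
    case True
    then show ?thesis
      by (intro rot_contract_first_survivor first_survivor.here) simp_all
  next
    case False
    then show ?thesis using rot_contract_outside[of h U "{}"] permutes_not_in[OF rot_permutes] by simp
  qed
  moreover have "flip (contract U {}) h = flip U h" for h
    using permutes_not_in[OF flip_permutes] by (simp add: flip_contract)
  ultimately show "contract U {} = U" by (intro ptree.equality) (auto simp: fun_eq_iff)
qed

lemma tree_iso_refl: "tree_iso U U"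
  unfolding tree_iso_def tree_iso_map_def by (rule exI[of _ "\<lambda>h. h"]) (simp add: bij_betw_def)

locale associahedron =
  fixes n :: nat and P :: "'v::euclidean_space set" and pt :: "mtree \<Rightarrow> 'v"
  assumes K: "stasheff_polytope n P pt"
begin

lemma DIM_n: "DIM('v) = n"
  using K unfolding stasheff_polytope_def by (elim conjE)

lemma polytope_P: "polytope P"
  using K unfolding stasheff_polytope_def by (elim conjE)

lemma aff_dim_P: "aff_dim P = int n"
  using K unfolding stasheff_polytope_def by (elim conjE)

lemma points: "pt ` {M. metric_tree n M} = P"
  using K unfolding stasheff_polytope_def by (elim conjE)

lemma same_face_iff: "metric_tree n M \<Longrightarrow> metric_tree n M' \<Longrightarrow>
    (\<exists>F. F face_of P \<and> pt M \<in> rel_interior F \<and> pt M' \<in> rel_interior F) \<longleftrightarrow> tree_iso (core M) (core M')"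
proof -
  have "\<forall>M M'. metric_tree n M \<longrightarrow> metric_tree n M' \<longrightarrow>
        ((\<exists>F. F face_of P \<and> pt M \<in> rel_interior F \<and> pt M' \<in> rel_interior F)
           \<longleftrightarrow> tree_iso (core M) (core M'))"
    using K unfolding stasheff_polytope_def by (elim conjE)
  then show "metric_tree n M \<Longrightarrow> metric_tree n M' \<Longrightarrow> ?thesis" by blast
qed

lemma face_inclusion_iff: "planar_tree n U \<Longrightarrow> planar_tree n U' \<Longrightarrow>
    closure (open_face n pt U) \<subseteq> closure (open_face n pt U')
      \<longleftrightarrow> (\<exists>\<E>\<subseteq>edges U. tree_iso (contract U (\<Union>\<E>)) U')"
proof -
  have "\<forall>T T'. planar_tree n T \<longrightarrow> planar_tree n T' \<longrightarrow>
        (closure (open_face n pt T) \<subseteq> closure (open_face n pt T')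
           \<longleftrightarrow> (\<exists>\<E>\<subseteq>edges T. tree_iso (contract T (\<Union>\<E>)) T'))"
    using K unfolding stasheff_polytope_def by (elim conjE)
  then show "planar_tree n U \<Longrightarrow> planar_tree n U' \<Longrightarrow> ?thesis" by blast
qed

lemma length_coordinates: "trivalent_tree n U \<Longrightarrow>
    (\<forall>E\<in>edges U. length_curve pt U E differentiable (at 1 within {0<..1})) \<and>
        inj_on (length_tangent pt U) (edges U) \<and> independent (length_tangent pt U ` edges U)"
proof -
  have "\<forall>T. trivalent_tree n T \<longrightarrow>
        (\<forall>E\<in>edges T. length_curve pt T E differentiable (at 1 within {0<..1})) \<and>
        inj_on (length_tangent pt T) (edges T) \<and>
        independent (length_tangent pt T ` edges T)"
    using K unfolding stasheff_polytope_def by (elim conjE)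
  then show "trivalent_tree n U \<Longrightarrow> ?thesis" by blast
qed

lemma convex_P: "convex P"
  by (rule polytope_imp_convex[OF polytope_P])

lemma closed_P: "closed P"
  by (rule polytope_imp_closed[OF polytope_P])

definition cell_face :: "ptree \<Rightarrow> 'v set" where
  "cell_face U = closure (open_face n pt U)"

definition center :: "ptree \<Rightarrow> 'v" where
  "center U = pt (U, \<lambda>_. 1)"

lemma center_tree:
  assumes "planar_tree n U"
  shows "metric_tree n (U, \<lambda>_. 1)" "core (U, \<lambda>_. 1) = U" "center U \<in> open_face n pt U"
proof -
  show m: "metric_tree n (U, \<lambda>_. 1)" using assms by (simp add: metric_tree_def)
  show c: "core (U, \<lambda>_. 1) = U" using contract_empty[OF assms] by (simp add: core_def)
  show "center U \<in> open_face n pt U"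
    unfolding open_face_def center_def using m c tree_iso_refl[of U] by (intro imageI) simp
qed

text \<open>
  The relative interiors of the faces partition the polyhedron, so the relative interior that contains
  the tree with all lengths 1 is the whole open face.
\<close>

lemma cell_face_props:
  assumes U: "planar_tree n U"
  shows "cell_face U face_of P" "rel_interior (cell_face U) = open_face n pt U"
proof -
  note c = center_tree[OF U]
  obtain F where F: "F face_of P" "center U \<in> rel_interior F"
    using same_face_iff[OF c(1) c(1)] tree_iso_refl unfolding center_def by blast
  have iff: "pt M \<in> rel_interior F \<longleftrightarrow> tree_iso (core M) U" if M: "metric_tree n M" for M
  proof
    assume "pt M \<in> rel_interior F"
    then show "tree_iso (core M) U" using same_face_iff[OF M c(1)] F c(2) unfolding center_def by auto
  next
    assume "tree_iso (core M) U"
    then obtain G where G: "G face_of P" "pt M \<in> rel_interior G" "center U \<in> rel_interior G"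
      using same_face_iff[OF M c(1)] c(2) unfolding center_def by auto
    then have "G = F" using face_of_eq[OF G(1) F(1)] F(2) by blast
    then show "pt M \<in> rel_interior F" using G(2) by simp
  qed
  have sub: "rel_interior F \<subseteq> pt ` {M. metric_tree n M}"
    unfolding points using rel_interior_subset face_of_imp_subset[OF F(1)] by blast
  have r: "rel_interior F = open_face n pt U"
  proof
    show "rel_interior F \<subseteq> open_face n pt U"
    proof
      fix y assume y: "y \<in> rel_interior F"
      then obtain M where "metric_tree n M" "y = pt M" using sub by blast
      then show "y \<in> open_face n pt U" using iff y unfolding open_face_def by blast
    qed
    show "open_face n pt U \<subseteq> rel_interior F" using iff unfolding open_face_def by blast
  qed
  have "closure (rel_interior F) = closure F"
    by (rule convex_closure_rel_interior[OF face_of_imp_convex[OF F(1)]])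
  also have "\<dots> = F" using face_of_imp_closed[OF convex_P closed_P F(1)] by simp
  finally have "cell_face U = F" unfolding cell_face_def r .
  then show "cell_face U face_of P" "rel_interior (cell_face U) = open_face n pt U"
    using F(1) r by simp_all
qed

lemma open_face_subset: "planar_tree n U \<Longrightarrow> open_face n pt U \<subseteq> cell_face U"
  unfolding cell_face_def by (rule closure_subset)

text \<open>
  The two faces are different because isomorphic trees have equally many half-edges.
\<close>

lemma cell_face_contract:
  assumes U: "planar_tree n U" and E: "E \<in> edges U"
  shows "cell_face U \<subseteq> cell_face (contract U E)" "cell_face U \<noteq> cell_face (contract U E)"
proof -
  have U': "planar_tree n (contract U E)" by (rule planar_tree_contract[OF U E])
  have "{E} \<subseteq> edges U" "tree_iso (contract U (\<Union>{E})) (contract U E)" using E tree_iso_refl by simp_all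
  then show "cell_face U \<subseteq> cell_face (contract U E)"
    unfolding cell_face_def using face_inclusion_iff[OF U U'] by blast
  show "cell_face U \<noteq> cell_face (contract U E)"
  proof
    assume "cell_face U = cell_face (contract U E)"
    then have "open_face n pt U = open_face n pt (contract U E)"
      using cell_face_props(2)[OF U] cell_face_props(2)[OF U'] by simp
    then have "center (contract U E) \<in> rel_interior (cell_face U)"
      using center_tree(3)[OF U'] cell_face_props(2)[OF U] by simp
    moreover have "center U \<in> rel_interior (cell_face U)"
      using center_tree(3)[OF U] cell_face_props(2)[OF U] by simp
    ultimately have "\<exists>F. F face_of P \<and> center U \<in> rel_interior F \<and> center (contract U E) \<in> rel_interior F"
      by (intro exI[of _ "cell_face U"] conjI cell_face_props(1)[OF U])
    then have "tree_iso U (contract U E)"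
      using same_face_iff[OF center_tree(1)[OF U] center_tree(1)[OF U']] center_tree(2)[OF U] center_tree(2)[OF U']
      unfolding center_def by simp
    then obtain f where f: "bij_betw f (darts U) (darts (contract U E))"
      unfolding tree_iso_def tree_iso_map_def by blast
    have same: "card (darts U) = card (darts U - E)" using bij_betw_same_card[OF f] by simp
    interpret planar_ribbon_tree n U using U by unfold_locales
    obtain h where "h \<in> E" using edge_nonempty[OF E] by blast
    then have "darts U - E \<subset> darts U" using edge_dart[OF E] by blast
    then have "card (darts U - E) < card (darts U)" by (rule psubset_card_mono[OF finite_darts])
    then show False using same by simp
  qed
qed

end

locale associahedron_chain = associahedron n P pt + collapse_chain n T e
  for n and P :: "'v::euclidean_space set" and pt and T and e
begin

lemma cell_face_chain_step: "i < n \<Longrightarrow> cell_face (T i) face_of cell_face (T (Suc i)) \<and> cell_face (T i) \<noteq> cell_face (T (Suc i))"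
proof -
  assume i: "i < n"
  have pl: "planar_tree n (T i)" "planar_tree n (T (Suc i))" and e: "e (Suc i) \<in> edges (T i)"
    using planar_chain[of i] planar_chain[of "Suc i"] edge_in_chain[of i "Suc i"] i by simp_all
  have "cell_face (T i) \<subseteq> cell_face (T (Suc i))" "cell_face (T i) \<noteq> cell_face (T (Suc i))"
    using cell_face_contract[OF pl(1) e] T_Suc[OF i] by simp_all
  moreover have "cell_face (T i) face_of cell_face (T (Suc i))"
    using face_of_subset[OF cell_face_props(1)[OF pl(1)] calculation(1) face_of_imp_subset[OF cell_face_props(1)[OF pl(2)]]] .
  ultimately show ?thesis by blast
qed

lemma cell_face_convex: "i \<le> n \<Longrightarrow> convex (cell_face (T i))"
  by (rule face_of_imp_convex[OF cell_face_props(1)[OF planar_chain]])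

text \<open>
  The \<open>n + 1\<close> faces have strictly increasing dimensions between \<open>0\<close> and \<open>n\<close>.
\<close>

lemma cell_face_chain_dim:
  assumes "i \<le> n"
  shows "aff_dim (cell_face (T i)) = int i"
proof (rule antisym)
  have less: "aff_dim (cell_face (T i)) < aff_dim (cell_face (T (Suc i)))" if "i < n" for i
    by (rule face_of_aff_dim_lt[OF cell_face_convex]) (use cell_face_chain_step[OF that] that in simp_all)
  show "int i \<le> aff_dim (cell_face (T i))" using assms
  proof (induction i)
    case 0
    have "cell_face (T 0) \<noteq> {}"
      using center_tree(3)[OF planar_chain[of 0]] open_face_subset[OF planar_chain[of 0]] by blast
    then have "\<not> aff_dim (cell_face (T 0)) < 0" unfolding aff_dim_negative_iff .
    then show ?case by linarith
  next
    case (Suc i)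
    then show ?case using less[of i] by simp
  qed
  have "aff_dim (cell_face (T (n - m))) \<le> int (n - m)" if "m \<le> n" for m
    using that
  proof (induction m)
    case 0
    show ?case using aff_dim_subset[OF face_of_imp_subset[OF cell_face_props(1)[OF planar_chain[of n]]]] aff_dim_P by simp
  next
    case (Suc m)
    then have "Suc (n - Suc m) = n - m" by simp
    then show ?case using less[of "n - Suc m"] Suc by simp
  qed
  from this[of "n - i"] show "aff_dim (cell_face (T i)) \<le> int i" using assms by simp
qed

text \<open>
  The edge \<open>e j\<close> may be collapsed before \<open>e 1, \<dots>, e (j - 1)\<close>, since collapses commute.
\<close>

lemma cell_face_single_edge:
  assumes "j \<in> {1..n}"
  shows "cell_face (contract (T 0) (e j)) \<subseteq> cell_face (T j)"
proof -
  have "cell_face (contract (T 0) (e j)) \<subseteq> cell_face (contract (T i) (e j))" if "i < j" for i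
    using that
  proof (induction i)
    case (Suc i)
    have i: "i < n" "Suc i < j" "j \<le> n" using Suc.prems assms by auto
    have pl: "planar_tree n (T i)" using planar_chain i by simp
    have ej: "e j \<in> edges (T i)" and ei: "e (Suc i) \<in> edges (T i)"
      using edge_in_chain[of i j] edge_in_chain[of i "Suc i"] i by simp_all
    have ne: "e (Suc i) \<noteq> e j"
      using inj_onD[OF bij_betw_imp_inj_on[OF edges_bij], of "Suc i" j] i by auto
    have "contract (T (Suc i)) (e j) = contract (contract (T i) (e j)) (e (Suc i))"
      unfolding T_Suc[OF i(1)] by (rule contract_commute[OF pl ei ej ne])
    moreover have "cell_face (contract (T i) (e j)) \<subseteq> cell_face (contract (contract (T i) (e j)) (e (Suc i)))"
      by (rule cell_face_contract) (use planar_tree_contract[OF pl ej] ei ne in auto)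
    ultimately show ?case using Suc by auto
  qed simp
  moreover have "j - 1 < j" "j - 1 < n" "Suc (j - 1) = j" using assms by auto
  ultimately show ?thesis using T_Suc[of "j - 1"] by metis
qed

lemma length_curve_in_face:
  assumes j: "j \<in> {1..n}" and s: "0 < s" "s < 1"
  shows "length_curve pt (T 0) (e j) s \<in> cell_face (T j)"
proof -
  let ?len = "(\<lambda>_. 1)(e j := s)"
  have ej: "e j \<in> edges (T 0)" using edge_in_chain[of 0 j] j by simp
  have pl: "planar_tree n (T 0)" by (rule planar_chain) simp
  have "metric_tree n (T 0, ?len)" using pl s by (simp add: metric_tree_def)
  moreover have "{E \<in> edges (T 0). ?len E < 1} = {e j}" using ej s by auto
  then have "core (T 0, ?len) = contract (T 0) (e j)" by (simp add: core_def)
  ultimately have "length_curve pt (T 0) (e j) s \<in> open_face n pt (contract (T 0) (e j))"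
    unfolding open_face_def length_curve_def using tree_iso_refl by (intro imageI) simp
  then show ?thesis
    using open_face_subset[OF planar_tree_contract(1)[OF pl ej]] cell_face_single_edge[OF j] by blast
qed

sublocale flag_of_faces n "\<lambda>i. cell_face (T i)" "\<lambda>j. length_curve pt (T 0) (e j)" "center (T 0)"
  "\<lambda>j. length_tangent pt (T 0) (e j)"
proof
  have im: "(\<lambda>j. length_tangent pt (T 0) (e j)) ` {1..n} = length_tangent pt (T 0) ` edges (T 0)"
    using edges_bij by (auto simp: bij_betw_def image_image[symmetric])
  note coord = length_coordinates[OF trivalent]
  show "convex (cell_face (T i))" if "i \<le> n" for i by (rule cell_face_convex[OF that])
  show "cell_face (T i) face_of cell_face (T (Suc i))" if "i < n" for i using cell_face_chain_step[OF that] by blast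
  show "aff_dim (cell_face (T i)) = int i" if "i \<le> n" for i by (rule cell_face_chain_dim[OF that])
  show "center (T 0) \<in> cell_face (T 0)"
    using center_tree(3)[OF planar_chain[of 0]] open_face_subset[OF planar_chain[of 0]] by blast
  show "length_curve pt (T 0) (e j) differentiable (at 1 within {0<..1})" if "j \<in> {1..n}" for j
    using coord edge_in_chain[of 0 j] that by simp
  show "length_curve pt (T 0) (e j) 1 = center (T 0)" for j
    unfolding length_curve_def center_def by (simp add: fun_upd_idem)
  show "length_curve pt (T 0) (e j) s \<in> cell_face (T j)" if "j \<in> {1..n}" "0 < s" "s < 1" for j s
    by (rule length_curve_in_face[OF that])
  show "length_tangent pt (T 0) (e j) = vector_derivative (length_curve pt (T 0) (e j)) (at 1 within {0<..1})" for j
    by (simp add: length_tangent_def)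
  show "inj_on (\<lambda>j. length_tangent pt (T 0) (e j)) {1..n}"
    using comp_inj_on[of e "{1..n}" "length_tangent pt (T 0)"] coord edges_bij by (simp add: bij_betw_def o_def)
  show "independent ((\<lambda>j. length_tangent pt (T 0) (e j)) ` {1..n})"
    unfolding im using coord by blast
qed

lemma simplex_embedding_vertex:
  "i \<le> n \<Longrightarrow> simplex_embedding n x (simplex_vertex i) = (x i :: 'v)"
proof -
  assume i: "i \<le> n"
  have "simplex_vertex i \<in> standard_simplex n"
    using i unfolding standard_simplex_def simplex_vertex_def by auto
  then have "simplex_embedding n x (simplex_vertex i) = (\<Sum>j\<le>n. simplex_vertex i j *\<^sub>R x j)"
    by (simp add: simplex_embedding_def)
  also have "\<dots> = (\<Sum>j\<le>n. if j = i then x i else 0)"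
    by (intro sum.cong) (auto simp: simplex_vertex_def)
  finally show "simplex_embedding n x (simplex_vertex i) = x i" using i by simp
qed

text \<open>
  The face of \<open>T 0\<close> is a point, so \<open>x 0\<close> is the common end of the length curves. The point \<open>x i\<close> lies in
  the relative interior of its face, hence not in the preceding face of the flag.
\<close>

lemma simplex_sign_eq:
  assumes n: "even n" and B: "ordered_basis (B :: 'v list)"
    and x: "\<And>i. i \<le> n \<Longrightarrow> x i \<in> open_face n pt (T i)"
  shows "simplex_sign B n (simplex_embedding n x) =
    (-1) ^ (n * (n - 1) div 2) * frame_sign B (map (\<lambda>j. length_tangent pt (T 0) (e j)) (rev [1..<Suc n]))"
proof -
  let ?t = "\<lambda>j. length_tangent pt (T 0) (e j)"
  have len: "length B = n" using B DIM_n by (simp add: ordered_basis_def)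
  obtain q where q: "cell_face (T 0) = {q}" using cell_face_chain_dim[of 0] aff_dim_eq_0 by auto
  have x0: "x 0 = center (T 0)"
    using x[of 0] center_tree(3)[OF planar_chain[of 0]] open_face_subset[OF planar_chain[of 0]] q by auto
  have "\<exists>a. x i - center (T 0) = (\<Sum>l=1..i. a l *\<^sub>R ?t l) \<and> a i < 0" if i: "i \<in> {1..n}" for i
  proof (rule flag_coordinates[OF i])
    have pl: "planar_tree n (T i)" using planar_chain i by simp
    have xi: "x i \<in> open_face n pt (T i)" using x i by simp
    then show "x i \<in> cell_face (T i)" using open_face_subset[OF pl] by blast
    have i': "i - 1 < n" "Suc (i - 1) = i" using i by auto
    have step: "cell_face (T (i - 1)) face_of cell_face (T i)" "cell_face (T (i - 1)) \<noteq> cell_face (T i)"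
      using cell_face_chain_step[OF i'(1)] unfolding i'(2) by blast+
    show "x i \<notin> cell_face (T (i - 1))"
    proof
      assume "x i \<in> cell_face (T (i - 1))"
      moreover have "x i \<in> rel_interior (cell_face (T i))" using xi cell_face_props(2)[OF pl] by simp
      ultimately have "cell_face (T i) \<subseteq> cell_face (T (i - 1))"
        by (intro subset_of_face_of[OF step(1) subset_refl]) blast
      then show False using step(2) face_of_imp_subset[OF step(1)] by simp
    qed
  qed
  then have "\<exists>a. \<forall>i\<in>{1..n}. x i - center (T 0) = (\<Sum>l=1..i. a i l *\<^sub>R ?t l) \<and> a i i < 0"
    by (intro bchoice ballI)
  then obtain a where a: "\<And>i. i \<in> {1..n} \<Longrightarrow> x i - center (T 0) = (\<Sum>l=1..i. a i l *\<^sub>R ?t l) \<and> a i i < 0"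
    by blast
  have "simplex_sign B n (simplex_embedding n x) = frame_sign B (map (\<lambda>i. x i - center (T 0)) [1..<Suc n])"
  proof -
    have *: "map (\<lambda>i. simplex_embedding n x (simplex_vertex i) - simplex_embedding n x (simplex_vertex 0)) [1..<Suc n]
       = map (\<lambda>i. x i - center (T 0)) [1..<Suc n]"
      by (rule map_cong) (auto simp: simplex_embedding_vertex x0)
    show ?thesis unfolding simplex_sign_def * by (rule refl)
  qed
  also have "\<dots> = frame_sign B (map ?t [1..<Suc n])"
    by (rule frame_sign_triangular[OF B len n]) (use a in auto)
  also have "\<dots> = (-1) ^ (n * (n - 1) div 2) * frame_sign B (rev (map ?t [1..<Suc n]))"
  proof -
    have "distinct (map ?t [1..<Suc n])"
      using inj_t by (simp add: distinct_map atLeastLessThanSuc_atLeastAtMost del: upt_Suc)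
    then show ?thesis using frame_sign_rev[of "map ?t [1..<Suc n]" B] len by simp
  qed
  finally show ?thesis by (simp add: rev_map)
qed

end


section \<open>Rooting a tree at an edge\<close>

context planar_ribbon_tree
begin

lemma finite_endpoints: "E \<in> edges T \<Longrightarrow> finite (endpoints T E)"
  unfolding endpoints_def edges_def by auto

lemma vertex_dist_le: "(x, y) \<in> adj T (edges T) ^^ m \<Longrightarrow> vertex_dist T x y \<le> m"
  unfolding vertex_dist_def by (rule Least_le)

lemma edge_dist_le:
  assumes "E \<in> edges T" "c \<in> endpoints T E" "(c, y) \<in> adj T (edges T) ^^ m"
  shows "edge_dist T E y \<le> m"
proof -
  have "edge_dist T E y \<le> vertex_dist T c y"
    unfolding edge_dist_def using finite_endpoints[OF assms(1)] assms(2) by (intro Min_le) auto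
  then show ?thesis using vertex_dist_le[OF assms(3)] by linarith
qed

lemma edge_dist_attained:
  assumes E: "E \<in> edges T" and y: "y \<in> vertices T"
  obtains c where "c \<in> endpoints T E" "(c, y) \<in> adj T (edges T) ^^ edge_dist T E y"
proof -
  have "endpoints T E \<noteq> {}" using edge_nonempty[OF E] unfolding endpoints_def by auto
  then have "edge_dist T E y \<in> (\<lambda>u. vertex_dist T u y) ` endpoints T E"
    unfolding edge_dist_def using finite_endpoints[OF E] by (intro Min_in) auto
  then obtain c where c: "c \<in> endpoints T E" "edge_dist T E y = vertex_dist T c y" by auto
  then obtain h where "h \<in> E" "c = vertex_of T h" unfolding endpoints_def by auto
  then have "c \<in> vertices T" using edge_dart[OF E] by simp
  then have "(c, y) \<in> (adj T (edges T))\<^sup>*" using connected y by blast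
  then obtain m where "(c, y) \<in> adj T (edges T) ^^ m" using rtrancl_power by blast
  then have "(c, y) \<in> adj T (edges T) ^^ vertex_dist T c y" unfolding vertex_dist_def by (rule LeastI)
  then show ?thesis using that c by simp
qed

lemma edge_dist_endpoint: "E \<in> edges T \<Longrightarrow> c \<in> endpoints T E \<Longrightarrow> edge_dist T E c = 0"
  using edge_dist_le[of E c c 0] by simp

text \<open>
  All vertices on a path of length less than the distance of \<open>w\<close> are closer than \<open>w\<close>. So the path
  does not use an edge that ends at \<open>w\<close>.
\<close>

lemma short_path_avoids_edge:
  assumes E: "E \<in> edges T" and w: "w \<in> endpoints T G"
    and c: "c \<in> endpoints T E" and path: "(c, y) \<in> adj T (edges T) ^^ m" and less: "m < edge_dist T E w"
  shows "(c, y) \<in> (adj T (edges T - {G}))\<^sup>*"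
  using path less
proof (induction m arbitrary: y)
  case (Suc m)
  then obtain x where x: "(c, x) \<in> adj T (edges T) ^^ m" "(x, y) \<in> adj T (edges T)" by auto
  have "x \<noteq> w" using edge_dist_le[OF E c x(1)] Suc.prems(2) by auto
  have "y \<noteq> w" using edge_dist_le[OF E c Suc.prems(1)] Suc.prems(2) by auto
  obtain g where g: "x = vertex_of T g" "y = vertex_of T (flip T g)" "{g, flip T g} \<in> edges T"
    using x(2) unfolding adj_def by auto
  have "{g, flip T g} \<noteq> G"
  proof
    assume "{g, flip T g} = G"
    then have "w = x \<or> w = y" using w g(1,2) unfolding endpoints_def by auto
    then show False using \<open>x \<noteq> w\<close> \<open>y \<noteq> w\<close> by blast
  qed
  then have "(x, y) \<in> adj T (edges T - {G})" unfolding adj_def using g by blast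
  moreover have "(c, x) \<in> (adj T (edges T - {G}))\<^sup>*" using Suc.IH x(1) Suc.prems(2) by simp
  ultimately show ?case by (rule rtrancl.rtrancl_into_rtrancl[rotated])
qed simp

lemma near_vertices_connected:
  assumes E: "E \<in> edges T" "G \<in> edges T" "E \<noteq> G" and w: "w \<in> endpoints T G"
    and x: "x \<in> vertices T" "edge_dist T E x < edge_dist T E w"
    and y: "y \<in> vertices T" "edge_dist T E y < edge_dist T E w"
  shows "(x, y) \<in> (adj T (edges T - {G}))\<^sup>*"
proof -
  let ?R = "(adj T (edges T - {G}))\<^sup>*"
  obtain c where c: "c \<in> endpoints T E" "(c, x) \<in> adj T (edges T) ^^ edge_dist T E x"
    by (rule edge_dist_attained[OF E(1) x(1)])
  obtain d where d: "d \<in> endpoints T E" "(d, y) \<in> adj T (edges T) ^^ edge_dist T E y"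
    by (rule edge_dist_attained[OF E(1) y(1)])
  have cx: "(c, x) \<in> ?R" by (rule short_path_avoids_edge[OF E(1) w c x(2)])
  have dy: "(d, y) \<in> ?R" by (rule short_path_avoids_edge[OF E(1) w d y(2)])
  have "(c, d) \<in> ?R"
  proof -
    obtain g where g: "g \<in> E" "c = vertex_of T g" using c(1) unfolding endpoints_def by auto
    have Eg: "E = {g, flip T g}" by (rule edge_eq[OF E(1) g(1)])
    have "(c, vertex_of T (flip T g)) \<in> adj T (edges T - {G})"
      unfolding adj_def g(2) using E Eg by blast
    moreover have "d = c \<or> d = vertex_of T (flip T g)"
      using d(1) g(2) Eg unfolding endpoints_def by auto
    ultimately show ?thesis by auto
  qed
  then show ?thesis using adj_rtrancl_sym[OF cx] dy by (meson rtrancl_trans)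
qed

lemma far_endpoint_dist:
  assumes E: "E\<^sub>1 \<in> edges T" "E \<in> edges T" and far: "far_endpoint T E\<^sub>1 E w" and g: "g \<in> E" "vertex_of T g = w"
  shows "edge_dist T E\<^sub>1 (vertex_of T (flip T g)) < edge_dist T E\<^sub>1 w"
proof -
  have "vertex_of T (flip T g) \<noteq> w" using vertex_of_flip_neq edge_dart[OF E(2) g(1)] g(2) by blast
  moreover have "vertex_of T (flip T g) \<in> endpoints T E"
    using edge_eq[OF E(2) g(1)] unfolding endpoints_def by blast
  ultimately show ?thesis using far unfolding far_endpoint_def by blast
qed

text \<open>
  If two edges had the same far endpoint \<open>w\<close>, then their other ends would be connected without passing
  through \<open>w\<close>, and together with the two edges this would give a cycle.
\<close>

lemma far_endpoint_inj:
  assumes E: "E\<^sub>1 \<in> edges T" "E \<in> edges T" "E' \<in> edges T" "E\<^sub>1 \<noteq> E"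
    and far: "far_endpoint T E\<^sub>1 E w" "far_endpoint T E\<^sub>1 E' w"
  shows "E = E'"
proof (rule ccontr)
  assume ne: "E \<noteq> E'"
  obtain g where g: "g \<in> E" "vertex_of T g = w" using far(1) unfolding far_endpoint_def endpoints_def by auto
  obtain g' where g': "g' \<in> E'" "vertex_of T g' = w" using far(2) unfolding far_endpoint_def endpoints_def by auto
  let ?x = "vertex_of T (flip T g)" and ?y = "vertex_of T (flip T g')"
  let ?R = "(adj T (edges T - {E}))\<^sup>*"
  have w: "w \<in> endpoints T E" using far(1) unfolding far_endpoint_def by blast
  have "(?x, ?y) \<in> ?R"
    by (rule near_vertices_connected[OF E(1,2,4) w])
      (use far_endpoint_dist[OF E(1,2) far(1) g] far_endpoint_dist[OF E(1,3) far(2) g']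
        edge_dart[OF E(2) g(1)] edge_dart[OF E(3) g'(1)] in simp_all)
  moreover have "(w, ?y) \<in> adj T (edges T - {E})"
    unfolding adj_def using g' edge_eq[OF E(3) g'(1)] E(3) ne by blast
  then have "(w, ?y) \<in> ?R" by blast
  ultimately have "(w, ?x) \<in> ?R" using adj_rtrancl_sym by (meson rtrancl_trans)
  moreover have "(w, ?x) \<notin> ?R"
    using acyclic[of g] edge_dart[OF E(2) g(1)] g(2) edge_eq[OF E(2) g(1)] by simp
  ultimately show False by blast
qed

lemma region_of_corner: "R \<in> regions T \<Longrightarrow> g \<in> R \<Longrightarrow> R = region_of T g"
  unfolding regions_def using region_of_eq_iff by blast

lemma one_vertex_rot:
  assumes D: "darts T = Leaf ` {..<n + 3}" and i: "i < n + 3"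
  shows "rot T (Leaf i) = Leaf ((i + 1) mod (n + 3))"
proof -
  obtain h where h: "h \<in> region_of T (Leaf i)" "rot T h = Leaf ((i + 1) mod (n + 3))"
    using next_leaf[OF i] by blast
  have "corner_step T = {}"
  proof -
    have "is_leaf (rot T g)" if "g \<in> darts T" for g
      using that rot_in_darts[of g] unfolding D by auto
    then show ?thesis unfolding corner_step_def by auto
  qed
  then have "h = Leaf i" using region_of_leaf[OF h(1)] by simp
  then show ?thesis using h(2) by simp
qed

text \<open>
  The natural orientation starts at an arbitrary leaf \<open>m\<close>, which causes the rotation.
\<close>

lemma one_vertex_natural_orientation:
  assumes D: "darts T = Leaf ` {..<n + 3}" and V: "vertices T = {r}" and nat: "natural_orientation T \<omega>"
  obtains m where "same_orientation T \<omega> (Vertex r # map Half (rotate m (map Leaf [0..<n + 3])))"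
proof -
  obtain hs where hs: "set hs \<subseteq> darts T" "distinct (map (vertex_of T) hs)" "vertex_of T ` set hs = vertices T"
    "same_orientation T \<omega> (concat (map (vertex_block T) hs))"
    using nat unfolding natural_orientation_def by blast
  have "card (set (map (vertex_of T) hs)) = 1" using hs(3) V by simp
  then have "length hs = 1" using distinct_card[OF hs(2)] by simp
  then obtain h where h: "hs = [h]" by (cases hs) auto
  then obtain m where m: "h = Leaf m" "m < n + 3" using hs(1) D by auto
  have r: "vertex_of T h = r" using hs(3) V h by simp
  have "vertex_of T g = r" if "g \<in> darts T" for g using that V vertex_of_in_vertices by blast
  then have "darts T \<subseteq> r" using self_in_vertex_of by blast
  moreover have "r \<subseteq> darts T" using r vertex_of_subset hs(1) h by auto
  ultimately have "r = darts T" by blast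
  then have card: "card r = n + 3"
    unfolding D by (simp add: card_image inj_on_def)
  have pow: "(rot T ^^ j) (Leaf m) = Leaf ((m + j) mod (n + 3))" for j
  proof (induction j)
    case 0
    then show ?case using m by simp
  next
    case (Suc j)
    then show ?case using one_vertex_rot[OF D, of "(m + j) mod (n + 3)"] by (simp add: mod_Suc_eq)
  qed
  have "map (\<lambda>j. Half ((rot T ^^ j) h)) [0..<n + 3] = map Half (rotate m (map Leaf [0..<n + 3]))"
    by (rule nth_equalityI) (simp_all add: nth_rotate pow m(1) add.commute)
  then have "concat (map (vertex_block T) hs) = Vertex r # map Half (rotate m (map Leaf [0..<n + 3]))"
    by (simp add: h vertex_block_def card r)
  then show ?thesis using that hs(4) by simp
qed

end

section \<open>The regions at an edge of a trivalent tree\<close>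

locale trivalent_edge = trivalent_ribbon_tree n T + collapsed_edge n T a b for n T a b
begin

lemma region_rot_rot_a: "region_of T (rot T (rot T a)) = region_of T b"
  using region_of_flip_rot[of "rot T (rot T a)"] vertex_triple(2)[OF a_dart] a_dart a_inner flip_a by simp

lemma region_rot_rot_b: "region_of T (rot T (rot T b)) = region_of T a"
  using region_of_flip_rot[of "rot T (rot T b)"] vertex_triple(2)[OF b_dart] b_dart b_inner flip_b by simp

lemma region_at_a:
  assumes "R \<in> regions T" "R \<inter> vertex_of T a \<noteq> {}"
  shows "R = region_of T a \<or> R = region_of T b \<or> R = region_of T (rot T a)"
proof -
  obtain g where "g \<in> R" "g \<in> vertex_of T a" using assms(2) by blast
  then have "R = region_of T g" "g = a \<or> g = rot T a \<or> g = rot T (rot T a)"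
    using region_of_corner[OF assms(1)] vertex_triple(3)[OF a_dart] by auto
  then show ?thesis using region_rot_rot_a by metis
qed

lemma region_at_b:
  assumes "R \<in> regions T" "R \<inter> vertex_of T b \<noteq> {}"
  shows "R = region_of T a \<or> R = region_of T b \<or> R = region_of T (rot T b)"
proof -
  obtain g where "g \<in> R" "g \<in> vertex_of T b" using assms(2) by blast
  then have "R = region_of T g" "g = b \<or> g = rot T b \<or> g = rot T (rot T b)"
    using region_of_corner[OF assms(1)] vertex_triple(3)[OF b_dart] by auto
  then show ?thesis using region_rot_rot_b by metis
qed

text \<open>
  Two of the three corners at each end lie in the regions bounding the edge, so each end is touched by
  only one further region. The cyclic order decides which of the two is \<open>a\<^sub>2\<close>.
\<close>

lemma regions_around_edge:
  assumes "bounding_regions T {a, b} = {a\<^sub>1, a\<^sub>3}" "region_of T a = a\<^sub>1"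
    and "touching_regions T {a, b} - {a\<^sub>1, a\<^sub>3} = {a\<^sub>2, b\<^sub>1}"
    and "in_cyclic_order (ccw_regions n T) [a\<^sub>1, a\<^sub>2, a\<^sub>3, b\<^sub>1]"
  shows "a\<^sub>3 = region_of T b" "a\<^sub>2 = region_of T (rot T a)" "b\<^sub>1 = region_of T (rot T b)"
proof -
  obtain i\<^sub>0 m\<^sub>1 m\<^sub>2 m\<^sub>3 where m: "i\<^sub>0 < n + 3" "0 < m\<^sub>1" "m\<^sub>1 < m\<^sub>2" "m\<^sub>2 < m\<^sub>3" "m\<^sub>3 < n + 3"
    "a\<^sub>1 = region_of T (Leaf i\<^sub>0)" "a\<^sub>2 = region_of T (Leaf ((i\<^sub>0 + m\<^sub>1) mod (n + 3)))"
    "a\<^sub>3 = region_of T (Leaf ((i\<^sub>0 + m\<^sub>2) mod (n + 3)))" "b\<^sub>1 = region_of T (Leaf ((i\<^sub>0 + m\<^sub>3) mod (n + 3)))"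
    by (rule cyclic_order4[OF assms(4)])
  have ne: "a\<^sub>1 \<noteq> a\<^sub>3" "a\<^sub>2 \<noteq> b\<^sub>1"
    unfolding m(6-9) region_of_Leaf_eq_iff
    using Leaf_mod_neq[of 0 m\<^sub>2 i\<^sub>0] Leaf_mod_neq[of m\<^sub>1 m\<^sub>3 i\<^sub>0] m(1-5) by auto
  have "{region_of T a, region_of T b} = {a\<^sub>1, a\<^sub>3}" using assms(1) unfolding bounding_regions_def by simp
  then show a3: "a\<^sub>3 = region_of T b" using assms(2) ne(1) by (auto simp: doubleton_eq_iff)
  have mem: "R = region_of T (rot T a) \<or> R = region_of T (rot T b)" if "R \<in> {a\<^sub>2, b\<^sub>1}" for R
  proof -
    have R: "R \<in> touching_regions T {a, b}" "R \<noteq> region_of T a" "R \<noteq> region_of T b"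
      using that assms(2) a3 unfolding assms(3)[symmetric] by auto
    then have "R \<in> regions T" "R \<inter> vertex_of T a \<noteq> {} \<or> R \<inter> vertex_of T b \<noteq> {}"
      unfolding touching_regions_def endpoints_def by auto
    then show ?thesis using region_at_a region_at_b R(2,3) by blast
  qed
  have "\<not> (a\<^sub>2 = region_of T (rot T b) \<and> b\<^sub>1 = region_of T (rot T a))"
    using not_reversed_order assms(2,4) a3 by auto
  then show "a\<^sub>2 = region_of T (rot T a)" "b\<^sub>1 = region_of T (rot T b)"
    using mem[of a\<^sub>2] mem[of b\<^sub>1] ne(2) by auto
qed

lemma region_opposite_edge:
  assumes "touches_only_at T R {a, b} (vertex_of T b)"
  shows "R = region_of T (rot T b)"
proof -
  have R: "R \<in> touching_regions T {a, b}" "R \<noteq> region_of T a" "R \<noteq> region_of T b"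
    "{w \<in> endpoints T {a, b}. R \<inter> w \<noteq> {}} = {vertex_of T b}"
    using assms unfolding touches_only_at_def bounding_regions_def by auto
  then have "R \<in> regions T" "R \<inter> vertex_of T b \<noteq> {}" unfolding touching_regions_def by blast+
  then show ?thesis using region_at_b R(2,3) by blast
qed

end

section \<open>The sign of a simplex\<close>

lemma ex_reordering_with_sign:
  assumes "distinct xs" "length xs \<ge> 2" "s = 1 \<or> s = (-1 :: int)"
  obtains ys where "distinct ys" "set ys = set xs" "word_sign xs ys = s"
proof -
  obtain x y zs where xs: "xs = x # y # zs"
    using assms(2) by (metis Suc_le_length_iff numeral_2_eq_2)
  have "word_sign xs (y # x # zs) = -1"
    using word_sign_swap_blocks_context[of "[]" "[x]" "[y]" zs] assms(1) unfolding xs by simp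
  moreover have "distinct (y # x # zs)" "set (y # x # zs) = set xs" using assms(1) unfolding xs by auto
  ultimately show ?thesis using that[of "y # x # zs"] that[of xs] word_sign_refl[OF assms(1)] assms(1,3) by auto
qed

text \<open>
  The parity of \<open>2 k\<close> transpositions followed by the shuffle of \<open>2 k\<close> triples past three leaves
  and the leaves following the earlier triples.
\<close>

lemma minus_one_power_shuffle: "(-1 :: int) ^ (2 * k + (\<Sum>i<2 * k. 3 + i)) = (-1) ^ k"
proof (induction k)
  case (Suc k)
  have "2 * Suc k + (\<Sum>i<2 * Suc k. 3 + i) = (2 * k + (\<Sum>i<2 * k. 3 + i)) + 2 * (2 * k + 4) + 1"
    by simp
  then show ?case using Suc by (simp only: power_add power_mult) simp
qed simp

lemma minus_one_power_rev: "(-1 :: real) ^ (2 * k * (2 * k - 1) div 2) = (-1) ^ k"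
proof -
  have "2 * k * (2 * k - 1) div 2 = k * (2 * k - 1)" by (simp add: mult.assoc)
  moreover have "odd (2 * k - 1) \<or> k = 0" by (cases k) auto
  then have "even (k * (2 * k - 1)) \<longleftrightarrow> even k" by auto
  ultimately show ?thesis by (simp add: minus_one_power_iff)
qed


lemma cells_one_vertexD:
  assumes "orientation_word U (Vertex r # map Half L)"
  shows "vertices U = {r}" "darts U = set L"
proof -
  have c: "insert (Vertex r) (Half ` set L) = cells U" using assms unfolding orientation_word_def by simp
  have "w \<in> vertices U \<longleftrightarrow> w = r" for w
  proof -
    have "w \<in> vertices U \<longleftrightarrow> Vertex w \<in> cells U" unfolding cells_def by auto
    then show ?thesis unfolding c[symmetric] by auto
  qed
  then show "vertices U = {r}" by blast
  have "h \<in> darts U \<longleftrightarrow> h \<in> set L" for h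
  proof -
    have "h \<in> darts U \<longleftrightarrow> Half h \<in> cells U" unfolding cells_def by auto
    then show ?thesis unfolding c[symmetric] by auto
  qed
  then show "darts U = set L" by blast
qed

lemma word_sign_Vertex_Half:
  assumes "distinct L" "distinct L'" "set L = set L'" "distinct (as @ map Half L)"
  shows "word_sign (as @ map Half L) (as @ map Half L') = word_sign L L'"
proof -
  have "inj_on Half (set L)" by (simp add: inj_on_def)
  then have "word_sign (map Half L) (map Half L') = word_sign L L'"
    using word_sign_map_inj assms by blast
  moreover have "distinct (map Half L')" using assms(2) by (simp add: distinct_map inj_on_def)
  ultimately show ?thesis
    using word_sign_context[of as "map Half L" "[]" "map Half L'"] assms(3,4) by simp
qed

theorem theorem2p6:
  fixes k :: nat
    and P :: "'v::euclidean_space set"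
    and pt :: "mtree \<Rightarrow> 'v"
    and T :: "nat \<Rightarrow> ptree"
    and e :: "nat \<Rightarrow> edge"
    and x :: "nat \<Rightarrow> 'v"
    and \<omega> :: "cell list"
    and B :: "'v list"
    and a\<^sub>1 a\<^sub>2 a\<^sub>3 :: region
    and b :: "nat \<Rightarrow> region"
    and v :: "nat \<Rightarrow> vertex"
  assumes "k \<ge> 1"
    and "stasheff_polytope (2 * k) P pt"
    and "full_chain (2 * k) T e"
    and "\<And>i. i \<le> 2 * k \<Longrightarrow> x i \<in> open_face (2 * k) pt (T i)"
    and "natural_orientation (T (2 * k)) \<omega>"
    and "geometric_orientation (2 * k) pt \<omega> B"
    and "bounding_regions (T 0) (e 1) = {a\<^sub>1, a\<^sub>3}"
    and "touching_regions (T 0) (e 1) - {a\<^sub>1, a\<^sub>3} = {a\<^sub>2, b 1}"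
    and "in_cyclic_order (ccw_regions (2 * k) (T 0)) [a\<^sub>1, a\<^sub>2, a\<^sub>3, b 1]"
    and "\<And>i. i \<in> {2..2 * k} \<Longrightarrow> far_endpoint (T 0) (e 1) (e i) (v i)"
    and "\<And>i. i \<in> {2..2 * k} \<Longrightarrow> touches_only_at (T 0) (b i) (e i) (v i)"
  shows "simplex_sign B (2 * k) (simplex_embedding (2 * k) x) =
    of_int (word_sign (a\<^sub>1 # a\<^sub>2 # a\<^sub>3 # map b [1..<Suc (2 * k)]) (ccw_regions (2 * k) (T 0)))"
proof -
  define n where "n = 2 * k"
  note K = assms(2-11)[folded n_def]
  have n: "n \<ge> 2" "even n" using assms(1) by (simp_all add: n_def)
  interpret A: associahedron_chain n P pt T e
    using K(1,2) by unfold_locales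
  let ?T = "T 0"
  interpret T0: trivalent_ribbon_tree n ?T
    using A.trivalent unfolding trivalent_tree_def by unfold_locales auto
  have edge: "e j \<in> edges ?T" if "j \<in> {1..n}" for j using A.edge_in_chain[of 0 j] that by simp
  have e1: "e 1 \<in> edges ?T" using edge[of 1] n by simp
  have e_inj: "e i = e j \<longleftrightarrow> i = j" if "i \<in> {1..n}" "j \<in> {1..n}" for i j
    using inj_on_eq_iff[OF bij_betw_imp_inj_on[OF A.edges_bij] that] .
  have "a\<^sub>1 \<in> bounding_regions ?T (e 1)" unfolding K(6) by simp
  then obtain h where h: "h \<in> e 1" "region_of ?T h = a\<^sub>1" unfolding bounding_regions_def by auto
  define h' where "h' = flip ?T h"
  have e1_eq: "e 1 = {h, h'}" unfolding h'_def by (rule T0.edge_eq[OF e1 h(1)])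
  have trivalent_edge: "trivalent_edge n ?T g (flip ?T g)" if "g \<in> e j" "j \<in> {1..n}" for g j
    using T0.edge_dart[OF edge[OF that(2)] that(1)] by unfold_locales auto
  interpret E1: trivalent_edge n ?T h h' unfolding h'_def by (rule trivalent_edge[OF h(1)]) (use n in simp)
  have regions1: "a\<^sub>3 = region_of ?T h'" "a\<^sub>2 = region_of ?T (rot ?T h)" "b 1 = region_of ?T (rot ?T h')"
    by (rule E1.regions_around_edge[OF K(6)[unfolded e1_eq] h(2) K(7)[unfolded e1_eq] K(8)])+
  have ends1: "endpoints ?T (e 1) = {vertex_of ?T h, vertex_of ?T h'}" unfolding e1_eq endpoints_def by simp
  \<comment> \<open>the far half of every edge as seen from the root; \<open>e 1\<close> has no far endpoint of its own\<close>
  define u where "u j = (if j = 1 then h' else (SOME d. d \<in> e j \<and> vertex_of ?T d = v j))" for j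
  have u1: "u 1 = h'" by (simp add: u_def)
  have flip_u1: "flip ?T (u 1) = h" unfolding u1 by (rule E1.flip_b)
  have u_ge2: "u j \<in> e j \<and> vertex_of ?T (u j) = v j" if "j \<in> {2..n}" for j
  proof -
    have "\<exists>d. d \<in> e j \<and> vertex_of ?T d = v j"
      using K(9)[OF that] unfolding far_endpoint_def endpoints_def by auto
    then have "(SOME d. d \<in> e j \<and> vertex_of ?T d = v j) \<in> e j \<and>
      vertex_of ?T (SOME d. d \<in> e j \<and> vertex_of ?T d = v j) = v j" by (rule someI_ex)
    then show ?thesis using that by (simp add: u_def)
  qed
  have u_in: "u j \<in> e j" if "j \<in> {1..n}" for j
    using u_ge2[of j] u1 e1_eq that by (cases "j = 1") auto
  have b_region: "b j = region_of ?T (rot ?T (u j))" if j: "j \<in> {1..n}" for j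
  proof (cases "j = 1")
    case True
    then show ?thesis using regions1(3) u1 by simp
  next
    case False
    then have j2: "j \<in> {2..n}" using j by auto
    interpret E: trivalent_edge n ?T "flip ?T (u j)" "flip ?T (flip ?T (u j))"
    proof (rule trivalent_edge[OF _ j])
      show "flip ?T (u j) \<in> e j" using T0.edge_eq[OF edge[OF j] u_in[OF j]] by blast
    qed
    have "e j = {flip ?T (u j), u j}" using T0.edge_eq[OF edge[OF j] u_in[OF j]] by blast
    then show ?thesis using E.region_opposite_edge K(10)[OF j2] u_ge2[OF j2] by simp
  qed
  \<comment> \<open>both ends of \<open>e 1\<close> have distance 0 from it, so the root is set apart from the other end\<close>
  define depth where "depth w = (if w = vertex_of ?T h then 0 else Suc (edge_dist ?T (e 1) w))" for w
  have closer: "edge_dist ?T (e 1) (vertex_of ?T (flip ?T (u j))) < edge_dist ?T (e 1) (v j)" if "j \<in> {2..n}" for j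
    using T0.far_endpoint_dist[OF e1 edge K(9)[OF that]] u_ge2[OF that] that by simp
  have not_end: "v j \<notin> endpoints ?T (e 1)" if "j \<in> {2..n}" for j
    using closer[OF that] T0.edge_dist_endpoint[OF e1] by fastforce
  have v_inj: "i = j" if "i \<in> {2..n}" "j \<in> {2..n}" "v i = v j" for i j
  proof -
    have ij: "i \<in> {1..n}" "j \<in> {1..n}" "1 \<in> {1..n}" using that by auto
    have "e i = e j"
      using T0.far_endpoint_inj[OF e1 edge[OF ij(1)] edge[OF ij(2)] _ K(9)[OF that(1)]] K(9)[OF that(2)]
        that e_inj[OF ij(3) ij(1)] by auto
    then show ?thesis using e_inj ij by blast
  qed
  interpret R: rooted_trivalent_tree n ?T e u h depth
  proof
    show "bij_betw e {1..n} (edges ?T)" by (rule A.edges_bij)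
    show "u j \<in> e j" if "j \<in> {1..n}" for j by (rule u_in[OF that])
    show "h \<in> darts ?T" by (rule E1.a_dart)
    have split: "[1..<Suc n] = 1 # [2..<Suc n]" using n by (simp add: upt_conv_Cons numeral_2_eq_2)
    have vm: "map (vertex_of ?T) (map u [2..<Suc n]) = map v [2..<Suc n]"
      using u_ge2 by (simp add: less_Suc_eq_le)
    have "distinct (map v [2..<Suc n])" using v_inj by (simp add: distinct_map inj_on_def less_Suc_eq_le)
    moreover have "vertex_of ?T h \<notin> set (map v [2..<Suc n])" "vertex_of ?T h' \<notin> set (map v [2..<Suc n])"
      using not_end unfolding ends1 by (force simp: less_Suc_eq_le)+
    ultimately show "distinct (map (vertex_of ?T) (h # map u [1..<Suc n]))"
      unfolding split list.map vm u1 using E1.vertices_ab_neq by simp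
    show "depth (vertex_of ?T (flip ?T (u j))) < depth (vertex_of ?T (u j))" if j: "j \<in> {1..n}" for j
    proof (cases "j = 1")
      case True
      then show ?thesis using flip_u1 u1 E1.vertices_ab_neq by (simp add: depth_def)
    next
      case False
      then have j2: "j \<in> {2..n}" using j by auto
      then have "v j \<noteq> vertex_of ?T h" using not_end unfolding ends1 by blast
      then show ?thesis using closer[OF j2] u_ge2[OF j2] by (simp add: depth_def)
    qed
  qed
  let ?L = R.leaf_list
  define s :: int where "s = (-1) ^ k"
  have s: "s = 1 \<or> s = -1" "s * s = 1" unfolding s_def by (simp_all add: minus_one_power_iff)
  have word0: "A.chain_word u L 0 (vertex_of ?T h) = Vertex (vertex_of ?T h) #
    concat (map (\<lambda>j. [Vertex (vertex_of ?T (u j)), Half (flip ?T (u j)), Half (u j)]) [1..<Suc n]) @ map Half L" for L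
    unfolding A.chain_word_def A.edge_triple_def by simp
  have w0: "orientation_word ?T (A.chain_word u ?L 0 (vertex_of ?T h))"
    "word_sign R.block_word (A.chain_word u ?L 0 (vertex_of ?T h)) = s"
    unfolding word0 s_def using R.chain_word_sign minus_one_power_shuffle[of k] by (simp_all add: n_def)
  \<comment> \<open>the order of the leaves is corrected by the sign \<open>s\<close>, so that the word is a natural orientation\<close>
  obtain L where L: "distinct L" "set L = set ?L" "word_sign ?L L = s"
    by (rule ex_reordering_with_sign[OF R.leaf_list_leaves(1) _ s(1)]) (use R.leaf_list_leaves(3) in auto)
  have lenL: "length L \<ge> 2" using distinct_card[OF L(1)] distinct_card[OF R.leaf_list_leaves(1)] L(2) R.leaf_list_leaves(3) by simp
  define pre where "pre = Vertex (vertex_of ?T h) #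
    concat (map (\<lambda>j. [Vertex (vertex_of ?T (u j)), Half (flip ?T (u j)), Half (u j)]) [1..<Suc n])"
  have wL: "A.chain_word u L' 0 (vertex_of ?T h) = pre @ map Half L'" for L' unfolding word0 pre_def by simp
  have d0: "distinct (pre @ map Half ?L)" "set (pre @ map Half ?L) = cells ?T"
    using w0(1) unfolding wL orientation_word_def by simp_all
  have d1: "distinct (pre @ map Half L)" "set (pre @ map Half L) = cells ?T"
    using d0 L(1,2) by (simp_all add: distinct_map inj_on_def)
  have o1: "orientation_word ?T (A.chain_word u L 0 (vertex_of ?T h))"
    unfolding wL orientation_word_def using d1 by blast
  have "word_sign R.block_word (pre @ map Half L) = word_sign R.block_word (pre @ map Half ?L) * word_sign (pre @ map Half ?L) (pre @ map Half L)"
    by (rule word_sign_trans)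
      (use R.block_word_orientation d0 d1 in \<open>simp_all only: orientation_word_def\<close>)
  also have "word_sign (pre @ map Half ?L) (pre @ map Half L) = s"
    using word_sign_Vertex_Half[OF R.leaf_list_leaves(1) L(1) L(2)[symmetric] d0(1)] L(3) by simp
  also have "word_sign R.block_word (pre @ map Half ?L) = s" using w0(2) unfolding wL .
  finally have nat0: "natural_orientation ?T (A.chain_word u L 0 (vertex_of ?T h))"
    using R.natural_orientationI[OF o1] s(2) unfolding wL by simp
  obtain r where r: "r 0 = vertex_of ?T h" "\<And>i. i \<le> n \<Longrightarrow> orientation_word (T i) (A.chain_word u L i (r i))"
    "\<And>i. i \<in> {1..n} \<Longrightarrow> induced_orientation (T (i - 1)) (e i) (A.chain_word u L (i - 1) (r (i - 1))) (A.chain_word u L i (r i))"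
    using A.induced_chain_words[OF u_in lenL o1] by blast
  let ?W = "\<lambda>i. A.chain_word u L i (r i)"
  have Wn: "?W n = Vertex (r n) # map Half L" unfolding A.chain_word_def by simp
  have B: "ordered_basis B" using K(5) unfolding geometric_orientation_def by blast
  have frame: "frame_sign B (map (\<lambda>i. length_tangent pt ?T (e i)) (rev [1..<Suc n])) = of_int (word_sign (?W n) \<omega>)"
  proof -
    have nat: "natural_orientation ?T (?W 0)" using nat0 r(1) by simp
    show ?thesis
      by (rule K(5)[unfolded geometric_orientation_def, THEN conjunct2, THEN spec[of _ T], THEN spec[of _ e],
            THEN spec[of _ ?W], THEN mp, OF K(2), THEN mp, OF nat, THEN mp]) (intro ballI r(3))
  qed
  let ?leaves = "map Leaf [0..<n + 3]"
  have leaves: "distinct ?leaves" "set ?leaves = Leaf ` {..<n + 3}" "length ?leaves = n + 3"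
    by (auto simp: distinct_map inj_on_def)
  have setL: "set L = set ?leaves" using L(2) R.leaf_list_leaves(2) leaves(2) by simp
  interpret Tn: planar_ribbon_tree n "T n" using A.planar_chain by unfold_locales simp
  have on: "orientation_word (T n) (Vertex (r n) # map Half L)" using r(2)[of n] unfolding Wn by simp
  obtain m where m: "same_orientation (T n) \<omega> (Vertex (r n) # map Half (rotate m ?leaves))"
    by (rule Tn.one_vertex_natural_orientation[OF _ cells_one_vertexD(1)[OF on] K(4)])
      (use cells_one_vertexD(2)[OF on] setL leaves(2) in auto)
  let ?\<omega>' = "Vertex (r n) # map Half (rotate m ?leaves)"
  have sm: "orientation_word (T n) \<omega>" "orientation_word (T n) ?\<omega>'" "word_sign \<omega> ?\<omega>' = 1"
    using m unfolding same_orientation_def by blast+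
  note W = orientation_word_distinct orientation_word_set
  have "word_sign (?W n) \<omega> = word_sign (?W n) ?\<omega>' * word_sign ?\<omega>' \<omega>"
    unfolding Wn by (rule word_sign_trans[OF W(1)[OF on] W(1)[OF sm(2)] W(1)[OF sm(1)]])
      (use W(2)[OF on] W(2)[OF sm(1)] W(2)[OF sm(2)] in simp_all)
  also have "word_sign ?\<omega>' \<omega> = 1"
    using word_sign_sym[OF W(1)[OF sm(1)] W(1)[OF sm(2)]] W(2)[OF sm(1)] W(2)[OF sm(2)] sm(3) by simp
  also have "word_sign (?W n) ?\<omega>' = word_sign L (rotate m ?leaves)"
    unfolding Wn using word_sign_Vertex_Half[of L "rotate m ?leaves" "[Vertex (r n)]"] L(1) setL leaves(1) W(1)[OF on] by simp
  also have "\<dots> = word_sign L ?leaves * word_sign ?leaves (rotate m ?leaves)"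
    by (rule word_sign_trans[OF L(1) leaves(1)]) (use leaves(1) setL in simp_all)
  also have "word_sign ?leaves (rotate m ?leaves) = 1"
    using word_sign_sym[of "rotate m ?leaves" ?leaves] word_sign_rotate[OF leaves(1), of m] leaves(1,3) n(2) by simp
  also have "word_sign L ?leaves = s * word_sign ?L ?leaves"
  proof -
    have "word_sign ?L ?leaves = word_sign ?L L * word_sign L ?leaves"
      by (rule word_sign_trans[OF R.leaf_list_leaves(1) L(1) leaves(1)]) (use L(2) setL in simp_all)
    then show ?thesis using L(3) s(2) by (simp add: mult.assoc[symmetric])
  qed
  also have "word_sign ?L ?leaves = word_sign (map (region_of ?T) ?L) (map (region_of ?T) ?leaves)"
  proof (rule word_sign_map_inj[symmetric])
    show "inj_on (region_of ?T) (set ?L)"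
      unfolding R.leaf_list_leaves(2) by (auto simp: inj_on_def T0.region_of_Leaf_eq_iff)
  qed (use R.leaf_list_leaves leaves in simp_all)
  also have "map (region_of ?T) ?L = a\<^sub>1 # a\<^sub>2 # a\<^sub>3 # map b [1..<Suc n]"
  proof -
    have "map (\<lambda>j. region_of ?T (rot ?T (u j))) [1..<Suc n] = map b [1..<Suc n]"
      using b_region by (intro map_cong) auto
    then show ?thesis unfolding R.region_leaf_list
      using h(2) regions1(1,2) E1.region_rot_rot_a by (simp add: o_def)
  qed
  also have "map (region_of ?T) ?leaves = ccw_regions n ?T"
    unfolding ccw_regions_def by (simp add: o_def)
  finally have sign: "word_sign (?W n) \<omega> = s * word_sign (a\<^sub>1 # a\<^sub>2 # a\<^sub>3 # map b [1..<Suc n]) (ccw_regions n ?T)"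
    by simp
  have "simplex_sign B n (simplex_embedding n x) = (-1) ^ (n * (n - 1) div 2) * of_int (word_sign (?W n) \<omega>)"
    unfolding frame[symmetric] by (rule A.simplex_sign_eq[OF n(2) B]) (rule K(3))
  also have "(-1 :: real) ^ (n * (n - 1) div 2) = of_int s"
    unfolding n_def minus_one_power_rev s_def by simp
  also have "of_int s * of_int (word_sign (?W n) \<omega>) = (of_int (s * s * word_sign (a\<^sub>1 # a\<^sub>2 # a\<^sub>3 # map b [1..<Suc n]) (ccw_regions n ?T)) :: real)"
    unfolding sign by (simp add: mult.assoc)
  finally show ?thesis unfolding s(2) by (simp add: n_def)
qed

end
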